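(* Let $k$ be a commutative ring with $2\in k^\times$, $A$ a commutative $k$-algebra with commuting involutions $\theta,\eta$ over $k$, and $X=\mathrm{Spec}\,A$. Let $(a_\lambda)_{\lambda\in\Lambda}$ be a family of generators of the $k$-algebra $A$ and $i:X\hookrightarrow\mathbb{A}^\Lambda_k$ the corresponding closed immersion. Let $\mathbf{X}(\theta,\eta)=\mathrm{Spec}\,\mathbf{A}(\theta,\eta)$ and let $\tilde i_{\theta,\eta}:\mathbf{X}(\theta,\eta)\hookrightarrow\mathbb{A}^{16\Lambda}_{k[t_1,t_2]}$ be the closed immersion described in the context. Then $\mathbf{X}(\theta,\eta)$ exhibits, via $\tilde i_{\theta,\eta}$, the scheme-theoretic closure of $\mathbf{X}(\theta,\eta)\otimes_{k[t_1,t_2]}k[t_1^{\pm1},t_2^{\pm1}]$ in $\mathbb{A}^{16\Lambda}_{k[t_1,t_2]}$. The base change of $\tilde i_{\theta,\eta}$ to $k[\sqrt{t_1}^{\pm1},\sqrt{t_2}^{\pm1}]$ is identified with the map $$X\otimes_kk[\sqrt{t_1}^{\pm1},\sqrt{t_2}^{\pm1}]\hookrightarrow\mathbb{A}^{16\Lambda}_{k[\sqrt{t_1}^{\pm1},\sqrt{t_2}^{\pm1}]},\qquad x\mapsto\tfrac14(x_{ij})_{1\le i,j\le4},$$ where $x_{jj}=i(x)+i(\theta x)+i(\eta x)+i(\theta\eta x)$ for $1\le j\le4$; $x_{12}=x_{34}=\sqrt{t_1}\,(i(x)-i(\theta x)+i(\eta x)-i(\theta\eta x))$; $x_{13}=x_{24}=\sqrt{t_2}\,(i(x)+i(\theta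 x)-i(\eta x)-i(\theta\eta x))$; $x_{14}=\sqrt{t_1}\sqrt{t_2}\,(i(x)-i(\theta x)-i(\eta x)+i(\theta\eta x))$; $x_{21}=x_{43}=\sqrt{t_1}^{-1}(i(x)-i(\theta x)+i(\eta x)-i(\theta\eta x))$; $x_{23}=\sqrt{t_1}^{-1}\sqrt{t_2}\,(i(x)-i(\theta x)-i(\eta x)+i(\theta\eta x))$; $x_{31}=x_{42}=\sqrt{t_2}^{-1}(i(x)+i(\theta x)-i(\eta x)-i(\theta\eta x))$; $x_{32}=\sqrt{t_1}\sqrt{t_2}^{-1}(i(x)-i(\theta x)-i(\eta x)+i(\theta\eta x))$; $x_{41}=\sqrt{t_1}^{-1}\sqrt{t_2}^{-1}(i(x)-i(\theta x)-i(\eta x)+i(\theta\eta x))$.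
   Context: Contraction: for a commutative ring $R$ with $2\in R^\times$ and a commutative $R$-algebra $C$ with an $R$-linear involution $\sigma$, put $C^{\pm\sigma}=\{c:\sigma(c)=\pm c\}$; the contraction algebra of $(C,\sigma)$ with parameter $s$ is the $R[s]$-subalgebra of the Laurent polynomial ring $C[\sqrt s^{\pm1}]$ ($s=(\sqrt s)^2$) generated by $C^\sigma$ and $\frac{1}{\sqrt s}C^{-\sigma}$. $\mathbf{A}(\theta)$ is the contraction algebra of $(A,\theta)$ over $k$ with parameter $t_1$; $\eta$ extends to an involution of $\mathbf{A}(\theta)$ over $k[t_1]$ (the restriction of $\eta\otimes_kk[\sqrt{t_1}^{\pm1}]$), still written $\eta$; $\mathbf{A}(\theta,\eta)$ is the contraction algebra of $(\mathbf{A}(\theta),\eta)$ over $k[t_1]$ with parameter $t_2$, viewed inside $A[\sqrt{t_1}^{\pm1},\sqrt{t_2}^{\pm1}]$. This inclusion induces $\mathbf{A}(\theta,\eta)\otimes_{k[t_1,t_2]}k[\sqrt{t_1}^{\pm1},\sqrt{t_2}^{\pm1}]\cong A[\sqrt{t_1}^{\pm1},\sqrt{t_2}^{\pm1}]$, which gives the identification of the base change. Embeddings: given a commutative ring $R$ with $2\in R^\times$, a commutative $R$-algebra $C$ with an $R$-linear involution $\sigma$, and a parameter $s$, with $\mathbf{C}\subset C[\sqrt s^{\pm1}]$ the contraction algebra of $(C,\sigma)$ with parameter $s$, and given a generating family $(c_\mu)_{\mu\in M}$ of the $R$-algebra $C$, put $c_{\mu\pm}=\frac{c_\mu\pm\sigma(c_\mu)}2$.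 The associated closed immersion $\mathrm{Spec}\,\mathbf{C}\hookrightarrow\mathbb{A}^{4M}_{R[s]}$ corresponds to the surjection $R[s,x_{pq\mu};1\le p,q\le2,\mu\in M]\to\mathbf{C}$ with $x_{11\mu},x_{22\mu}\mapsto c_{\mu+}$, $x_{12\mu}\mapsto\frac{s}{\sqrt s}c_{\mu-}$, $x_{21\mu}\mapsto\frac1{\sqrt s}c_{\mu-}$. Applying this to $(A,\theta)$ and $(a_\lambda)$ gives $\tilde i_\theta:\mathrm{Spec}\,\mathbf{A}(\theta)\hookrightarrow\mathbb{A}^{4\Lambda}_{k[t_1]}$; applying it again to $(\mathbf{A}(\theta),\eta)$ over $k[t_1]$ with the $4\Lambda$ generators defining $\tilde i_\theta$ gives $\tilde i_{\theta,\eta}$. The 16 coordinate blocks (each indexed by $\Lambda$) are arranged as a $4\times4$ matrix, viewed as a $2\times2$ block matrix whose block index $(p,q)$ comes from the second contraction and whose index inside a block comes from the first. *)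

theory Defs
  imports "HOL-Algebra.UnivPoly" "HOL-Algebra.QuotRing" "HOL-Algebra.Generated_Rings"
    "HOL-Algebra.Elementary_Groups" "HOL-Library.Multiset"
begin

text \<open>
  All schemes in sight are affine.  An affine scheme is represented by its coordinate ring, a
  commutative \<open>R\<close>-algebra by a commutative ring \<open>C\<close> with a structure homomorphism
  \<open>R \<rightarrow> C\<close>, a morphism of affine schemes by its comorphism, and the \<open>S\<close>-points of
  \<open>Spec C\<close> by the homomorphisms \<open>C \<rightarrow> S\<close>.  The carrier-based setting of HOL-Algebra is
  used so that the zero ring is allowed everywhere.
\<close>

section \<open>Polynomial and Laurent polynomial rings\<close>

text \<open>The monoid ring \<open>R[M]\<close> of a commutative monoid \<open>M\<close>: finitely supported
  functions on \<open>carrier M\<close>, extended by zero to the whole type, with the convolution product.\<close>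

definition monoid_ring ::
    "('r, 'x) ring_scheme \<Rightarrow> ('m, 'y) monoid_scheme \<Rightarrow> ('m \<Rightarrow> 'r) ring" where
  "monoid_ring R M =
    \<lparr>carrier = {f. (\<forall>m. f m \<in> carrier R) \<and> (\<forall>m. m \<notin> carrier M \<longrightarrow> f m = \<zero>\<^bsub>R\<^esub>)
                  \<and> finite {m. f m \<noteq> \<zero>\<^bsub>R\<^esub>}},
     monoid.mult = (\<lambda>f g m. finsum R (\<lambda>(a, b). f a \<otimes>\<^bsub>R\<^esub> g b)
                {(a, b). f a \<noteq> \<zero>\<^bsub>R\<^esub> \<and> g b \<noteq> \<zero>\<^bsub>R\<^esub> \<and> a \<otimes>\<^bsub>M\<^esub> b = m}),
     monoid.one = (\<lambda>m. if m = \<one>\<^bsub>M\<^esub> then \<one>\<^bsub>R\<^esub> else \<zero>\<^bsub>R\<^esub>),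
     ring.zero = (\<lambda>m. \<zero>\<^bsub>R\<^esub>),
     ring.add = (\<lambda>f g m. f m \<oplus>\<^bsub>R\<^esub> g m)\<rparr>"

definition single :: "('r, 'x) ring_scheme \<Rightarrow> 'r \<Rightarrow> 'm \<Rightarrow> ('m \<Rightarrow> 'r)" where
  "single R r m = (\<lambda>n. if n = m then r else \<zero>\<^bsub>R\<^esub>)"

text \<open>\<open>laurent C\<close> is \<open>C[u, u\<^sup>-\<^sup>1]\<close>, and \<open>single C c n\<close> is \<open>c u\<^sup>n\<close>.\<close>

abbreviation laurent :: "('c, 'x) ring_scheme \<Rightarrow> (int \<Rightarrow> 'c) ring" where
  "laurent C \<equiv> monoid_ring C integer_group"

text \<open>The polynomial ring \<open>R[x\<^sub>v; v \<in> V]\<close>, the coordinate ring of the affine space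
  of \<open>V\<close> over \<open>R\<close>; monomials are multisets of variables.\<close>

definition monomials :: "'v set \<Rightarrow> 'v multiset monoid" where
  "monomials V = \<lparr>carrier = {m. set_mset m \<subseteq> V}, monoid.mult = (+), monoid.one = {#}\<rparr>"

abbreviation mpoly :: "('r, 'x) ring_scheme \<Rightarrow> 'v set \<Rightarrow> ('v multiset \<Rightarrow> 'r) ring" where
  "mpoly R V \<equiv> monoid_ring R (monomials V)"

abbreviation mpoly_const :: "('r, 'x) ring_scheme \<Rightarrow> 'r \<Rightarrow> ('v multiset \<Rightarrow> 'r)" where
  "mpoly_const R r \<equiv> single R r {#}"

text \<open>The homomorphism \<open>R[x\<^sub>v; v \<in> V] \<rightarrow> D\<close> extending \<open>\<phi> : R \<rightarrow> D\<close> with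
  \<open>x\<^sub>v \<mapsto> d v\<close>; in terms of points, the \<open>D\<close>-point of affine space with coordinates
  \<open>d\<close>.\<close>

definition mpoly_eval ::
    "('r, 'x) ring_scheme \<Rightarrow> ('d, 'y) ring_scheme \<Rightarrow> ('r \<Rightarrow> 'd) \<Rightarrow> ('v \<Rightarrow> 'd)
      \<Rightarrow> ('v multiset \<Rightarrow> 'r) \<Rightarrow> 'd" where
  "mpoly_eval R D \<phi> d f =
    (\<Oplus>\<^bsub>D\<^esub>m\<in>{m. f m \<noteq> \<zero>\<^bsub>R\<^esub>}. \<phi> (f m) \<otimes>\<^bsub>D\<^esub> (\<Otimes>\<^bsub>D\<^esub>v\<in>set_mset m. d v [^]\<^bsub>D\<^esub> count m v))"

text \<open>The homomorphism \<open>R[s] \<rightarrow> C[u, u\<^sup>-\<^sup>1]\<close> with \<open>s \<mapsto> u\<^sup>n\<close> extending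
  \<open>\<phi> : R \<rightarrow> C\<close>.  For \<open>n = 2\<close> the variable \<open>u\<close> plays the role of \<open>\<surd>s\<close>, for
  \<open>n = 1\<close> it is \<open>s\<close> itself.\<close>

definition poly_to_laurent ::
    "('r, 'x) ring_scheme \<Rightarrow> ('c, 'y) ring_scheme \<Rightarrow> ('r \<Rightarrow> 'c) \<Rightarrow> int
      \<Rightarrow> (nat \<Rightarrow> 'r) \<Rightarrow> (int \<Rightarrow> 'c)" where
  "poly_to_laurent R C \<phi> n =
    eval R (laurent C) (\<lambda>r. single C (\<phi> r) 0) (single C \<one>\<^bsub>C\<^esub> n)"

section \<open>Tensor products\<close>

text \<open>The tensor product over \<open>R\<close> of the \<open>R\<close>-algebras \<open>\<beta> : R \<rightarrow> B\<close> and
  \<open>\<gamma> : R \<rightarrow> C\<close>: the free abelian group on \<open>B \<times> C\<close>, made into a ring by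
  \<open>[b, c][b', c'] = [bb', cc']\<close>, modulo additivity in both arguments and
  \<open>R\<close>-balancedness.\<close>

abbreviation free_tensor ::
    "('b, 'x) ring_scheme \<Rightarrow> ('c, 'y) ring_scheme \<Rightarrow> ('b \<times> 'c \<Rightarrow> int) ring" where
  "free_tensor B C \<equiv> monoid_ring INTEG (B \<times>\<times> C)"

definition tensor_ideal ::
    "('r, 'w) ring_scheme \<Rightarrow> ('b, 'x) ring_scheme \<Rightarrow> ('r \<Rightarrow> 'b)
      \<Rightarrow> ('c, 'y) ring_scheme \<Rightarrow> ('r \<Rightarrow> 'c) \<Rightarrow> ('b \<times> 'c \<Rightarrow> int) set" where
  "tensor_ideal R B \<beta> C \<gamma> = Idl\<^bsub>free_tensor B C\<^esub>
    ({single INTEG 1 (b \<oplus>\<^bsub>B\<^esub> b', c) \<ominus>\<^bsub>free_tensor B C\<^esub>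
        (single INTEG 1 (b, c) \<oplus>\<^bsub>free_tensor B C\<^esub> single INTEG 1 (b', c))
        | b b' c. b \<in> carrier B \<and> b' \<in> carrier B \<and> c \<in> carrier C}
     \<union> {single INTEG 1 (b, c \<oplus>\<^bsub>C\<^esub> c') \<ominus>\<^bsub>free_tensor B C\<^esub>
        (single INTEG 1 (b, c) \<oplus>\<^bsub>free_tensor B C\<^esub> single INTEG 1 (b, c'))
        | b c c'. b \<in> carrier B \<and> c \<in> carrier C \<and> c' \<in> carrier C}
     \<union> {single INTEG 1 (\<beta> r \<otimes>\<^bsub>B\<^esub> b, c) \<ominus>\<^bsub>free_tensor B C\<^esub> single INTEG 1 (b, \<gamma> r \<otimes>\<^bsub>C\<^esub> c)
        | r b c. r \<in> carrier R \<and> b \<in> carrier B \<and> c \<in> carrier C})"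

definition tensor ::
    "('r, 'w) ring_scheme \<Rightarrow> ('b, 'x) ring_scheme \<Rightarrow> ('r \<Rightarrow> 'b)
      \<Rightarrow> ('c, 'y) ring_scheme \<Rightarrow> ('r \<Rightarrow> 'c) \<Rightarrow> ('b \<times> 'c \<Rightarrow> int) set ring" where
  "tensor R B \<beta> C \<gamma> = free_tensor B C Quot tensor_ideal R B \<beta> C \<gamma>"

definition pure_tensor ::
    "('r, 'w) ring_scheme \<Rightarrow> ('b, 'x) ring_scheme \<Rightarrow> ('r \<Rightarrow> 'b)
      \<Rightarrow> ('c, 'y) ring_scheme \<Rightarrow> ('r \<Rightarrow> 'c) \<Rightarrow> 'b \<Rightarrow> 'c \<Rightarrow> ('b \<times> 'c \<Rightarrow> int) set" where
  "pure_tensor R B \<beta> C \<gamma> b c =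
    tensor_ideal R B \<beta> C \<gamma> +>\<^bsub>free_tensor B C\<^esub> single INTEG 1 (b, c)"

text \<open>The homomorphism \<open>B \<otimes>\<^sub>R C \<rightarrow> D\<close>, \<open>b \<otimes> c \<mapsto> f b \<cdot> g c\<close>, induced by homomorphisms
  \<open>f : B \<rightarrow> D\<close> and \<open>g : C \<rightarrow> D\<close> that agree on \<open>R\<close>: the common value of
  \<open>\<Sum> n\<^sub>z [z] \<mapsto> \<Sum> n\<^sub>z f (fst z) g (snd z)\<close> on the coset.\<close>

definition tensor_lift ::
    "('d, 'x) ring_scheme \<Rightarrow> ('b \<Rightarrow> 'd) \<Rightarrow> ('c \<Rightarrow> 'd)
      \<Rightarrow> ('b \<times> 'c \<Rightarrow> int) set \<Rightarrow> 'd" where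
  "tensor_lift D f g Q =
    the_elem ((\<lambda>h. \<Oplus>\<^bsub>D\<^esub>z\<in>{z. h z \<noteq> 0}. [h z] \<cdot>\<^bsub>D\<^esub> (f (fst z) \<otimes>\<^bsub>D\<^esub> g (snd z))) ` Q)"

section \<open>Closed immersions and scheme-theoretic closure\<close>

definition closed_immersion ::
    "('p, 'x) ring_scheme \<Rightarrow> ('d, 'y) ring_scheme \<Rightarrow> ('p \<Rightarrow> 'd) \<Rightarrow> bool" where
  "closed_immersion P D f \<longleftrightarrow> f \<in> ring_hom P D \<and> f ` carrier P = carrier D"

text \<open>The morphism \<open>Spec D \<rightarrow> Spec P\<close> given by \<open>f\<close> factors through the closed subscheme
  \<open>Spec (P/I)\<close>.\<close>

definition factors_through ::
    "('p, 'x) ring_scheme \<Rightarrow> ('d, 'y) ring_scheme \<Rightarrow> ('p \<Rightarrow> 'd) \<Rightarrow> 'p set \<Rightarrow> bool" where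
  "factors_through P D f I \<longleftrightarrow>
    ideal I P \<and> (\<exists>g \<in> ring_hom (P Quot I) D. \<forall>p \<in> carrier P. g (I +>\<^bsub>P\<^esub> p) = f p)"

text \<open>\<open>Spec (P/I)\<close> is the smallest closed subscheme through which
  \<open>Spec D \<rightarrow> Spec P\<close> factors; smaller subschemes have larger ideals.\<close>

definition scheme_closure ::
    "('p, 'x) ring_scheme \<Rightarrow> ('d, 'y) ring_scheme \<Rightarrow> ('p \<Rightarrow> 'd) \<Rightarrow> 'p set \<Rightarrow> bool" where
  "scheme_closure P D f I \<longleftrightarrow>
    factors_through P D f I \<and> (\<forall>J. factors_through P D f J \<longrightarrow> J \<subseteq> I)"

section \<open>Contractions\<close>

definition involution_over ::
    "('r, 'x) ring_scheme \<Rightarrow> ('c, 'y) ring_scheme \<Rightarrow> ('r \<Rightarrow> 'c) \<Rightarrow> ('c \<Rightarrow> 'c) \<Rightarrow> bool" where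
  "involution_over R C \<phi> \<sigma> \<longleftrightarrow>
    \<sigma> \<in> ring_hom C C \<and> (\<forall>c \<in> carrier C. \<sigma> (\<sigma> c) = c) \<and> (\<forall>r \<in> carrier R. \<sigma> (\<phi> r) = \<phi> r)"

definition generates_algebra ::
    "('r, 'x) ring_scheme \<Rightarrow> ('c, 'y) ring_scheme \<Rightarrow> ('r \<Rightarrow> 'c) \<Rightarrow> 'c set \<Rightarrow> bool" where
  "generates_algebra R C \<phi> G \<longleftrightarrow>
    G \<subseteq> carrier C \<and> generate_ring C (\<phi> ` carrier R \<union> G) = carrier C"

text \<open>The contraction algebra of \<open>(C, \<sigma>)\<close>, as a subring of \<open>C[u, u\<^sup>-\<^sup>1]\<close> with
  \<open>u = \<surd>s\<close>; its structure homomorphism from \<open>R[s]\<close> is \<open>poly_to_laurent R C \<phi> 2\<close>.\<close>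

definition contraction ::
    "('r, 'x) ring_scheme \<Rightarrow> ('c, 'y) ring_scheme \<Rightarrow> ('r \<Rightarrow> 'c) \<Rightarrow> ('c \<Rightarrow> 'c)
      \<Rightarrow> (int \<Rightarrow> 'c) ring" where
  "contraction R C \<phi> \<sigma> = (laurent C)\<lparr>carrier := generate_ring (laurent C)
    (poly_to_laurent R C \<phi> 2 ` carrier (UP R)
     \<union> {single C c 0 | c. c \<in> carrier C \<and> \<sigma> c = c}
     \<union> {single C c (-1) | c. c \<in> carrier C \<and> \<sigma> c = \<ominus>\<^bsub>C\<^esub> c})\<rparr>"

text \<open>The variables \<open>x\<^sub>p\<^sub>q\<^sub>\<mu>\<close> and their images
  under the closed immersion of the contraction defined by a family of generators.\<close>

definition block_vars :: "'m set \<Rightarrow> (nat \<times> nat \<times> 'm) set" where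
  "block_vars M = {1, 2} \<times> {1, 2} \<times> M"

definition half :: "('c, 'x) ring_scheme \<Rightarrow> 'c \<Rightarrow> 'c" where
  "half C c = inv\<^bsub>C\<^esub> (\<one>\<^bsub>C\<^esub> \<oplus>\<^bsub>C\<^esub> \<one>\<^bsub>C\<^esub>) \<otimes>\<^bsub>C\<^esub> c"

definition contraction_coord ::
    "('c, 'x) ring_scheme \<Rightarrow> ('c \<Rightarrow> 'c) \<Rightarrow> ('m \<Rightarrow> 'c) \<Rightarrow> nat \<times> nat \<times> 'm \<Rightarrow> (int \<Rightarrow> 'c)" where
  "contraction_coord C \<sigma> c = (\<lambda>(p, q, \<mu>).
    if p = q then single C (half C (c \<mu> \<oplus>\<^bsub>C\<^esub> \<sigma> (c \<mu>))) 0
    else if (p, q) = (1, 2) then single C (half C (c \<mu> \<ominus>\<^bsub>C\<^esub> \<sigma> (c \<mu>))) 1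
    else single C (half C (c \<mu> \<ominus>\<^bsub>C\<^esub> \<sigma> (c \<mu>))) (-1))"

definition contraction_embedding ::
    "('r, 'x) ring_scheme \<Rightarrow> ('c, 'y) ring_scheme \<Rightarrow> ('r \<Rightarrow> 'c) \<Rightarrow> ('c \<Rightarrow> 'c) \<Rightarrow> ('m \<Rightarrow> 'c)
      \<Rightarrow> ((nat \<times> nat \<times> 'm) multiset \<Rightarrow> nat \<Rightarrow> 'r) \<Rightarrow> (int \<Rightarrow> 'c)" where
  "contraction_embedding R C \<phi> \<sigma> c =
    mpoly_eval (UP R) (contraction R C \<phi> \<sigma>) (poly_to_laurent R C \<phi> 2) (contraction_coord C \<sigma> c)"

section \<open>The twofold contraction\<close>

text \<open>In \<open>laurent (laurent C)\<close> the inner variable is \<open>\<surd>t\<^sub>1\<close> (or \<open>t\<^sub>1\<close>) and the outer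
  one is \<open>\<surd>t\<^sub>2\<close> (or \<open>t\<^sub>2\<close>); in \<open>UP (UP k)\<close>, that is \<open>k[t\<^sub>1][t\<^sub>2]\<close>, likewise.\<close>

abbreviation laurent2 :: "('c, 'x) ring_scheme \<Rightarrow> (int \<Rightarrow> int \<Rightarrow> 'c) ring" where
  "laurent2 C \<equiv> laurent (laurent C)"

definition single2 :: "('c, 'x) ring_scheme \<Rightarrow> 'c \<Rightarrow> int \<Rightarrow> int \<Rightarrow> (int \<Rightarrow> int \<Rightarrow> 'c)" where
  "single2 C c m n = single (laurent C) (single C c m) n"

definition poly2_to_laurent2 ::
    "('k, 'x) ring_scheme \<Rightarrow> int \<Rightarrow> (nat \<Rightarrow> nat \<Rightarrow> 'k) \<Rightarrow> (int \<Rightarrow> int \<Rightarrow> 'k)" where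
  "poly2_to_laurent2 k n =
    poly_to_laurent (UP k) (laurent k) (poly_to_laurent k k (\<lambda>r. r) n) n"

text \<open>The twofold contraction.  The involution \<open>\<eta>\<close> acts on the contraction of
  \<open>(A, \<theta>)\<close> coefficientwise.\<close>

abbreviation contraction2 ::
    "('k, 'x) ring_scheme \<Rightarrow> ('a, 'y) ring_scheme \<Rightarrow> ('k \<Rightarrow> 'a) \<Rightarrow> ('a \<Rightarrow> 'a) \<Rightarrow> ('a \<Rightarrow> 'a)
      \<Rightarrow> (int \<Rightarrow> int \<Rightarrow> 'a) ring" where
  "contraction2 k A \<iota> \<theta> \<eta> \<equiv>
    contraction (UP k) (contraction k A \<iota> \<theta>) (poly_to_laurent k A \<iota> 2) (\<lambda>f. \<eta> \<circ> f)"

abbreviation contraction2_structure ::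
    "('k, 'x) ring_scheme \<Rightarrow> ('a, 'y) ring_scheme \<Rightarrow> ('k \<Rightarrow> 'a) \<Rightarrow> ('a \<Rightarrow> 'a)
      \<Rightarrow> (nat \<Rightarrow> nat \<Rightarrow> 'k) \<Rightarrow> (int \<Rightarrow> int \<Rightarrow> 'a)" where
  "contraction2_structure k A \<iota> \<theta> \<equiv>
    poly_to_laurent (UP k) (contraction k A \<iota> \<theta>) (poly_to_laurent k A \<iota> 2) 2"

definition contraction2_embedding ::
    "('k, 'x) ring_scheme \<Rightarrow> ('a, 'y) ring_scheme \<Rightarrow> ('k \<Rightarrow> 'a) \<Rightarrow> ('a \<Rightarrow> 'a) \<Rightarrow> ('a \<Rightarrow> 'a)
      \<Rightarrow> ('l \<Rightarrow> 'a) \<Rightarrow> ((nat \<times> nat \<times> nat \<times> nat \<times> 'l) multiset \<Rightarrow> nat \<Rightarrow> nat \<Rightarrow> 'k)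
      \<Rightarrow> (int \<Rightarrow> int \<Rightarrow> 'a)" where
  "contraction2_embedding k A \<iota> \<theta> \<eta> a =
    contraction_embedding (UP k) (contraction k A \<iota> \<theta>) (poly_to_laurent k A \<iota> 2) (\<lambda>f. \<eta> \<circ> f)
      (contraction_coord A \<theta> a)"

text \<open>The four summands are \<open>y = i(x)\<close>, \<open>y\<^sub>\<theta> = i(\<theta>x)\<close>, \<open>y\<^sub>\<eta> = i(\<eta>x)\<close>
  and \<open>y\<^sub>\<theta>\<^sub>\<eta> = i(\<theta>\<eta>x)\<close> (one coordinate of each), and
  \<open>u\<^sub>1, u\<^sub>2\<close> are \<open>\<surd>t\<^sub>1, \<surd>t\<^sub>2\<close>.\<close>

definition point_matrix ::
    "('s, 'x) ring_scheme \<Rightarrow> 's \<Rightarrow> 's \<Rightarrow> 's \<Rightarrow> 's \<Rightarrow> 's \<Rightarrow> 's \<Rightarrow> nat \<Rightarrow> nat \<Rightarrow> 's" where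
  "point_matrix S u\<^sub>1 u\<^sub>2 y y\<^sub>\<theta> y\<^sub>\<eta> y\<^sub>\<theta>\<^sub>\<eta> i j =
    (let pp = y \<oplus>\<^bsub>S\<^esub> y\<^sub>\<theta> \<oplus>\<^bsub>S\<^esub> y\<^sub>\<eta> \<oplus>\<^bsub>S\<^esub> y\<^sub>\<theta>\<^sub>\<eta>;
         mp = y \<ominus>\<^bsub>S\<^esub> y\<^sub>\<theta> \<oplus>\<^bsub>S\<^esub> y\<^sub>\<eta> \<ominus>\<^bsub>S\<^esub> y\<^sub>\<theta>\<^sub>\<eta>;
         pm = y \<oplus>\<^bsub>S\<^esub> y\<^sub>\<theta> \<ominus>\<^bsub>S\<^esub> y\<^sub>\<eta> \<ominus>\<^bsub>S\<^esub> y\<^sub>\<theta>\<^sub>\<eta>;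
         mm = y \<ominus>\<^bsub>S\<^esub> y\<^sub>\<theta> \<ominus>\<^bsub>S\<^esub> y\<^sub>\<eta> \<oplus>\<^bsub>S\<^esub> y\<^sub>\<theta>\<^sub>\<eta>;
         v\<^sub>1 = inv\<^bsub>S\<^esub> u\<^sub>1;
         v\<^sub>2 = inv\<^bsub>S\<^esub> u\<^sub>2
     in if i = j then pp
        else if (i, j) \<in> {(1, 2), (3, 4)} then u\<^sub>1 \<otimes>\<^bsub>S\<^esub> mp
        else if (i, j) \<in> {(1, 3), (2, 4)} then u\<^sub>2 \<otimes>\<^bsub>S\<^esub> pm
        else if (i, j) = (1, 4) then u\<^sub>1 \<otimes>\<^bsub>S\<^esub> u\<^sub>2 \<otimes>\<^bsub>S\<^esub> mm
        else if (i, j) \<in> {(2, 1), (4, 3)} then v\<^sub>1 \<otimes>\<^bsub>S\<^esub> mp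
        else if (i, j) = (2, 3) then v\<^sub>1 \<otimes>\<^bsub>S\<^esub> u\<^sub>2 \<otimes>\<^bsub>S\<^esub> mm
        else if (i, j) \<in> {(3, 1), (4, 2)} then v\<^sub>2 \<otimes>\<^bsub>S\<^esub> pm
        else if (i, j) = (3, 2) then u\<^sub>1 \<otimes>\<^bsub>S\<^esub> v\<^sub>2 \<otimes>\<^bsub>S\<^esub> mm
        else v\<^sub>1 \<otimes>\<^bsub>S\<^esub> v\<^sub>2 \<otimes>\<^bsub>S\<^esub> mm)"

text \<open>The image of the point \<open>x : A \<rightarrow> S\<close> in affine space, where \<open>\<chi>\<close> is the
  structure homomorphism \<open>k[\<surd>t\<^sub>1\<^sup>\<plusminus>\<^sup>1, \<surd>t\<^sub>2\<^sup>\<plusminus>\<^sup>1] \<rightarrow> S\<close>.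
  The point \<open>\<theta>x\<close> is \<open>x \<circ> \<theta>\<close>, and \<open>i(x)\<close> has coordinates \<open>x (a \<lambda>)\<close>.  In a variable
  \<open>(p, q, p', q', \<lambda>)\<close>, the block index \<open>(p, q)\<close> comes from the second contraction and
  \<open>(p', q')\<close> from the first.\<close>

definition matrix_point ::
    "('k, 'x) ring_scheme \<Rightarrow> ('s, 'y) ring_scheme \<Rightarrow> ((int \<Rightarrow> int \<Rightarrow> 'k) \<Rightarrow> 's)
      \<Rightarrow> ('a \<Rightarrow> 'a) \<Rightarrow> ('a \<Rightarrow> 'a) \<Rightarrow> ('l \<Rightarrow> 'a) \<Rightarrow> ('a \<Rightarrow> 's)
      \<Rightarrow> nat \<times> nat \<times> nat \<times> nat \<times> 'l \<Rightarrow> 's" where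
  "matrix_point k S \<chi> \<theta> \<eta> a x = (\<lambda>(p, q, p', q', l).
    inv\<^bsub>S\<^esub> ([(4::nat)] \<cdot>\<^bsub>S\<^esub> \<one>\<^bsub>S\<^esub>) \<otimes>\<^bsub>S\<^esub>
    point_matrix S (\<chi> (single2 k \<one>\<^bsub>k\<^esub> 1 0)) (\<chi> (single2 k \<one>\<^bsub>k\<^esub> 0 1))
      (x (a l)) (x (\<theta> (a l))) (x (\<eta> (a l))) (x (\<theta> (\<eta> (a l))))
      (2 * (p - 1) + p') (2 * (q - 1) + q'))"

end

theory Submission
  imports Defs
begin

text \<open>
  The Laurent polynomial ring \<open>C[\<surd>s\<^sup>\<plusminus>\<^sup>1]\<close> arises from the contraction algebra of
  \<open>(C, \<sigma>)\<close> by adjoining an invertible square root of \<open>s\<close>: writing \<open>c = c\<^sub>+ + c\<^sub>-\<close>,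
  a homomorphism \<open>j\<close> on the contraction and a unit \<open>v\<close> with \<open>v\<^sup>2 = j s\<close> extend via
  \<open>c \<mapsto> j c\<^sub>+ + j (c\<^sub>- / \<surd>s) v\<close>.  Applied twice, this inverts the base change map
  \<open>B \<otimes> k[\<surd>t\<^sub>1\<^sup>\<plusminus>\<^sup>1, \<surd>t\<^sub>2\<^sup>\<plusminus>\<^sup>1] \<rightarrow> A[\<surd>t\<^sub>1\<^sup>\<plusminus>\<^sup>1, \<surd>t\<^sub>2\<^sup>\<plusminus>\<^sup>1]\<close>.
  The embedding is surjective because \<open>(cd)\<^sub>+ = c\<^sub>+ d\<^sub>+ + s (c\<^sub>- / \<surd>s)(d\<^sub>- / \<surd>s)\<close>
  and \<open>(cd)\<^sub>- / \<surd>s = c\<^sub>+ (d\<^sub>- / \<surd>s) + (c\<^sub>- / \<surd>s) d\<^sub>+\<close>.  The closure statement holds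
  because \<open>B\<close> embeds into a ring where \<open>t\<^sub>1, t\<^sub>2\<close> are invertible, and the
  coordinates are compared on the generators of the polynomial ring.
\<close>

section \<open>Homomorphisms and generators\<close>

text \<open>Maps are compared on generators: each ring involved is generated by constants and
  variables, or by two tensor factors, so uniqueness and surjectivity reduce to a few kinds of
  elements, and an isomorphism is recognised by a map back that is a left inverse on generators. The
  obstacle is the nesting of carriers. The second contraction consists of Laurent polynomials over
  the first contraction, not over \<open>laurent A\<close>, so the two square roots cannot be
  adjoined in one stroke: the outer root is adjoined over the first contraction, and the inner root
  is adjoined to the constants of the result. One ring, \<open>laurent2 k\<close>, represents both
  k[t_1, 1/t_1, t_2, 1/t_2] and its extension by square roots; only the map from
  \<open>UP (UP k)\<close> changes, sending t_i to u_i or to u_i^2, and the substitution of u_i^2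
  for u_i passes from one to the other. The factor 1/4 of the matrix is the product of two halvings,
  one in each contraction.\<close>

lemma ring_hom_minus:
  assumes "ring X" "ring D" "F \<in> ring_hom X D" "x \<in> carrier X"
  shows "F (\<ominus>\<^bsub>X\<^esub> x) = \<ominus>\<^bsub>D\<^esub> F x"
proof -
  interpret ring_hom_ring X D F
    using assms by (intro ring_hom_ringI2) auto
  show ?thesis using assms by simp
qed

lemma ring_hom_diff:
  assumes "ring X" "ring D" "F \<in> ring_hom X D" "x \<in> carrier X" "y \<in> carrier X"
  shows "F (x \<ominus>\<^bsub>X\<^esub> y) = F x \<ominus>\<^bsub>D\<^esub> F y"
proof -
  interpret X: ring X by fact
  show ?thesis
    using assms by (simp add: a_minus_def ring_hom_minus ring_hom_add[OF assms(3)])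
qed

text \<open>The elements on which two homomorphisms agree are closed under the ring operations. The
  uniqueness statements for Laurent, polynomial and tensor rings all come from this.\<close>

lemma ring_hom_eq_on_generate_ring:
  assumes X: "ring X" and D: "ring D" and H: "H \<subseteq> carrier X"
    and F: "F \<in> ring_hom X D" and G: "G \<in> ring_hom X D"
    and eq: "\<And>h. h \<in> H \<Longrightarrow> F h = G h" and x: "x \<in> generate_ring X H"
  shows "F x = G x"
proof -
  interpret X: ring X by fact
  note c = X.generate_ring_in_carrier[OF H]
  show ?thesis
    using x
  proof induction
    case one
    then show ?case using ring_hom_one[OF F] ring_hom_one[OF G] by simp
  next
    case (incl h)
    then show ?case by (rule eq)
  next
    case (a_inv h)
    then show ?case by (simp add: ring_hom_minus[OF X D F c] ring_hom_minus[OF X D G c])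
  next
    case (eng_add h1 h2)
    then show ?case by (simp add: ring_hom_add[OF F c c] ring_hom_add[OF G c c])
  next
    case (eng_mult h1 h2)
    then show ?case by (simp add: ring_hom_mult[OF F c c] ring_hom_mult[OF G c c])
  qed
qed

lemma ring_hom_image_subring:
  assumes "ring X" "ring D" "F \<in> ring_hom X D"
  shows "subring (F ` carrier X) D"
proof -
  interpret ring_hom_ring X D F
    using assms by (intro ring_hom_ringI2) auto
  show ?thesis by (rule img_is_subring[OF R.carrier_is_subring])
qed

lemma ring_hom_surj_on_generators:
  assumes "ring X" "ring D" "F \<in> ring_hom X D" "H \<subseteq> F ` carrier X"
    and "carrier D \<subseteq> generate_ring D H"
  shows "F ` carrier X = carrier D"
proof
  show "F ` carrier X \<subseteq> carrier D" using assms(3) by (auto simp: ring_hom_closed)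
  with assms have "generate_ring D H \<subseteq> F ` carrier X"
    by (intro ring.generate_ring_min_subring1 ring_hom_image_subring) auto
  with assms show "carrier D \<subseteq> F ` carrier X" by blast
qed

text \<open>Injectivity comes from \<open>G\<close> undoing \<open>F\<close>, surjectivity from
  generators of \<open>D\<close> lying in the image. The composite \<open>F\<close> after
  \<open>G\<close> is never computed, so \<open>G\<close> has to be known only on the elements
  \<open>F h\<close>.\<close>

lemma ring_iso_by_generators:
  assumes X: "ring X" and D: "ring D" and F: "F \<in> ring_hom X D" and G: "G \<in> ring_hom D X"
    and H: "H \<subseteq> carrier X" and gen: "carrier X \<subseteq> generate_ring X H"
    and GF: "\<And>h. h \<in> H \<Longrightarrow> G (F h) = h"
    and H': "H' \<subseteq> F ` carrier X" and gen': "carrier D \<subseteq> generate_ring D H'"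
  shows "F \<in> ring_iso X D" and "\<And>x. x \<in> carrier X \<Longrightarrow> G (F x) = x"
proof -
  have GF': "G \<circ> F \<in> ring_hom X X" using ring_hom_trans[OF F G] .
  show inv: "\<And>x. x \<in> carrier X \<Longrightarrow> G (F x) = x"
    using ring_hom_eq_on_generate_ring[OF X X H GF' id_ring_hom[unfolded id_def]] gen GF
    by fastforce
  have "F ` carrier X = carrier D"
    by (rule ring_hom_surj_on_generators) fact+
  moreover have "inj_on F (carrier X)"
    using inv by (rule inj_on_inverseI)
  ultimately show "F \<in> ring_iso X D"
    using F by (simp add: ring_iso_def bij_betw_def)
qed

lemma (in ring) generate_ring_subset:
  assumes "G \<subseteq> generate_ring R H" "H \<subseteq> carrier R"
  shows "generate_ring R G \<subseteq> generate_ring R H"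
  using assms
  by (meson generate_ring_incl generate_ring_is_subring generate_ring_min_subring1 subset_trans)

section \<open>Monoid rings\<close>

text \<open>One construction covers three uses: Laurent polynomials (integer exponents), polynomials
  (multisets of variables) and the free abelian group under a tensor product (pairs, with integer
  coefficients).\<close>

locale monoid_ring_setup = R?: cring R + M: comm_monoid M
  for R :: "('r, 'x) ring_scheme" (structure) and M :: "('m, 'y) monoid_scheme"
begin

abbreviation MR where "MR \<equiv> monoid_ring R M"

lemma carrier_MR:
  "f \<in> carrier MR \<longleftrightarrow> (\<forall>m. f m \<in> carrier R) \<and> (\<forall>m. m \<notin> carrier M \<longrightarrow> f m = \<zero>)
    \<and> finite {m. f m \<noteq> \<zero>}"
  by (simp add: monoid_ring_def)

lemma coeff_closed: "f \<in> carrier MR \<Longrightarrow> f m \<in> carrier R"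
  by (simp add: carrier_MR)

lemma add_MR: "f \<oplus>\<^bsub>MR\<^esub> g = (\<lambda>m. f m \<oplus> g m)"
  by (simp add: monoid_ring_def)

lemma zero_MR: "\<zero>\<^bsub>MR\<^esub> = (\<lambda>m. \<zero>)"
  by (simp add: monoid_ring_def)

lemma one_MR: "\<one>\<^bsub>MR\<^esub> = single R \<one> \<one>\<^bsub>M\<^esub>"
  by (simp add: monoid_ring_def single_def)

lemma single_closed [simp, intro]:
  "r \<in> carrier R \<Longrightarrow> m \<in> carrier M \<Longrightarrow> single R r m \<in> carrier MR"
  by (auto simp: carrier_MR single_def intro: finite_subset[of _ "{m}"])

lemma single_add:
  assumes "r \<in> carrier R" "s \<in> carrier R"
  shows "single R (r \<oplus> s) m = single R r m \<oplus>\<^bsub>MR\<^esub> single R s m"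
  using assms by (auto simp: add_MR single_def)

lemma single_zero [simp]: "single R \<zero> m = \<zero>\<^bsub>MR\<^esub>"
  by (auto simp: zero_MR single_def)

lemma zero_in_MR: "\<zero>\<^bsub>MR\<^esub> \<in> carrier MR"
  by (simp add: zero_MR carrier_MR)

lemma add_in_MR: "f \<in> carrier MR \<Longrightarrow> g \<in> carrier MR \<Longrightarrow> f \<oplus>\<^bsub>MR\<^esub> g \<in> carrier MR"
  by (auto simp: carrier_MR add_MR
        intro: finite_subset[of _ "{m. f m \<noteq> \<zero>} \<union> {m. g m \<noteq> \<zero>}"])

lemma support_subset: "f \<in> carrier MR \<Longrightarrow> {m. f m \<noteq> \<zero>} \<subseteq> carrier M"
  by (auto simp: carrier_MR)

lemma support_finite: "f \<in> carrier MR \<Longrightarrow> finite {m. f m \<noteq> \<zero>}"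
  by (auto simp: carrier_MR)

text \<open>The induction runs over a finite set \<open>X\<close> containing the support, so that
  the function left after removing one term, \<open>f(m := \<zero>)\<close>, is covered by the
  hypothesis for the smaller set.\<close>

lemma monoid_ring_induct [consumes 1, case_names zero single add]:
  assumes f: "f \<in> carrier MR" and zero: "P \<zero>\<^bsub>MR\<^esub>"
    and single: "\<And>r m. r \<in> carrier R \<Longrightarrow> m \<in> carrier M \<Longrightarrow> P (single R r m)"
    and add: "\<And>f g. f \<in> carrier MR \<Longrightarrow> g \<in> carrier MR \<Longrightarrow> P f \<Longrightarrow> P g \<Longrightarrow> P (f \<oplus>\<^bsub>MR\<^esub> g)"
  shows "P f"
proof -
  have "finite X \<Longrightarrow> f \<in> carrier MR \<Longrightarrow> {m. f m \<noteq> \<zero>} \<subseteq> X \<Longrightarrow> P f" for X f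
  proof (induction X arbitrary: f rule: finite_induct)
    case empty
    then have "f = \<zero>\<^bsub>MR\<^esub>" by (auto simp: zero_MR)
    then show ?case by (simp add: zero)
  next
    case (insert m X)
    \<comment> \<open>\<open>X\<close> need not lie in the monoid; at a point outside it
      \<open>f\<close> vanishes and there is no term to split off.\<close>
    show ?case
    proof (cases "m \<in> carrier M")
      case False
      then have "f m = \<zero>" using insert.prems(1) by (simp add: carrier_MR)
      then show ?thesis using insert by (intro insert.IH) auto
    next
      case True
      let ?g = "f(m := \<zero>)"
      have g: "?g \<in> carrier MR"
        using insert.prems(1)
        by (auto simp: carrier_MR intro: finite_subset[of _ "{m. f m \<noteq> \<zero>}"])
      have "P ?g" using insert.prems by (intro insert.IH g) (auto split: if_splits)
      moreover have "f = single R (f m) m \<oplus>\<^bsub>MR\<^esub> ?g"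
        using coeff_closed[OF insert.prems(1)] by (auto simp: add_MR single_def)
      ultimately show ?thesis
        using add[OF single_closed g single] insert.prems(1) True by (metis coeff_closed)
    qed
  qed
  then show ?thesis using f support_finite by blast
qed

text \<open>The index set in the definition varies with \<open>f\<close>, \<open>g\<close> and
  \<open>m\<close>. Summing over a fixed rectangle with an indicator allows products with different
  factors to be added term by term.\<close>

lemma mult_MR:
  assumes f: "f \<in> carrier MR" and g: "g \<in> carrier MR" and X: "finite X" "{m. f m \<noteq> \<zero>} \<subseteq> X"
    and Y: "finite Y" "{m. g m \<noteq> \<zero>} \<subseteq> Y"
  shows "(f \<otimes>\<^bsub>MR\<^esub> g) m =
    (\<Oplus>z\<in>X \<times> Y. if fst z \<otimes>\<^bsub>M\<^esub> snd z = m then f (fst z) \<otimes> g (snd z) else \<zero>)"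
proof -
  have "(\<Oplus>z\<in>{(a, b). f a \<noteq> \<zero> \<and> g b \<noteq> \<zero> \<and> a \<otimes>\<^bsub>M\<^esub> b = m}. (\<lambda>(a, b). f a \<otimes> g b) z) =
    (\<Oplus>z\<in>X \<times> Y. if fst z \<otimes>\<^bsub>M\<^esub> snd z = m then f (fst z) \<otimes> g (snd z) else \<zero>)"
    by (rule R.add.finprod_mono_neutral_cong_left) (use assms coeff_closed[OF f] coeff_closed[OF g] in \<open>auto split: if_splits\<close>)
  then show ?thesis by (simp add: monoid_ring_def)
qed

lemma single_mult:
  assumes "r \<in> carrier R" "s \<in> carrier R" "m \<in> carrier M" "n \<in> carrier M"
  shows "single R r m \<otimes>\<^bsub>MR\<^esub> single R s n = single R (r \<otimes> s) (m \<otimes>\<^bsub>M\<^esub> n)"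
proof
  fix p
  have supp: "{p. single R r m p \<noteq> \<zero>} \<subseteq> {m}" "{p. single R s n p \<noteq> \<zero>} \<subseteq> {n}"
    by (auto simp: single_def)
  have "(single R r m \<otimes>\<^bsub>MR\<^esub> single R s n) p =
    (\<Oplus>z\<in>{m} \<times> {n}. if fst z \<otimes>\<^bsub>M\<^esub> snd z = p then single R r m (fst z) \<otimes> single R s n (snd z) else \<zero>)"
    using assms by (intro mult_MR supp) auto
  also have "\<dots> = single R (r \<otimes> s) (m \<otimes>\<^bsub>M\<^esub> n) p"
    using assms by (simp add: single_def)
  finally show "(single R r m \<otimes>\<^bsub>MR\<^esub> single R s n) p = single R (r \<otimes> s) (m \<otimes>\<^bsub>M\<^esub> n) p" .
qed

lemma MR_add_ac:
  assumes "f \<in> carrier MR" "g \<in> carrier MR" "h \<in> carrier MR"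
  shows "(f \<oplus>\<^bsub>MR\<^esub> g) \<oplus>\<^bsub>MR\<^esub> h = f \<oplus>\<^bsub>MR\<^esub> (g \<oplus>\<^bsub>MR\<^esub> h)" "f \<oplus>\<^bsub>MR\<^esub> g = g \<oplus>\<^bsub>MR\<^esub> f"
    "\<zero>\<^bsub>MR\<^esub> \<oplus>\<^bsub>MR\<^esub> f = f"
  using coeff_closed[OF assms(1)] coeff_closed[OF assms(2)] coeff_closed[OF assms(3)]
  by (auto simp: add_MR zero_MR a_assoc intro: a_comm)

lemma MR_distrib:
  assumes f: "f \<in> carrier MR" and g: "g \<in> carrier MR" and h: "h \<in> carrier MR"
  shows "(f \<oplus>\<^bsub>MR\<^esub> g) \<otimes>\<^bsub>MR\<^esub> h = f \<otimes>\<^bsub>MR\<^esub> h \<oplus>\<^bsub>MR\<^esub> g \<otimes>\<^bsub>MR\<^esub> h"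
    and "h \<otimes>\<^bsub>MR\<^esub> (f \<oplus>\<^bsub>MR\<^esub> g) = h \<otimes>\<^bsub>MR\<^esub> f \<oplus>\<^bsub>MR\<^esub> h \<otimes>\<^bsub>MR\<^esub> g"
proof -
  define X where "X = {m. f m \<noteq> \<zero>} \<union> {m. g m \<noteq> \<zero>}"
  define Y where "Y = {m. h m \<noteq> \<zero>}"
  have fin: "finite X" "finite Y" using assms by (auto simp: X_def Y_def carrier_MR)
  have sub: "{m. f m \<noteq> \<zero>} \<subseteq> X" "{m. g m \<noteq> \<zero>} \<subseteq> X" "{m. h m \<noteq> \<zero>} \<subseteq> Y"
    "{m. (f \<oplus>\<^bsub>MR\<^esub> g) m \<noteq> \<zero>} \<subseteq> X"
    by (auto simp: X_def Y_def add_MR)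
  show "(f \<oplus>\<^bsub>MR\<^esub> g) \<otimes>\<^bsub>MR\<^esub> h = f \<otimes>\<^bsub>MR\<^esub> h \<oplus>\<^bsub>MR\<^esub> g \<otimes>\<^bsub>MR\<^esub> h"
    unfolding add_MR[of "f \<otimes>\<^bsub>MR\<^esub> h"]
    apply (rule ext)
    apply (simp only: mult_MR[OF add_in_MR[OF f g] h fin(1) sub(4) fin(2) sub(3)]
      mult_MR[OF f h fin(1) sub(1) fin(2) sub(3)] mult_MR[OF g h fin(1) sub(2) fin(2) sub(3)])
    apply (subst R.finsum_addf[symmetric])
      prefer 3
      apply (rule R.finsum_cong')
    using coeff_closed[OF f] coeff_closed[OF g] coeff_closed[OF h]
    by (auto simp: add_MR l_distr)
  show "h \<otimes>\<^bsub>MR\<^esub> (f \<oplus>\<^bsub>MR\<^esub> g) = h \<otimes>\<^bsub>MR\<^esub> f \<oplus>\<^bsub>MR\<^esub> h \<otimes>\<^bsub>MR\<^esub> g"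
    unfolding add_MR[of "h \<otimes>\<^bsub>MR\<^esub> f"]
    apply (rule ext)
    apply (simp only: mult_MR[OF h add_in_MR[OF f g] fin(2) sub(3) fin(1) sub(4)]
      mult_MR[OF h f fin(2) sub(3) fin(1) sub(1)] mult_MR[OF h g fin(2) sub(3) fin(1) sub(2)])
    apply (subst R.finsum_addf[symmetric])
      prefer 3
      apply (rule R.finsum_cong')
    using coeff_closed[OF f] coeff_closed[OF g] coeff_closed[OF h]
    by (auto simp: add_MR r_distr)
qed

lemma MR_mult_zero:
  assumes "f \<in> carrier MR"
  shows "\<zero>\<^bsub>MR\<^esub> \<otimes>\<^bsub>MR\<^esub> f = \<zero>\<^bsub>MR\<^esub>" "f \<otimes>\<^bsub>MR\<^esub> \<zero>\<^bsub>MR\<^esub> = \<zero>\<^bsub>MR\<^esub>"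
  by (simp_all add: monoid_ring_def)

text \<open>Additivity in every factor reduces this and the next two lemmas to single terms, where
  the claim is a law of the coefficient ring and of the monoid.\<close>

lemma mult_in_MR:
  assumes f: "f \<in> carrier MR" and g: "g \<in> carrier MR"
  shows "f \<otimes>\<^bsub>MR\<^esub> g \<in> carrier MR"
  using f
proof (induction rule: monoid_ring_induct)
  case zero
  then show ?case using g by (simp add: MR_mult_zero zero_in_MR)
next
  case (single r m)
  show ?case
    using g
  proof (induction rule: monoid_ring_induct)
    case (single s n)
    then show ?case
      using \<open>r \<in> carrier R\<close> \<open>m \<in> carrier M\<close> by (simp add: single_mult)
  qed (use single in \<open>auto simp: MR_mult_zero zero_in_MR MR_distrib intro: add_in_MR\<close>)
next
  case (add f1 f2)
  then show ?case using g by (simp add: MR_distrib add_in_MR)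
qed

lemma MR_comm:
  assumes f: "f \<in> carrier MR" and g: "g \<in> carrier MR"
  shows "f \<otimes>\<^bsub>MR\<^esub> g = g \<otimes>\<^bsub>MR\<^esub> f"
  using f
proof (induction rule: monoid_ring_induct)
  case zero
  then show ?case using g by (simp add: MR_mult_zero)
next
  case (single r m)
  show ?case
    using g
  proof (induction rule: monoid_ring_induct)
    case (single s n)
    then show ?case
      using \<open>r \<in> carrier R\<close> \<open>m \<in> carrier M\<close> by (simp add: single_mult m_comm M.m_comm)
  qed (use single in \<open>auto simp: MR_mult_zero MR_distrib\<close>)
next
  case (add f1 f2)
  then show ?case using g by (simp add: MR_distrib)
qed

lemma MR_assoc:
  assumes f: "f \<in> carrier MR" and g: "g \<in> carrier MR" and h: "h \<in> carrier MR"
  shows "(f \<otimes>\<^bsub>MR\<^esub> g) \<otimes>\<^bsub>MR\<^esub> h = f \<otimes>\<^bsub>MR\<^esub> (g \<otimes>\<^bsub>MR\<^esub> h)"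
  using f
proof (induction rule: monoid_ring_induct)
  case zero
  then show ?case using g h by (simp add: MR_mult_zero mult_in_MR)
next
  case rm: (single r m)
  show ?case
    using g
  proof (induction rule: monoid_ring_induct)
    case zero
    then show ?case using rm h by (simp add: MR_mult_zero mult_in_MR)
  next
    case sn: (single s n)
    show ?case
      using h
    proof (induction rule: monoid_ring_induct)
      case (single t p)
      then show ?case using rm sn by (simp add: single_mult m_assoc M.m_assoc)
    qed (use rm sn in \<open>auto simp: MR_mult_zero mult_in_MR MR_distrib\<close>)
  next
    case (add g1 g2)
    then show ?case using rm h by (simp add: MR_distrib mult_in_MR)
  qed
next
  case (add f1 f2)
  then show ?case using g h by (simp add: MR_distrib mult_in_MR)
qed

lemma monoid_ring_cring: "cring MR"
proof (intro cringI abelian_groupI comm_monoidI)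
  fix f assume f: "f \<in> carrier MR"
  have "(\<lambda>m. \<ominus> f m) \<in> carrier MR"
    using f by (auto simp: carrier_MR intro: finite_subset[of _ "{m. f m \<noteq> \<zero>}"])
  moreover have "(\<lambda>m. \<ominus> f m) \<oplus>\<^bsub>MR\<^esub> f = \<zero>\<^bsub>MR\<^esub>"
    using coeff_closed[OF f] by (auto simp: add_MR zero_MR l_neg)
  ultimately show "\<exists>g\<in>carrier MR. g \<oplus>\<^bsub>MR\<^esub> f = \<zero>\<^bsub>MR\<^esub>" by blast
  show "\<one>\<^bsub>MR\<^esub> \<otimes>\<^bsub>MR\<^esub> f = f"
    using f
    by (induction rule: monoid_ring_induct)
      (auto simp: one_MR single_mult MR_mult_zero MR_distrib)
qed (auto simp: add_in_MR zero_in_MR MR_add_ac(1,3) MR_distrib mult_in_MR MR_assoc one_MR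
    intro: MR_comm MR_add_ac(2))

sublocale MR: cring MR by (rule monoid_ring_cring)

lemma single_uminus: "r \<in> carrier R \<Longrightarrow> m \<in> carrier M \<Longrightarrow> single R (\<ominus> r) m = \<ominus>\<^bsub>MR\<^esub> single R r m"
  by (rule sym, rule MR.minus_equality) (auto simp: single_add[symmetric] l_neg)

lemma const_ring_hom: "(\<lambda>r. single R r \<one>\<^bsub>M\<^esub>) \<in> ring_hom R MR"
  by (rule ring_hom_memI) (auto simp: single_mult single_add one_MR)

lemma MR_generated:
  "carrier MR \<subseteq> generate_ring MR ((\<lambda>r. single R r \<one>\<^bsub>M\<^esub>) ` carrier R \<union> single R \<one> ` carrier M)"
    (is "_ \<subseteq> generate_ring MR ?H")
proof
  fix f assume "f \<in> carrier MR"
  then show "f \<in> generate_ring MR ?H"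
  proof (induction rule: monoid_ring_induct)
    case zero
    show ?case by (rule MR.zero_in_generate)
  next
    case (single r m)
    then have "single R r \<one>\<^bsub>M\<^esub> \<otimes>\<^bsub>MR\<^esub> single R \<one> m \<in> generate_ring MR ?H"
      by (intro generate_ring.intros(2,5)) auto
    then show ?case using single by (simp add: single_mult)
  next
    case (add f g)
    then show ?case by (simp add: generate_ring.eng_add)
  qed
qed

end

text \<open>The common form of polynomial evaluation, of evaluation at a unit in a Laurent ring and
  of the sum inside \<open>tensor_lift\<close>. The function \<open>h\<close> is meant to be a
  monoid homomorphism into the multiplicative monoid of \<open>D\<close>, as the locale below
  requires.\<close>

definition monoid_ring_lift ::
    "('r, 'x) ring_scheme \<Rightarrow> ('d, 'y) ring_scheme \<Rightarrow> ('r \<Rightarrow> 'd) \<Rightarrow> ('m \<Rightarrow> 'd) \<Rightarrow> ('m \<Rightarrow> 'r) \<Rightarrow> 'd" where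
  "monoid_ring_lift R D \<phi> h f = (\<Oplus>\<^bsub>D\<^esub>m\<in>{m. f m \<noteq> \<zero>\<^bsub>R\<^esub>}. \<phi> (f m) \<otimes>\<^bsub>D\<^esub> h m)"

locale monoid_ring_hom = monoid_ring_setup R M + D: cring D
  for R :: "('r, 'x) ring_scheme" (structure) and M :: "('m, 'y) monoid_scheme"
    and D :: "('d, 'z) ring_scheme" +
  fixes \<phi> and h
  assumes \<phi>: "\<phi> \<in> ring_hom R D"
    and h_closed: "\<And>m. m \<in> carrier M \<Longrightarrow> h m \<in> carrier D"
    and h_one: "h \<one>\<^bsub>M\<^esub> = \<one>\<^bsub>D\<^esub>"
    and h_mult: "\<And>m n. m \<in> carrier M \<Longrightarrow> n \<in> carrier M \<Longrightarrow> h (m \<otimes>\<^bsub>M\<^esub> n) = h m \<otimes>\<^bsub>D\<^esub> h n"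
begin

text \<open>Terms outside the support vanish because \<phi> preserves zero. Additivity needs this
  freedom, in order to sum two functions over a common index set.\<close>

lemma lift_eq:
  assumes f: "f \<in> carrier MR" and X: "finite X" "{m. f m \<noteq> \<zero>} \<subseteq> X" "X \<subseteq> carrier M"
  shows "monoid_ring_lift R D \<phi> h f = (\<Oplus>\<^bsub>D\<^esub>m\<in>X. \<phi> (f m) \<otimes>\<^bsub>D\<^esub> h m)"
  unfolding monoid_ring_lift_def
proof (rule D.add.finprod_mono_neutral_cong_left)
  have "\<phi> \<zero> = \<zero>\<^bsub>D\<^esub>" by (rule ring_hom_zero[OF \<phi>]) unfold_locales
  then show "\<phi> (f m) \<otimes>\<^bsub>D\<^esub> h m = \<zero>\<^bsub>D\<^esub>" if "m \<in> X - {m. f m \<noteq> \<zero>}" for m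
    using that X(3) by (auto simp: h_closed)
qed (use assms coeff_closed[OF f] in \<open>auto intro!: D.m_closed ring_hom_closed[OF \<phi>] h_closed\<close>)

lemma lift_single:
  assumes "r \<in> carrier R" "m \<in> carrier M"
  shows "monoid_ring_lift R D \<phi> h (single R r m) = \<phi> r \<otimes>\<^bsub>D\<^esub> h m"
proof -
  have "monoid_ring_lift R D \<phi> h (single R r m) = (\<Oplus>\<^bsub>D\<^esub>p\<in>{m}. \<phi> (single R r m p) \<otimes>\<^bsub>D\<^esub> h p)"
    using assms by (intro lift_eq single_closed) (auto simp: single_def)
  then show ?thesis
    using assms by (simp add: single_def h_closed ring_hom_closed[OF \<phi>])
qed

lemma lift_closed: "f \<in> carrier MR \<Longrightarrow> monoid_ring_lift R D \<phi> h f \<in> carrier D"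
  unfolding monoid_ring_lift_def using support_subset[of f] coeff_closed[of f]
  by (intro D.finsum_closed) (auto intro!: D.m_closed ring_hom_closed[OF \<phi>] h_closed)

lemma lift_add:
  assumes f: "f \<in> carrier MR" and g: "g \<in> carrier MR"
  shows "monoid_ring_lift R D \<phi> h (f \<oplus>\<^bsub>MR\<^esub> g)
    = monoid_ring_lift R D \<phi> h f \<oplus>\<^bsub>D\<^esub> monoid_ring_lift R D \<phi> h g"
proof -
  define X where "X = {m. f m \<noteq> \<zero>} \<union> {m. g m \<noteq> \<zero>}"
  have fin: "finite X" "X \<subseteq> carrier M" using assms by (auto simp: X_def carrier_MR)
  then have hX: "h m \<in> carrier D" if "m \<in> X" for m using that h_closed by blast
  have sub: "{m. f m \<noteq> \<zero>} \<subseteq> X" "{m. g m \<noteq> \<zero>} \<subseteq> X" "{m. (f \<oplus>\<^bsub>MR\<^esub> g) m \<noteq> \<zero>} \<subseteq> X"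
    by (auto simp: X_def add_MR)
  show ?thesis
    unfolding lift_eq[OF f fin(1) sub(1) fin(2)] lift_eq[OF g fin(1) sub(2) fin(2)]
      lift_eq[OF MR.a_closed[OF f g] fin(1) sub(3) fin(2)]
    apply (subst D.finsum_addf[symmetric])
      prefer 3
      apply (rule D.finsum_cong')
    using coeff_closed[OF f] coeff_closed[OF g] hX
    by (auto simp: add_MR D.l_distr ring_hom_add[OF \<phi>] ring_hom_closed[OF \<phi>])
qed

lemma lift_ring_hom: "monoid_ring_lift R D \<phi> h \<in> ring_hom MR D"
proof (rule ring_hom_memI)
  fix f g assume f: "f \<in> carrier MR" and g: "g \<in> carrier MR"
  let ?F = "monoid_ring_lift R D \<phi> h"
  have 0: "?F \<zero>\<^bsub>MR\<^esub> = \<zero>\<^bsub>D\<^esub>" by (simp add: monoid_ring_lift_def zero_MR)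
  show "?F (f \<otimes>\<^bsub>MR\<^esub> g) = ?F f \<otimes>\<^bsub>D\<^esub> ?F g"
    using f
  proof (induction rule: monoid_ring_induct)
    case zero
    then show ?case using g by (simp add: 0 lift_closed)
  next
    case rm: (single r m)
    show ?case
      using g
    proof (induction rule: monoid_ring_induct)
      case zero
      then show ?case using rm by (simp add: 0 lift_closed)
    next
      case (single s n)
      then show ?case
        using rm by (simp add: single_mult lift_single ring_hom_mult[OF \<phi>] ring_hom_closed[OF \<phi>]
          h_closed h_mult D.m_ac)
    next
      case (add g1 g2)
      then show ?case using rm by (simp add: MR.r_distr lift_add lift_closed D.r_distr)
    qed
  next
    case (add f1 f2)
    then show ?case using g by (simp add: MR.l_distr lift_add lift_closed D.l_distr)
  qed
qed (auto simp: lift_closed lift_add one_MR lift_single h_one ring_hom_one[OF \<phi>])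

end

text \<open>Zero goes to zero, so supports stay finite, and single terms go to single terms;
  multiplicativity then follows by induction on both factors. The map is kept in pointwise form
  because the coefficient maps of the theorem are written that way.\<close>

lemma monoid_ring_map_hom:
  fixes M :: "('m, 'y) monoid_scheme"
  assumes R: "cring R" and R': "cring R'" and M: "comm_monoid M" and \<phi>: "\<phi> \<in> ring_hom R R'"
  shows "(\<lambda>f m. \<phi> (f m)) \<in> ring_hom (monoid_ring R M) (monoid_ring R' M)"
proof -
  interpret R: monoid_ring_setup R M using R M by (simp add: monoid_ring_setup_def)
  interpret R': monoid_ring_setup R' M using R' M by (simp add: monoid_ring_setup_def)
  have 0: "\<phi> \<zero>\<^bsub>R\<^esub> = \<zero>\<^bsub>R'\<^esub>" by (rule ring_hom_zero[OF \<phi> R.ring_axioms R'.ring_axioms])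
  define F where "F = (\<lambda>f (m :: 'm). \<phi> (f m))"
  have F_single: "F (single R r m) = single R' (\<phi> r) m" for r m
    by (auto simp: F_def single_def 0)
  have closed: "F f \<in> carrier R'.MR" if "f \<in> carrier R.MR" for f
    using that
    by (auto simp: F_def R.carrier_MR R'.carrier_MR 0 ring_hom_closed[OF \<phi>]
        intro: finite_subset[of _ "{m. f m \<noteq> \<zero>\<^bsub>R\<^esub>}"])
  have F_add: "F (f \<oplus>\<^bsub>R.MR\<^esub> g) = F f \<oplus>\<^bsub>R'.MR\<^esub> F g" if "f \<in> carrier R.MR" "g \<in> carrier R.MR" for f g
    using R.coeff_closed[OF that(1)] R.coeff_closed[OF that(2)]
    by (auto simp: F_def R.add_MR R'.add_MR ring_hom_add[OF \<phi>])
  have F_zero: "F \<zero>\<^bsub>R.MR\<^esub> = \<zero>\<^bsub>R'.MR\<^esub>" by (simp add: F_def R.zero_MR R'.zero_MR 0)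
  show ?thesis
    unfolding F_def[symmetric]
  proof (rule ring_hom_memI)
    fix f g assume f: "f \<in> carrier R.MR" and g: "g \<in> carrier R.MR"
    show "F (f \<otimes>\<^bsub>R.MR\<^esub> g) = F f \<otimes>\<^bsub>R'.MR\<^esub> F g"
      using f
    proof (induction rule: R.monoid_ring_induct)
      case zero
      then show ?case using g closed[OF g] F_zero by simp
    next
      case rm: (single r m)
      show ?case
        using g
      proof (induction rule: R.monoid_ring_induct)
        case zero
        then show ?case using rm closed[OF R.single_closed[OF rm]] F_zero by simp
      next
        case (single s n)
        with rm show ?case
          by (simp add: R.single_mult R'.single_mult F_single ring_hom_mult[OF \<phi>]
              ring_hom_closed[OF \<phi>])
      next
        case (add g1 g2)
        note c = R.single_closed[OF rm]
        show ?case
          using add(3,4)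
          unfolding R.MR.r_distr[OF add(1,2) c]
            F_add[OF R.MR.m_closed[OF c add(1)] R.MR.m_closed[OF c add(2)]] F_add[OF add(1,2)]
            R'.MR.r_distr[OF closed[OF add(1)] closed[OF add(2)] closed[OF c]]
          by simp
      qed
    next
      case (add f1 f2)
      show ?case
        using add(3,4)
        unfolding R.MR.l_distr[OF add(1,2) g]
          F_add[OF R.MR.m_closed[OF add(1) g] R.MR.m_closed[OF add(2) g]] F_add[OF add(1,2)]
          R'.MR.l_distr[OF closed[OF add(1)] closed[OF add(2)] closed[OF g]]
        by simp
    qed
  next
    show "F \<one>\<^bsub>R.MR\<^esub> = \<one>\<^bsub>R'.MR\<^esub>"
      by (simp add: R.one_MR R'.one_MR F_single ring_hom_one[OF \<phi>])
  qed (auto simp: closed F_add)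
qed

section \<open>Polynomial rings and Laurent polynomial rings\<close>

lemma UP_is_cring:
  assumes "cring R"
  shows "cring (UP R)"
proof -
  interpret UP_cring R "UP R" using assms by (simp add: UP_cring_def)
  show ?thesis by (rule UP_cring)
qed

text \<open>Monomials are reached from constants by multiplying with the variable, one degree at a
  time; \<open>up_repr\<close> then writes a polynomial as a sum of monomials.\<close>

lemma UP_generated:
  assumes "cring R"
  shows "carrier (UP R) \<subseteq>
    generate_ring (UP R) ((\<lambda>r. monom (UP R) r 0) ` carrier R \<union> {monom (UP R) \<one>\<^bsub>R\<^esub> 1})"
    (is "_ \<subseteq> generate_ring _ ?H")
proof
  interpret UP_cring R "UP R" using assms by (simp add: UP_cring_def)
  interpret P: cring "UP R" by (rule UP_cring)
  have H: "?H \<subseteq> carrier (UP R)" by auto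
  have monom: "monom (UP R) r n \<in> generate_ring (UP R) ?H" if r: "r \<in> carrier R" for r n
  proof (induction n)
    case 0
    show ?case using r by (intro generate_ring.incl) auto
  next
    case (Suc n)
    have "monom (UP R) (r \<otimes>\<^bsub>R\<^esub> \<one>\<^bsub>R\<^esub>) (n + 1) = monom (UP R) r n \<otimes>\<^bsub>UP R\<^esub> monom (UP R) \<one>\<^bsub>R\<^esub> 1"
      using r by (intro monom_mult) auto
    moreover have "monom (UP R) r n \<otimes>\<^bsub>UP R\<^esub> monom (UP R) \<one>\<^bsub>R\<^esub> 1 \<in> generate_ring (UP R) ?H"
      by (intro generate_ring.eng_mult Suc generate_ring.incl) auto
    ultimately show ?case using r by simp
  qed
  fix p assume p: "p \<in> carrier (UP R)"
  have "(\<Oplus>\<^bsub>UP R\<^esub>i\<in>X. monom (UP R) (coeff (UP R) p i) i) \<in> generate_ring (UP R) ?H"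
    if "finite X" for X
    using that
  proof induction
    case empty
    show ?case by (simp add: P.zero_in_generate)
  next
    case (insert i X)
    then show ?case using p monom by (simp add: P.finsum_insert Pi_def generate_ring.eng_add)
  qed
  from this[of "{..deg R p}"] show "p \<in> generate_ring (UP R) ?H"
    by (simp add: up_repr[OF p])
qed

section \<open>Laurent polynomials: generators and universal property\<close>

lemma laurent_setup: "cring C \<Longrightarrow> monoid_ring_setup C integer_group"
  using abelian_integer_group by (simp add: monoid_ring_setup_def comm_group_def)

lemma laurent_cring: "cring C \<Longrightarrow> cring (laurent C)"
  by (rule monoid_ring_setup.monoid_ring_cring[OF laurent_setup])

lemma laurent_single_closed:
  "cring C \<Longrightarrow> c \<in> carrier C \<Longrightarrow> single C c n \<in> carrier (laurent C)"
  by (simp add: monoid_ring_setup.single_closed[OF laurent_setup])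

lemma laurent_single_mult:
  assumes "cring C" "c \<in> carrier C" "d \<in> carrier C"
  shows "single C c m \<otimes>\<^bsub>laurent C\<^esub> single C d n = single C (c \<otimes>\<^bsub>C\<^esub> d) (m + n)"
  using assms by (simp add: monoid_ring_setup.single_mult[OF laurent_setup])

lemma laurent_single_add:
  assumes "cring C" "c \<in> carrier C" "d \<in> carrier C"
  shows "single C c m \<oplus>\<^bsub>laurent C\<^esub> single C d m = single C (c \<oplus>\<^bsub>C\<^esub> d) m"
  using assms by (simp add: monoid_ring_setup.single_add[OF laurent_setup])

lemma laurent_single_uminus:
  assumes "cring C" "c \<in> carrier C"
  shows "\<ominus>\<^bsub>laurent C\<^esub> single C c m = single C (\<ominus>\<^bsub>C\<^esub> c) m"
  using assms by (simp add: monoid_ring_setup.single_uminus[OF laurent_setup])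

lemma laurent_one: "cring C \<Longrightarrow> \<one>\<^bsub>laurent C\<^esub> = single C \<one>\<^bsub>C\<^esub> 0"
  by (simp add: monoid_ring_setup.one_MR[OF laurent_setup])

lemma laurent_const_hom: "cring C \<Longrightarrow> (\<lambda>c. single C c 0) \<in> ring_hom C (laurent C)"
  using monoid_ring_setup.const_ring_hom[OF laurent_setup] by simp

lemma laurent_generated:
  assumes "cring C"
  shows "carrier (laurent C) \<subseteq> generate_ring (laurent C)
    ((\<lambda>c. single C c 0) ` carrier C \<union> {single C \<one>\<^bsub>C\<^esub> 1, single C \<one>\<^bsub>C\<^esub> (- 1)})"
    (is "_ \<subseteq> generate_ring _ ?H")
proof -
  interpret C: cring C by fact
  interpret L: cring "laurent C" by (rule laurent_cring) fact
  \<comment> \<open>\<open>s\<close> is the sign of the exponent, so that one induction handles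
    positive and negative powers.\<close>
  have pow: "single C \<one>\<^bsub>C\<^esub> (s * int n) \<in> generate_ring (laurent C) ?H" if s: "s \<in> {1, - 1}" for s n
  proof (induction n)
    case 0
    then show ?case by (auto intro: generate_ring.incl)
  next
    case (Suc n)
    have "single C \<one>\<^bsub>C\<^esub> s \<otimes>\<^bsub>laurent C\<^esub> single C \<one>\<^bsub>C\<^esub> (s * int n) \<in> generate_ring (laurent C) ?H"
      using s by (intro generate_ring.eng_mult Suc generate_ring.incl) auto
    then show ?case using assms by (simp add: laurent_single_mult algebra_simps)
  qed
  have "single C \<one>\<^bsub>C\<^esub> n \<in> generate_ring (laurent C) ?H" for n
    using pow[of 1 "nat n"] pow[of "- 1" "nat (- n)"] by (cases "n \<ge> 0") auto
  then have "(\<lambda>r. single C r \<one>\<^bsub>integer_group\<^esub>) ` carrier C \<union> single C \<one>\<^bsub>C\<^esub> ` carrier integer_group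
    \<subseteq> generate_ring (laurent C) ?H"
    by (auto intro: generate_ring.incl)
  then have "generate_ring (laurent C)
      ((\<lambda>r. single C r \<one>\<^bsub>integer_group\<^esub>) ` carrier C \<union> single C \<one>\<^bsub>C\<^esub> ` carrier integer_group)
    \<subseteq> generate_ring (laurent C) ?H"
    using assms by (intro L.generate_ring_subset) (auto simp: laurent_single_closed)
  then show ?thesis
    using monoid_ring_setup.MR_generated[OF laurent_setup[OF assms]] by blast
qed

text \<open>A homomorphism sends the variable to a unit, and inverses are unique, so its value at
  the inverse variable is forced by its value at the variable.\<close>

lemma laurent_hom_unique:
  assumes C: "cring C" and D: "cring D"
    and F: "F \<in> ring_hom (laurent C) D" and G: "G \<in> ring_hom (laurent C) D"
    and const: "\<And>c. c \<in> carrier C \<Longrightarrow> F (single C c 0) = G (single C c 0)"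
    and var: "F (single C \<one>\<^bsub>C\<^esub> 1) = G (single C \<one>\<^bsub>C\<^esub> 1)"
    and f: "f \<in> carrier (laurent C)"
  shows "F f = G f"
proof -
  interpret C: cring C by fact
  interpret L: cring "laurent C" by (rule laurent_cring) fact
  interpret D: cring D by fact
  note cl = laurent_single_closed[OF C C.one_closed]
  have inv: "H (single C \<one>\<^bsub>C\<^esub> 1) \<otimes>\<^bsub>D\<^esub> H (single C \<one>\<^bsub>C\<^esub> (- 1)) = \<one>\<^bsub>D\<^esub>"
    if H: "H \<in> ring_hom (laurent C) D" for H
    using ring_hom_mult[OF H cl cl, of 1 "- 1"] ring_hom_one[OF H] C
    by (simp add: laurent_single_mult laurent_one)
  have "F (single C \<one>\<^bsub>C\<^esub> (- 1)) = G (single C \<one>\<^bsub>C\<^esub> (- 1))"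
    using inv[OF F] inv[OF G] var ring_hom_closed[OF F cl] ring_hom_closed[OF G cl]
    by (metis D.inv_unique D.m_comm)
  note inv = this
  let ?H = "(\<lambda>c. single C c 0) ` carrier C \<union> {single C \<one>\<^bsub>C\<^esub> 1, single C \<one>\<^bsub>C\<^esub> (- 1)}"
  have H: "?H \<subseteq> carrier (laurent C)" using laurent_single_closed[OF C] by auto
  have "F h = G h" if "h \<in> ?H" for h
    using that
  proof (elim UnE imageE insertE emptyE)
    fix c assume "h = single C c 0" "c \<in> carrier C"
    then show ?thesis by (simp only: const)
  qed (simp_all only: inv var)
  then show ?thesis
    using subsetD[OF laurent_generated[OF C] f]
    by (rule ring_hom_eq_on_generate_ring[OF L.ring_axioms D.ring_axioms H F G])
qed

text \<open>Integer powers of \<open>v\<close> are taken in the group \<open>units_of D\<close>,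
  where the exponent law demanded by \<open>monoid_ring_hom\<close> is available.\<close>

lemma laurent_hom_exists:
  assumes C: "cring C" and D: "cring D" and \<psi>: "\<psi> \<in> ring_hom C D" and v: "v \<in> Units D"
  obtains F where "F \<in> ring_hom (laurent C) D"
    and "\<And>c. c \<in> carrier C \<Longrightarrow> F (single C c 0) = \<psi> c" and "F (single C \<one>\<^bsub>C\<^esub> 1) = v"
proof -
  interpret C: cring C by fact
  interpret D: cring D by fact
  interpret U: comm_group "units_of D" by (rule D.units_comm_group)
  define h where "h = (\<lambda>n :: int. v [^]\<^bsub>units_of D\<^esub> n)"
  have v': "v \<in> carrier (units_of D)" using v by (simp add: units_of_carrier)
  interpret monoid_ring_hom C integer_group D \<psi> h
  proof (intro monoid_ring_hom.intro monoid_ring_hom_axioms.intro laurent_setup C D \<psi>)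
    fix m :: int
    show "h m \<in> carrier D"
      using U.int_pow_closed[OF v', of m] D.Units_closed by (simp add: h_def units_of_carrier)
  next
    show "h \<one>\<^bsub>integer_group\<^esub> = \<one>\<^bsub>D\<^esub>" by (simp add: h_def units_of_one)
  next
    fix m n :: int
    show "h (m \<otimes>\<^bsub>integer_group\<^esub> n) = h m \<otimes>\<^bsub>D\<^esub> h n"
      using U.int_pow_mult[OF v', of m n] by (simp add: h_def units_of_mult)
  qed
  show ?thesis
  proof
    show "monoid_ring_lift C D \<psi> h \<in> ring_hom (laurent C) D" by (rule lift_ring_hom)
    show "monoid_ring_lift C D \<psi> h (single C c 0) = \<psi> c" if "c \<in> carrier C" for c
      using that h_one ring_hom_closed[OF \<psi>] by (simp add: lift_single)
    have "h 1 = v" using U.int_pow_1[OF v'] by (simp add: h_def)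
    then show "monoid_ring_lift C D \<psi> h (single C \<one>\<^bsub>C\<^esub> 1) = v"
      using v ring_hom_one[OF \<psi>] by (simp add: lift_single D.Units_closed)
  qed
qed

lemma poly_to_laurent_hom:
  assumes R: "cring R" and C: "cring C" and \<phi>: "\<phi> \<in> ring_hom R C"
  shows "poly_to_laurent R C \<phi> n \<in> ring_hom (UP R) (laurent C)"
    and "r \<in> carrier R \<Longrightarrow> poly_to_laurent R C \<phi> n (monom (UP R) r 0) = single C (\<phi> r) 0"
    and "poly_to_laurent R C \<phi> n (monom (UP R) \<one>\<^bsub>R\<^esub> 1) = single C \<one>\<^bsub>C\<^esub> n"
proof -
  interpret C: cring C by fact
  have hom: "(\<lambda>r. single C (\<phi> r) 0) \<in> ring_hom R (laurent C)"
    using ring_hom_trans[OF \<phi> laurent_const_hom[OF C]] by (simp add: comp_def)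
  interpret UP_pre_univ_prop R "laurent C" "\<lambda>r. single C (\<phi> r) 0" "UP R"
    using UP_pre_univ_propI[OF R laurent_cring[OF C] hom] .
  note cl = laurent_single_closed[OF C C.one_closed]
  show "poly_to_laurent R C \<phi> n \<in> ring_hom (UP R) (laurent C)"
    unfolding poly_to_laurent_def by (rule eval_ring_hom[OF cl])
  show "poly_to_laurent R C \<phi> n (monom (UP R) r 0) = single C (\<phi> r) 0" if "r \<in> carrier R"
    unfolding poly_to_laurent_def by (rule eval_const[OF cl that])
  show "poly_to_laurent R C \<phi> n (monom (UP R) \<one>\<^bsub>R\<^esub> 1) = single C \<one>\<^bsub>C\<^esub> n"
    unfolding poly_to_laurent_def by (rule eval_monom1[OF cl])
qed

lemma UP_hom_eqI:
  assumes R: "cring R" and D: "cring D"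
    and F: "F \<in> ring_hom (UP R) D" and G: "G \<in> ring_hom (UP R) D"
    and const: "\<And>r. r \<in> carrier R \<Longrightarrow> F (monom (UP R) r 0) = G (monom (UP R) r 0)"
    and var: "F (monom (UP R) \<one>\<^bsub>R\<^esub> 1) = G (monom (UP R) \<one>\<^bsub>R\<^esub> 1)"
    and f: "f \<in> carrier (UP R)"
  shows "F f = G f"
proof -
  interpret UP_cring R "UP R" using R by (simp add: UP_cring_def)
  interpret P: cring "UP R" by (rule UP_cring)
  interpret D: cring D by fact
  let ?H = "(\<lambda>r. monom (UP R) r 0) ` carrier R \<union> {monom (UP R) \<one>\<^bsub>R\<^esub> 1}"
  have H: "?H \<subseteq> carrier (UP R)" by auto
  have "F h = G h" if "h \<in> ?H" for h
    using that
  proof (elim UnE imageE insertE emptyE)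
    fix c assume "h = monom (UP R) c 0" "c \<in> carrier R"
    then show ?thesis by (simp only: const)
  qed (simp_all only: var)
  then show ?thesis
    using subsetD[OF UP_generated[OF R] f]
    by (rule ring_hom_eq_on_generate_ring[OF P.ring_axioms D.ring_axioms H F G])
qed

section \<open>Polynomial rings in arbitrary sets of variables\<close>

lemma mpoly_setup: "cring R \<Longrightarrow> monoid_ring_setup R (monomials V)"
  unfolding monoid_ring_setup_def
  by (auto simp: monomials_def intro!: comm_monoidI)

lemma mpoly_cring: "cring R \<Longrightarrow> cring (mpoly R V)"
  by (rule monoid_ring_setup.monoid_ring_cring[OF mpoly_setup])

lemma mpoly_const_hom: "cring R \<Longrightarrow> mpoly_const R \<in> ring_hom R (mpoly R V)"
  using monoid_ring_setup.const_ring_hom[OF mpoly_setup, of R V] by (simp add: monomials_def)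

definition mpoly_var :: "('r, 'x) ring_scheme \<Rightarrow> 'v \<Rightarrow> ('v multiset \<Rightarrow> 'r)" where
  "mpoly_var R v = single R \<one>\<^bsub>R\<^esub> {#v#}"

lemma mpoly_var_closed: "cring R \<Longrightarrow> v \<in> V \<Longrightarrow> mpoly_var R v \<in> carrier (mpoly R V)"
  unfolding mpoly_var_def
  by (intro monoid_ring_setup.single_closed[OF mpoly_setup])
    (auto simp: monomials_def cring.cring_simprules)

lemma mpoly_generated:
  assumes "cring R"
  shows "carrier (mpoly R V) \<subseteq>
    generate_ring (mpoly R V) (mpoly_const R ` carrier R \<union> mpoly_var R ` V)"
    (is "_ \<subseteq> generate_ring ?P ?H")
proof -
  interpret R: cring R by fact
  interpret monoid_ring_setup R "monomials V" using assms by (rule mpoly_setup)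
  have "single R \<one>\<^bsub>R\<^esub> m \<in> generate_ring ?P ?H" if "set_mset m \<subseteq> V" for m
    using that
  proof (induction m)
    case empty
    then show ?case by (auto intro: generate_ring.incl)
  next
    case (add v m)
    then have "mpoly_var R v \<otimes>\<^bsub>?P\<^esub> single R \<one>\<^bsub>R\<^esub> m \<in> generate_ring ?P ?H"
      by (intro generate_ring.eng_mult) (auto intro: generate_ring.incl)
    also have "mpoly_var R v \<otimes>\<^bsub>?P\<^esub> single R \<one>\<^bsub>R\<^esub> m = single R \<one>\<^bsub>R\<^esub> (add_mset v m)"
      using add.prems unfolding mpoly_var_def by (subst single_mult) (auto simp: monomials_def)
    finally show ?case .
  qed
  then have "(\<lambda>r. single R r \<one>\<^bsub>monomials V\<^esub>) ` carrier R \<union> single R \<one>\<^bsub>R\<^esub> ` carrier (monomials V)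
    \<subseteq> generate_ring ?P ?H"
    by (auto simp: monomials_def intro: generate_ring.incl)
  moreover have "?H \<subseteq> carrier ?P"
    using mpoly_var_closed[OF assms] ring_hom_closed[OF mpoly_const_hom[OF assms]] by auto
  ultimately have "generate_ring ?P
      ((\<lambda>r. single R r \<one>\<^bsub>monomials V\<^esub>) ` carrier R \<union> single R \<one>\<^bsub>R\<^esub> ` carrier (monomials V))
    \<subseteq> generate_ring ?P ?H"
    by (intro MR.generate_ring_subset) auto
  then show ?thesis using MR_generated by blast
qed

lemma mpoly_eval_hom:
  assumes R: "cring R" and D: "cring D" and \<phi>: "\<phi> \<in> ring_hom R D"
    and d: "\<And>v. v \<in> V \<Longrightarrow> d v \<in> carrier D"
  shows "mpoly_eval R D \<phi> d \<in> ring_hom (mpoly R V) D"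
    and "\<And>r. r \<in> carrier R \<Longrightarrow> mpoly_eval R D \<phi> d (mpoly_const R r) = \<phi> r"
    and "\<And>v. v \<in> V \<Longrightarrow> mpoly_eval R D \<phi> d (mpoly_var R v) = d v"
proof -
  interpret R: cring R by fact
  interpret D: cring D by fact
  define h where "h = (\<lambda>m. \<Otimes>\<^bsub>D\<^esub>v\<in>set_mset m. d v [^]\<^bsub>D\<^esub> count m v)"
  \<comment> \<open>Variables absent from \<open>m\<close> contribute a power with exponent 0, so
    the product may run over any finite \<open>X\<close> above the support; two monomials are
    multiplied over a common \<open>X\<close>.\<close>
  have h_on: "h m = (\<Otimes>\<^bsub>D\<^esub>v\<in>X. d v [^]\<^bsub>D\<^esub> count m v)"
    if "finite X" "set_mset m \<subseteq> X" "X \<subseteq> V" for m X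
    unfolding h_def using that d
    by (intro D.finprod_mono_neutral_cong_left) (auto simp: not_in_iff)
  interpret monoid_ring_hom R "monomials V" D \<phi> h
  proof (intro monoid_ring_hom.intro monoid_ring_hom_axioms.intro mpoly_setup R D \<phi>)
    fix m assume m: "m \<in> carrier (monomials V)"
    then show "h m \<in> carrier D"
      unfolding h_def using d by (auto intro!: D.finprod_closed simp: monomials_def)
    fix n assume n: "n \<in> carrier (monomials V)"
    define X where "X = set_mset m \<union> set_mset n"
    have X: "finite X" "X \<subseteq> V" "set_mset m \<subseteq> X" "set_mset n \<subseteq> X" "set_mset (m + n) \<subseteq> X"
      using m n by (auto simp: X_def monomials_def)
    have dX: "d v \<in> carrier D" if "v \<in> X" for v using that X(2) d by blast
    show "h (m \<otimes>\<^bsub>monomials V\<^esub> n) = h m \<otimes>\<^bsub>D\<^esub> h n"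
    proof -
      have "h (m + n) = (\<Otimes>\<^bsub>D\<^esub>v\<in>X. d v [^]\<^bsub>D\<^esub> count m v \<otimes>\<^bsub>D\<^esub> d v [^]\<^bsub>D\<^esub> count n v)"
        unfolding h_on[OF X(1) X(5) X(2)]
        using dX by (intro D.finprod_cong') (auto simp: D.nat_pow_mult)
      also have "\<dots> = h m \<otimes>\<^bsub>D\<^esub> h n"
        unfolding h_on[OF X(1) X(3) X(2)] h_on[OF X(1) X(4) X(2)]
        using dX by (intro D.finprod_multf) auto
      finally show ?thesis by (simp add: monomials_def)
    qed
  next
    show "h \<one>\<^bsub>monomials V\<^esub> = \<one>\<^bsub>D\<^esub>" by (simp add: h_def monomials_def)
  qed
  have eq: "mpoly_eval R D \<phi> d = monoid_ring_lift R D \<phi> h"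
    by (rule ext) (simp add: mpoly_eval_def monoid_ring_lift_def h_def)
  show "mpoly_eval R D \<phi> d \<in> ring_hom (mpoly R V) D"
    unfolding eq by (rule lift_ring_hom)
  show "mpoly_eval R D \<phi> d (mpoly_const R r) = \<phi> r" if "r \<in> carrier R" for r
    unfolding eq using that ring_hom_closed[OF \<phi> that]
    by (subst lift_single) (auto simp: monomials_def h_def)
  show "mpoly_eval R D \<phi> d (mpoly_var R v) = d v" if "v \<in> V" for v
    unfolding eq mpoly_var_def using that d ring_hom_one[OF \<phi>]
    by (subst lift_single) (auto simp: monomials_def h_def)
qed

lemma mpoly_hom_eqI:
  assumes R: "cring R" and D: "cring D"
    and F: "F \<in> ring_hom (mpoly R V) D" and G: "G \<in> ring_hom (mpoly R V) D"
    and const: "\<And>r. r \<in> carrier R \<Longrightarrow> F (mpoly_const R r) = G (mpoly_const R r)"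
    and var: "\<And>v. v \<in> V \<Longrightarrow> F (mpoly_var R v) = G (mpoly_var R v)"
    and f: "f \<in> carrier (mpoly R V)"
  shows "F f = G f"
proof -
  interpret P: cring "mpoly R V" by (rule mpoly_cring) fact
  interpret D: cring D by fact
  let ?H = "mpoly_const R ` carrier R \<union> mpoly_var R ` V"
  have H: "?H \<subseteq> carrier (mpoly R V)"
    using mpoly_var_closed[OF R] ring_hom_closed[OF mpoly_const_hom[OF R]] by auto
  have "F h = G h" if "h \<in> ?H" for h
    using that
  proof (elim UnE imageE)
    fix c assume "h = mpoly_const R c" "c \<in> carrier R"
    then show ?thesis by (simp only: const)
  next
    fix v assume "h = mpoly_var R v" "v \<in> V"
    then show ?thesis by (simp only: var)
  qed
  then show ?thesis
    using subsetD[OF mpoly_generated[OF R] f]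
    by (rule ring_hom_eq_on_generate_ring[OF P.ring_axioms D.ring_axioms H F G])
qed

section \<open>Tensor products\<close>

lemma INTEG_simps: "\<one>\<^bsub>INTEG\<^esub> = 1" "\<zero>\<^bsub>INTEG\<^esub> = 0" "m \<oplus>\<^bsub>INTEG\<^esub> n = m + n"
  by (simp_all add: INTEG_def)

locale tensor_setup = B: cring B + C: cring C
  for R :: "('r, 'w) ring_scheme" and B :: "('b, 'x) ring_scheme" and \<beta> :: "'r \<Rightarrow> 'b"
    and C :: "('c, 'y) ring_scheme" and \<gamma> :: "'r \<Rightarrow> 'c" +
  assumes \<beta>_closed: "r \<in> carrier R \<Longrightarrow> \<beta> r \<in> carrier B"
    and \<gamma>_closed: "r \<in> carrier R \<Longrightarrow> \<gamma> r \<in> carrier C"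
begin

abbreviation T where "T \<equiv> tensor R B \<beta> C \<gamma>"
abbreviation pt where "pt \<equiv> pure_tensor R B \<beta> C \<gamma>"
abbreviation I where "I \<equiv> tensor_ideal R B \<beta> C \<gamma>"

lemma DirProd_comm_monoid: "Group.comm_monoid (B \<times>\<times> C)"
proof -
  interpret BC: Group.monoid "B \<times>\<times> C"
    by (rule DirProd_monoid) unfold_locales
  show ?thesis
    by (rule BC.monoid_comm_monoidI) (auto simp: B.m_comm C.m_comm)
qed

sublocale F: monoid_ring_setup INTEG "B \<times>\<times> C"
  by (simp add: monoid_ring_setup_def INTEG_cring DirProd_comm_monoid)

definition tensor_relations where
  "tensor_relations =
    {single INTEG 1 (b \<oplus>\<^bsub>B\<^esub> b', c) \<ominus>\<^bsub>free_tensor B C\<^esub>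
        (single INTEG 1 (b, c) \<oplus>\<^bsub>free_tensor B C\<^esub> single INTEG 1 (b', c))
        | b b' c. b \<in> carrier B \<and> b' \<in> carrier B \<and> c \<in> carrier C}
     \<union> {single INTEG 1 (b, c \<oplus>\<^bsub>C\<^esub> c') \<ominus>\<^bsub>free_tensor B C\<^esub>
        (single INTEG 1 (b, c) \<oplus>\<^bsub>free_tensor B C\<^esub> single INTEG 1 (b, c'))
        | b c c'. b \<in> carrier B \<and> c \<in> carrier C \<and> c' \<in> carrier C}
     \<union> {single INTEG 1 (\<beta> r \<otimes>\<^bsub>B\<^esub> b, c) \<ominus>\<^bsub>free_tensor B C\<^esub> single INTEG 1 (b, \<gamma> r \<otimes>\<^bsub>C\<^esub> c)
        | r b c. r \<in> carrier R \<and> b \<in> carrier B \<and> c \<in> carrier C}"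

lemma tensor_ideal_eq: "I = Idl\<^bsub>free_tensor B C\<^esub> tensor_relations"
  by (simp only: tensor_ideal_def tensor_relations_def)

lemma gen_closed:
  "b \<in> carrier B \<Longrightarrow> c \<in> carrier C \<Longrightarrow> single INTEG 1 (b, c) \<in> carrier (free_tensor B C)"
  by (rule F.single_closed) auto

lemma tensor_relations_closed: "tensor_relations \<subseteq> carrier (free_tensor B C)"
  unfolding tensor_relations_def
  by (auto intro!: F.MR.minus_closed F.MR.a_closed gen_closed \<beta>_closed \<gamma>_closed)

sublocale I: ideal I "free_tensor B C"
  unfolding tensor_ideal_eq by (rule F.MR.genideal_ideal[OF tensor_relations_closed])

lemma tensor_cring: "cring T"
  unfolding tensor_def by (rule I.quotient_is_cring[OF F.MR.cring_axioms])

sublocale T: cring T by (rule tensor_cring)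

lemma quot_hom: "(\<lambda>f. I +>\<^bsub>free_tensor B C\<^esub> f) \<in> ring_hom (free_tensor B C) T"
  unfolding tensor_def by (rule I.rcos_ring_hom)

lemma pt_closed: "b \<in> carrier B \<Longrightarrow> c \<in> carrier C \<Longrightarrow> pt b c \<in> carrier T"
  unfolding pure_tensor_def by (intro ring_hom_closed[OF quot_hom] gen_closed)

lemma pt_mult:
  assumes "b \<in> carrier B" "b' \<in> carrier B" "c \<in> carrier C" "c' \<in> carrier C"
  shows "pt b c \<otimes>\<^bsub>T\<^esub> pt b' c' = pt (b \<otimes>\<^bsub>B\<^esub> b') (c \<otimes>\<^bsub>C\<^esub> c')"
  unfolding pure_tensor_def using assms
  by (subst ring_hom_mult[OF quot_hom, symmetric])
    (auto simp: gen_closed F.single_mult)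

lemma relation_eq:
  assumes "x \<ominus>\<^bsub>free_tensor B C\<^esub> y \<in> tensor_relations"
    "x \<in> carrier (free_tensor B C)" "y \<in> carrier (free_tensor B C)"
  shows "I +>\<^bsub>free_tensor B C\<^esub> x = I +>\<^bsub>free_tensor B C\<^esub> y"
  using assms F.MR.genideal_self[OF tensor_relations_closed]
  by (subst F.MR.quotient_eq_iff_same_a_r_cos[OF I.is_ideal, symmetric])
    (auto simp: tensor_ideal_eq)

lemma pt_add_left:
  assumes "b \<in> carrier B" "b' \<in> carrier B" "c \<in> carrier C"
  shows "pt (b \<oplus>\<^bsub>B\<^esub> b') c = pt b c \<oplus>\<^bsub>T\<^esub> pt b' c"
proof -
  have "pt (b \<oplus>\<^bsub>B\<^esub> b') c = I +>\<^bsub>free_tensor B C\<^esub>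
      (single INTEG 1 (b, c) \<oplus>\<^bsub>free_tensor B C\<^esub> single INTEG 1 (b', c))"
    unfolding pure_tensor_def using assms
    by (intro relation_eq F.MR.a_closed gen_closed) (auto simp: tensor_relations_def)
  also have "\<dots> = pt b c \<oplus>\<^bsub>T\<^esub> pt b' c"
    unfolding pure_tensor_def using assms by (intro ring_hom_add[OF quot_hom] gen_closed)
  finally show ?thesis .
qed

lemma pt_add_right:
  assumes "b \<in> carrier B" "c \<in> carrier C" "c' \<in> carrier C"
  shows "pt b (c \<oplus>\<^bsub>C\<^esub> c') = pt b c \<oplus>\<^bsub>T\<^esub> pt b c'"
proof -
  have "pt b (c \<oplus>\<^bsub>C\<^esub> c') = I +>\<^bsub>free_tensor B C\<^esub>
      (single INTEG 1 (b, c) \<oplus>\<^bsub>free_tensor B C\<^esub> single INTEG 1 (b, c'))"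
    unfolding pure_tensor_def using assms
    by (intro relation_eq F.MR.a_closed gen_closed) (auto simp: tensor_relations_def)
  also have "\<dots> = pt b c \<oplus>\<^bsub>T\<^esub> pt b c'"
    unfolding pure_tensor_def using assms by (intro ring_hom_add[OF quot_hom] gen_closed)
  finally show ?thesis .
qed

lemma pt_balanced:
  assumes "r \<in> carrier R"
  shows "pt (\<beta> r) \<one>\<^bsub>C\<^esub> = pt \<one>\<^bsub>B\<^esub> (\<gamma> r)"
proof -
  have "pt (\<beta> r \<otimes>\<^bsub>B\<^esub> \<one>\<^bsub>B\<^esub>) \<one>\<^bsub>C\<^esub> = pt \<one>\<^bsub>B\<^esub> (\<gamma> r \<otimes>\<^bsub>C\<^esub> \<one>\<^bsub>C\<^esub>)"
    unfolding pure_tensor_def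
  proof (rule relation_eq)
    show "single INTEG 1 (\<beta> r \<otimes>\<^bsub>B\<^esub> \<one>\<^bsub>B\<^esub>, \<one>\<^bsub>C\<^esub>) \<ominus>\<^bsub>free_tensor B C\<^esub>
        single INTEG 1 (\<one>\<^bsub>B\<^esub>, \<gamma> r \<otimes>\<^bsub>C\<^esub> \<one>\<^bsub>C\<^esub>) \<in> tensor_relations"
      unfolding tensor_relations_def using assms B.one_closed C.one_closed by blast
  qed (use assms \<beta>_closed \<gamma>_closed in \<open>auto intro!: gen_closed\<close>)
  then show ?thesis using assms \<beta>_closed \<gamma>_closed by simp
qed

lemma pt_one: "pt \<one>\<^bsub>B\<^esub> \<one>\<^bsub>C\<^esub> = \<one>\<^bsub>T\<^esub>"
  using ring_hom_one[OF quot_hom] by (simp add: pure_tensor_def F.one_MR INTEG_simps)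

lemma pt_left_hom: "(\<lambda>b. pt b \<one>\<^bsub>C\<^esub>) \<in> ring_hom B T"
  by (rule ring_hom_memI) (auto simp: pt_closed pt_mult pt_add_left pt_one)

lemma pt_right_hom: "(\<lambda>c. pt \<one>\<^bsub>B\<^esub> c) \<in> ring_hom C T"
  by (rule ring_hom_memI) (auto simp: pt_closed pt_mult pt_add_right pt_one)

lemma pt_split: "b \<in> carrier B \<Longrightarrow> c \<in> carrier C \<Longrightarrow> pt b c = pt b \<one>\<^bsub>C\<^esub> \<otimes>\<^bsub>T\<^esub> pt \<one>\<^bsub>B\<^esub> c"
  by (simp add: pt_mult)

text \<open>Every subring contains the integral multiples of one. This disposes of the integer
  coefficients when generators of a tensor product are determined.\<close>

lemma INTEG_in_generate:
  assumes "cring X" and F: "F \<in> ring_hom INTEG X"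
  shows "F n \<in> generate_ring X H"
proof -
  interpret X: cring X by fact
  have pos: "F (int m) \<in> generate_ring X H" for m
  proof (induction m)
    case 0
    have "F 0 = \<zero>\<^bsub>X\<^esub>"
      using ring_hom_zero[OF F _ X.ring_axioms] INTEG_cring by (simp add: INTEG_def cring_def)
    then show ?case by (simp add: X.zero_in_generate)
  next
    case (Suc m)
    have "F (int (Suc m)) = F 1 \<oplus>\<^bsub>X\<^esub> F (int m)"
      using ring_hom_add[OF F, of 1 "int m"] by (simp add: INTEG_def)
    also have "F 1 = \<one>\<^bsub>X\<^esub>" using ring_hom_one[OF F] by (simp add: INTEG_def)
    finally show ?case using Suc by (simp add: generate_ring.intros)
  qed
  \<comment> \<open>\<open>nat n\<close> and \<open>nat (- n)\<close> are the positive and the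
    negative part of \<open>n\<close>.\<close>
  have "F n = F (int (nat n)) \<oplus>\<^bsub>X\<^esub> \<ominus>\<^bsub>X\<^esub> F (int (nat (- n)))"
  proof -
    have "F (int (nat n)) = F (n + int (nat (- n)))" by (rule arg_cong[of _ _ F]) simp
    also have "\<dots> = F n \<oplus>\<^bsub>X\<^esub> F (int (nat (- n)))"
      using ring_hom_add[OF F, of n "int (nat (- n))"] by (simp add: INTEG_def)
    finally show ?thesis
      using ring_hom_closed[OF F INTEG_closed]
      by (metis X.add.inv_solve_right)
  qed
  then show ?thesis by (rule ssubst) (intro generate_ring.intros(3,4) pos)
qed

text \<open>A term n[b, c] of the free group factors as n[1, 1] times [b, 1] times [1, c], and the
  integer factor lies in every subring.\<close>

lemma tensor_generated:
  "carrier T \<subseteq> generate_ring T ((\<lambda>b. pt b \<one>\<^bsub>C\<^esub>) ` carrier B \<union> (\<lambda>c. pt \<one>\<^bsub>B\<^esub> c) ` carrier C)"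
    (is "_ \<subseteq> generate_ring T ?H")
proof
  fix t assume "t \<in> carrier T"
  then obtain f where f: "f \<in> carrier (free_tensor B C)" and t: "t = I +>\<^bsub>free_tensor B C\<^esub> f"
    by (auto simp: tensor_def FactRing_def A_RCOSETS_def')
  let ?q = "\<lambda>f. I +>\<^bsub>free_tensor B C\<^esub> f"
  show "t \<in> generate_ring T ?H"
    using f unfolding t
  proof (induction rule: F.monoid_ring_induct)
    case zero
    have "?q \<zero>\<^bsub>free_tensor B C\<^esub> = \<zero>\<^bsub>T\<^esub>"
      by (rule ring_hom_zero[OF quot_hom F.MR.ring_axioms T.ring_axioms])
    then show ?case by (simp add: T.zero_in_generate)
  next
    case (single n z)
    then have bc: "fst z \<in> carrier B" "snd z \<in> carrier C" by auto
    have "(\<lambda>n. ?q (single INTEG n \<one>\<^bsub>B \<times>\<times> C\<^esub>)) \<in> ring_hom INTEG T"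
      using ring_hom_trans[OF F.const_ring_hom quot_hom] by (simp add: comp_def)
    then have n: "?q (single INTEG n \<one>\<^bsub>B \<times>\<times> C\<^esub>) \<in> generate_ring T ?H"
      by (rule INTEG_in_generate[OF tensor_cring])
    have z: "single INTEG 1 z \<in> carrier (free_tensor B C)"
      and n1: "single INTEG n \<one>\<^bsub>B \<times>\<times> C\<^esub> \<in> carrier (free_tensor B C)"
      using single(2) by (auto intro!: F.single_closed)
    have "single INTEG n z = single INTEG n \<one>\<^bsub>B \<times>\<times> C\<^esub> \<otimes>\<^bsub>free_tensor B C\<^esub> single INTEG 1 z"
      using single by (subst F.single_mult) auto
    then have "?q (single INTEG n z) = ?q (single INTEG n \<one>\<^bsub>B \<times>\<times> C\<^esub>) \<otimes>\<^bsub>T\<^esub> pt (fst z) (snd z)"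
      by (simp only: ring_hom_mult[OF quot_hom n1 z] pure_tensor_def prod.collapse)
    also have "\<dots> \<in> generate_ring T ?H"
      unfolding pt_split[OF bc]
      using bc n by (intro generate_ring.eng_mult) (auto intro: generate_ring.incl)
    finally show ?case .
  next
    case (add f g)
    then show ?case
      by (simp add: ring_hom_add[OF quot_hom] generate_ring.eng_add)
  qed
qed

lemma tensor_hom_eqI:
  assumes D: "cring D" and F: "F \<in> ring_hom T D" and G: "G \<in> ring_hom T D"
    and left: "\<And>b. b \<in> carrier B \<Longrightarrow> F (pt b \<one>\<^bsub>C\<^esub>) = G (pt b \<one>\<^bsub>C\<^esub>)"
    and right: "\<And>c. c \<in> carrier C \<Longrightarrow> F (pt \<one>\<^bsub>B\<^esub> c) = G (pt \<one>\<^bsub>B\<^esub> c)"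
    and t: "t \<in> carrier T"
  shows "F t = G t"
proof -
  interpret D: cring D by fact
  let ?H = "(\<lambda>b. pt b \<one>\<^bsub>C\<^esub>) ` carrier B \<union> (\<lambda>c. pt \<one>\<^bsub>B\<^esub> c) ` carrier C"
  have H: "?H \<subseteq> carrier T" by (auto simp: pt_closed)
  have "F h = G h" if "h \<in> ?H" for h
    using that left right by auto
  then show ?thesis
    using subsetD[OF tensor_generated t]
    by (rule ring_hom_eq_on_generate_ring[OF T.ring_axioms D.ring_axioms H F G])
qed

text \<open>The sum defining \<open>tensor_lift\<close> is the homomorphism out of the free ring
  induced by the monoid homomorphism sending (b, c) to the product of f b and g c. It kills the
  defining relations, hence is constant on cosets, so that the image of a coset is a singleton and
  \<open>the_elem\<close> returns its value.\<close>

lemma tensor_lift: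
  assumes D: "cring D" and f: "f \<in> ring_hom B D" and g: "g \<in> ring_hom C D"
    and bal: "\<And>r. r \<in> carrier R \<Longrightarrow> f (\<beta> r) = g (\<gamma> r)"
  shows tensor_lift_hom: "tensor_lift D f g \<in> ring_hom T D"
    and tensor_lift_pt: "\<And>b c. b \<in> carrier B \<Longrightarrow> c \<in> carrier C \<Longrightarrow> tensor_lift D f g (pt b c) = f b \<otimes>\<^bsub>D\<^esub> g c"
proof -
  interpret D: cring D by fact
  let ?FT = "free_tensor B C"
  define \<phi> where "\<phi> = (\<lambda>n :: int. [n] \<cdot>\<^bsub>D\<^esub> \<one>\<^bsub>D\<^esub>)"
  define h where "h = (\<lambda>z. f (fst z) \<otimes>\<^bsub>D\<^esub> g (snd z))"
  have [simp]: "f b \<in> carrier D" if "b \<in> carrier B" for b using ring_hom_closed[OF f that] .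
  have [simp]: "g c \<in> carrier D" if "c \<in> carrier C" for c using ring_hom_closed[OF g that] .
  have \<phi>: "\<phi> \<in> ring_hom INTEG D"
    unfolding \<phi>_def
    by (rule ring_hom_memI) (auto simp: INTEG_def D.add.int_pow_mult D.add_pow_ldistr_int
        D.add.int_pow_pow mult.commute)
  interpret L: monoid_ring_hom INTEG "B \<times>\<times> C" D \<phi> h
  proof (intro monoid_ring_hom.intro monoid_ring_hom_axioms.intro \<phi>
      F.monoid_ring_setup_axioms D)
    show "h \<one>\<^bsub>B \<times>\<times> C\<^esub> = \<one>\<^bsub>D\<^esub>" by (simp add: h_def ring_hom_one[OF f] ring_hom_one[OF g])
    fix m assume m: "m \<in> carrier (B \<times>\<times> C)"
    then show "h m \<in> carrier D" by (auto simp: h_def)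
    fix n assume n: "n \<in> carrier (B \<times>\<times> C)"
    show "h (m \<otimes>\<^bsub>B \<times>\<times> C\<^esub> n) = h m \<otimes>\<^bsub>D\<^esub> h n"
      using m n by (auto simp: h_def ring_hom_mult[OF f] ring_hom_mult[OF g] D.m_ac)
  qed
  let ?L = "monoid_ring_lift INTEG D \<phi> h"
  have hom: "?L \<in> ring_hom ?FT D" by (rule L.lift_ring_hom)
  interpret L: ring_hom_ring ?FT D ?L
    using F.MR.ring_axioms D.ring_axioms hom by (rule ring_hom_ringI2)
  \<comment> \<open>\<open>tensor_lift\<close> is written with integer multiples, the lift with
    products by the image of an integer; on the free ring both give the same sum.\<close>
  have L_eq: "?L w = (\<Oplus>\<^bsub>D\<^esub>z\<in>{z. w z \<noteq> 0}. [w z] \<cdot>\<^bsub>D\<^esub> (f (fst z) \<otimes>\<^bsub>D\<^esub> g (snd z)))"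
    if w: "w \<in> carrier ?FT" for w
    unfolding monoid_ring_lift_def
  proof (rule D.finsum_cong')
    show "{z. w z \<noteq> \<zero>\<^bsub>INTEG\<^esub>} = {z. w z \<noteq> 0}" by (simp add: INTEG_def)
    fix z assume "z \<in> {z. w z \<noteq> 0}"
    then have z: "z \<in> carrier (B \<times>\<times> C)"
      using F.support_subset[OF w] by (auto simp: INTEG_def)
    then show "\<phi> (w z) \<otimes>\<^bsub>D\<^esub> h z = [w z] \<cdot>\<^bsub>D\<^esub> (f (fst z) \<otimes>\<^bsub>D\<^esub> g (snd z))"
      by (auto simp: \<phi>_def h_def D.add_pow_ldistr_int)
  next
    show "(\<lambda>z. [w z] \<cdot>\<^bsub>D\<^esub> (f (fst z) \<otimes>\<^bsub>D\<^esub> g (snd z))) \<in> {z. w z \<noteq> 0} \<rightarrow> carrier D"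
      using F.support_subset[OF w] by (force simp: INTEG_def)
  qed
  have L_gen: "?L (single INTEG 1 (b, c)) = f b \<otimes>\<^bsub>D\<^esub> g c"
    if "b \<in> carrier B" "c \<in> carrier C" for b c
    using that by (subst L.lift_single) (auto simp: \<phi>_def h_def)
  have rel: "tensor_relations \<subseteq> a_kernel ?FT D ?L"
  proof
    fix w assume w: "w \<in> tensor_relations"
    then have wc: "w \<in> carrier ?FT" using tensor_relations_closed by blast
    have "?L w = \<zero>\<^bsub>D\<^esub>"
      using w unfolding tensor_relations_def
    proof (elim UnE CollectE exE conjE)
      fix b b' c assume "w = single INTEG 1 (b \<oplus>\<^bsub>B\<^esub> b', c) \<ominus>\<^bsub>?FT\<^esub>
        (single INTEG 1 (b, c) \<oplus>\<^bsub>?FT\<^esub> single INTEG 1 (b', c))"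
        "b \<in> carrier B" "b' \<in> carrier B" "c \<in> carrier C"
      then show ?thesis
        by (simp add: ring_hom_diff[OF F.MR.ring_axioms D.ring_axioms hom] gen_closed L_gen
            ring_hom_add[OF f] D.l_distr D.r_right_minus_eq)
    next
      fix b c c' assume "w = single INTEG 1 (b, c \<oplus>\<^bsub>C\<^esub> c') \<ominus>\<^bsub>?FT\<^esub>
        (single INTEG 1 (b, c) \<oplus>\<^bsub>?FT\<^esub> single INTEG 1 (b, c'))"
        "b \<in> carrier B" "c \<in> carrier C" "c' \<in> carrier C"
      then show ?thesis
        by (simp add: ring_hom_diff[OF F.MR.ring_axioms D.ring_axioms hom] gen_closed L_gen
            ring_hom_add[OF g] D.r_distr D.r_right_minus_eq)
    next
      fix r b c assume "w = single INTEG 1 (\<beta> r \<otimes>\<^bsub>B\<^esub> b, c) \<ominus>\<^bsub>?FT\<^esub> single INTEG 1 (b, \<gamma> r \<otimes>\<^bsub>C\<^esub> c)"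
        "r \<in> carrier R" "b \<in> carrier B" "c \<in> carrier C"
      then show ?thesis
        using \<beta>_closed \<gamma>_closed
        by (simp add: ring_hom_diff[OF F.MR.ring_axioms D.ring_axioms hom] gen_closed L_gen
            ring_hom_mult[OF f] ring_hom_mult[OF g] bal D.m_ac D.r_right_minus_eq)
    qed
    with wc show "w \<in> a_kernel ?FT D ?L" unfolding a_kernel_def' by blast
  qed
  have ker: "I \<subseteq> a_kernel ?FT D ?L"
    unfolding tensor_ideal_eq by (rule F.MR.genideal_minimal[OF L.kernel_is_ideal rel])
  have lift: "tensor_lift D f g (I +>\<^bsub>?FT\<^esub> w) = ?L w" if w: "w \<in> carrier ?FT" for w
  proof -
    have sub: "I +>\<^bsub>?FT\<^esub> w \<subseteq> carrier ?FT"
      using w by (rule F.MR.a_r_coset_subset_G[OF I.a_subset])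
    have eq: "?L v = ?L w" if v: "v \<in> I +>\<^bsub>?FT\<^esub> w" for v
    proof -
      obtain i where i: "i \<in> I" and v: "v = i \<oplus>\<^bsub>?FT\<^esub> w"
        using v by (auto simp: a_r_coset_def')
      have "?L i = \<zero>\<^bsub>D\<^esub>" using ker i unfolding a_kernel_def' by blast
      then show ?thesis
        unfolding v ring_hom_add[OF hom I.Icarr[OF i] w]
        using ring_hom_closed[OF hom w] by simp
    qed
    \<comment> \<open>The coset is nonempty, so its image is a singleton and not the empty
      set.\<close>
    have "w \<in> I +>\<^bsub>?FT\<^esub> w" by (rule I.a_rcos_self[OF w])
    then have "(\<lambda>v. \<Oplus>\<^bsub>D\<^esub>z\<in>{z. v z \<noteq> 0}. [v z] \<cdot>\<^bsub>D\<^esub> (f (fst z) \<otimes>\<^bsub>D\<^esub> g (snd z))) ` (I +>\<^bsub>?FT\<^esub> w)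
      = {?L w}"
      (is "?E ` _ = _")
    proof -
      have "?E v = ?L w" if "v \<in> I +>\<^bsub>?FT\<^esub> w" for v
        using L_eq[OF subsetD[OF sub that]] eq[OF that] by simp
      with \<open>w \<in> I +>\<^bsub>?FT\<^esub> w\<close> show ?thesis by (auto simp: image_iff intro!: bexI[of _ w])
    qed
    then show ?thesis by (simp add: tensor_lift_def)
  qed
  show pt: "tensor_lift D f g (pt b c) = f b \<otimes>\<^bsub>D\<^esub> g c"
    if "b \<in> carrier B" "c \<in> carrier C" for b c
    unfolding pure_tensor_def using that by (simp add: lift gen_closed L_gen)
  have rep: "\<exists>w\<in>carrier ?FT. t = I +>\<^bsub>?FT\<^esub> w" if "t \<in> carrier T" for t
    using that by (auto simp: tensor_def FactRing_def A_RCOSETS_def')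
  show "tensor_lift D f g \<in> ring_hom T D"
  proof (rule ring_hom_memI)
    fix s t assume "s \<in> carrier T" "t \<in> carrier T"
    then obtain v w where v: "v \<in> carrier ?FT" "s = I +>\<^bsub>?FT\<^esub> v" and w: "w \<in> carrier ?FT" "t = I +>\<^bsub>?FT\<^esub> w"
      using rep by metis
    show "tensor_lift D f g s \<in> carrier D" using v by (simp add: lift)
    show "tensor_lift D f g (s \<otimes>\<^bsub>T\<^esub> t) = tensor_lift D f g s \<otimes>\<^bsub>D\<^esub> tensor_lift D f g t"
      unfolding v(2) w(2) ring_hom_mult[OF quot_hom v(1) w(1), symmetric]
      using v(1) w(1) by (simp add: lift)
    show "tensor_lift D f g (s \<oplus>\<^bsub>T\<^esub> t) = tensor_lift D f g s \<oplus>\<^bsub>D\<^esub> tensor_lift D f g t"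
      unfolding v(2) w(2) ring_hom_add[OF quot_hom v(1) w(1), symmetric]
      using v(1) w(1) by (simp add: lift)
  next
    show "tensor_lift D f g \<one>\<^bsub>T\<^esub> = \<one>\<^bsub>D\<^esub>"
      using pt[of "\<one>\<^bsub>B\<^esub>" "\<one>\<^bsub>C\<^esub>"] by (simp add: pt_one ring_hom_one[OF f] ring_hom_one[OF g])
  qed
qed

end

section \<open>Contractions\<close>

lemma ring_hom_image_in_subring:
  assumes X: "ring X" and D: "ring D" and F: "F \<in> ring_hom X D" and H: "H \<subseteq> carrier X"
    and E: "subring E D" and FH: "\<And>h. h \<in> H \<Longrightarrow> F h \<in> E" and x: "x \<in> generate_ring X H"
  shows "F x \<in> E"
proof -
  interpret X: ring X by fact
  note c = X.generate_ring_in_carrier[OF H]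
  note E' = subringE[OF E]
  show ?thesis
    using x
  proof induction
    case one
    then show ?case using ring_hom_one[OF F] E'(3) by simp
  next
    case (incl h)
    then show ?case by (rule FH)
  next
    case (a_inv h)
    then show ?case using E'(5) by (simp add: ring_hom_minus[OF X D F c])
  next
    case (eng_add h1 h2)
    then show ?case using E'(7) by (simp add: ring_hom_add[OF F c c])
  next
    case (eng_mult h1 h2)
    then show ?case using E'(6) by (simp add: ring_hom_mult[OF F c c])
  qed
qed

section \<open>Division by two\<close>

lemma two_UnitI:
  assumes "cring X" "w \<in> carrier X" "w \<oplus>\<^bsub>X\<^esub> w = \<one>\<^bsub>X\<^esub>"
  shows "\<one>\<^bsub>X\<^esub> \<oplus>\<^bsub>X\<^esub> \<one>\<^bsub>X\<^esub> \<in> Units X"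
proof -
  interpret cring X by fact
  show ?thesis
    using assms(2,3) unfolding Units_def
    by (auto intro!: bexI[of _ w] simp: l_distr r_distr)
qed

lemma half_closed:
  assumes "cring X" "\<one>\<^bsub>X\<^esub> \<oplus>\<^bsub>X\<^esub> \<one>\<^bsub>X\<^esub> \<in> Units X" "x \<in> carrier X"
  shows "half X x \<in> carrier X"
proof -
  interpret cring X by fact
  show ?thesis using assms(2,3) by (simp add: half_def)
qed

lemma half_double:
  assumes "cring X" "\<one>\<^bsub>X\<^esub> \<oplus>\<^bsub>X\<^esub> \<one>\<^bsub>X\<^esub> \<in> Units X" "x \<in> carrier X"
  shows "half X x \<oplus>\<^bsub>X\<^esub> half X x = x"
proof -
  interpret cring X by fact
  have "half X x \<oplus>\<^bsub>X\<^esub> half X x = (\<one>\<^bsub>X\<^esub> \<oplus>\<^bsub>X\<^esub> \<one>\<^bsub>X\<^esub>) \<otimes>\<^bsub>X\<^esub> half X x"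
    using half_closed[OF assms] by (simp add: l_distr)
  also have "\<dots> = x"
    using assms(2,3) by (simp add: half_def m_assoc[symmetric])
  finally show ?thesis .
qed

text \<open>Only one element has the double \<open>x\<close>, since 2 can be cancelled. This is how
  \<open>half\<close> is carried along homomorphisms without touching the inverse of 2.\<close>

lemma half_unique:
  assumes "cring X" "\<one>\<^bsub>X\<^esub> \<oplus>\<^bsub>X\<^esub> \<one>\<^bsub>X\<^esub> \<in> Units X" "y \<in> carrier X" "y \<oplus>\<^bsub>X\<^esub> y = x"
  shows "half X x = y"
proof -
  interpret cring X by fact
  have "x = (\<one>\<^bsub>X\<^esub> \<oplus>\<^bsub>X\<^esub> \<one>\<^bsub>X\<^esub>) \<otimes>\<^bsub>X\<^esub> y" using assms(3,4) by (simp add: l_distr)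
  then show ?thesis
    using assms(2,3) by (simp add: half_def m_assoc[symmetric])
qed

lemma two_Unit_hom:
  assumes X: "cring X" and Y: "cring Y" and F: "F \<in> ring_hom X Y" and two: "\<one>\<^bsub>X\<^esub> \<oplus>\<^bsub>X\<^esub> \<one>\<^bsub>X\<^esub> \<in> Units X"
  shows "\<one>\<^bsub>Y\<^esub> \<oplus>\<^bsub>Y\<^esub> \<one>\<^bsub>Y\<^esub> \<in> Units Y"
proof (rule two_UnitI[OF Y])
  interpret X: cring X by fact
  note h = half_closed[OF X two X.one_closed]
  show "F (half X \<one>\<^bsub>X\<^esub>) \<in> carrier Y" using ring_hom_closed[OF F h] .
  show "F (half X \<one>\<^bsub>X\<^esub>) \<oplus>\<^bsub>Y\<^esub> F (half X \<one>\<^bsub>X\<^esub>) = \<one>\<^bsub>Y\<^esub>"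
    by (simp add: ring_hom_add[OF F h h, symmetric] half_double[OF X two] ring_hom_one[OF F])
qed

lemma half_hom:
  assumes X: "cring X" and Y: "cring Y" and F: "F \<in> ring_hom X Y" and two: "\<one>\<^bsub>X\<^esub> \<oplus>\<^bsub>X\<^esub> \<one>\<^bsub>X\<^esub> \<in> Units X"
    and x: "x \<in> carrier X"
  shows "half Y (F x) = F (half X x)"
proof (rule half_unique[OF Y two_Unit_hom[OF X Y F two]])
  note h = half_closed[OF X two x]
  show "F (half X x) \<in> carrier Y" using ring_hom_closed[OF F h] .
  show "F (half X x) \<oplus>\<^bsub>Y\<^esub> F (half X x) = F x"
    by (simp add: ring_hom_add[OF F h h, symmetric] half_double[OF X two x])
qed

section \<open>Even and odd parts under an involution\<close>

locale contraction_setup = R: cring R + C: cring C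
  for R :: "('r, 'x) ring_scheme" and C :: "('c, 'y) ring_scheme" and \<phi> :: "'r \<Rightarrow> 'c"
    and \<sigma> :: "'c \<Rightarrow> 'c" +
  assumes \<phi>: "\<phi> \<in> ring_hom R C" and invol: "involution_over R C \<phi> \<sigma>"
    and two: "\<one>\<^bsub>R\<^esub> \<oplus>\<^bsub>R\<^esub> \<one>\<^bsub>R\<^esub> \<in> Units R"
begin

lemma \<sigma>: "\<sigma> \<in> ring_hom C C" using invol by (simp add: involution_over_def)
lemma \<sigma>\<sigma>: "c \<in> carrier C \<Longrightarrow> \<sigma> (\<sigma> c) = c" using invol by (simp add: involution_over_def)
lemma \<sigma>\<phi>: "r \<in> carrier R \<Longrightarrow> \<sigma> (\<phi> r) = \<phi> r" using invol by (simp add: involution_over_def)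

lemma \<sigma>_closed [simp]: "c \<in> carrier C \<Longrightarrow> \<sigma> c \<in> carrier C" by (rule ring_hom_closed[OF \<sigma>])
lemma \<phi>_closed [simp]: "r \<in> carrier R \<Longrightarrow> \<phi> r \<in> carrier C" by (rule ring_hom_closed[OF \<phi>])

lemma two_C: "\<one>\<^bsub>C\<^esub> \<oplus>\<^bsub>C\<^esub> \<one>\<^bsub>C\<^esub> \<in> Units C"
  by (rule two_Unit_hom[OF R.cring_axioms C.cring_axioms \<phi> two])

lemma half_C_closed [simp]: "c \<in> carrier C \<Longrightarrow> half C c \<in> carrier C"
  by (rule half_closed[OF C.cring_axioms two_C])

lemma half_half: "c \<in> carrier C \<Longrightarrow> half C c \<oplus>\<^bsub>C\<^esub> half C c = c"
  by (rule half_double[OF C.cring_axioms two_C])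

lemma half_C_unique: "c \<in> carrier C \<Longrightarrow> c \<oplus>\<^bsub>C\<^esub> c = d \<Longrightarrow> half C d = c"
  by (rule half_unique[OF C.cring_axioms two_C])

lemma \<sigma>_half: "c \<in> carrier C \<Longrightarrow> \<sigma> (half C c) = half C (\<sigma> c)"
  by (rule half_hom[OF C.cring_axioms C.cring_axioms \<sigma> two_C, symmetric])

lemma half_uminus: "c \<in> carrier C \<Longrightarrow> half C (\<ominus>\<^bsub>C\<^esub> c) = \<ominus>\<^bsub>C\<^esub> half C c"
  by (rule half_C_unique) (simp_all add: C.minus_add[symmetric] half_half)

lemma half_add:
  "c \<in> carrier C \<Longrightarrow> d \<in> carrier C \<Longrightarrow> half C (c \<oplus>\<^bsub>C\<^esub> d) = half C c \<oplus>\<^bsub>C\<^esub> half C d"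
  by (simp add: half_def C.r_distr two_C)

definition even_part where "even_part c = half C (c \<oplus>\<^bsub>C\<^esub> \<sigma> c)"
definition odd_part where "odd_part c = half C (c \<ominus>\<^bsub>C\<^esub> \<sigma> c)"

lemma parts_closed [simp]:
  "c \<in> carrier C \<Longrightarrow> even_part c \<in> carrier C" "c \<in> carrier C \<Longrightarrow> odd_part c \<in> carrier C"
  by (simp_all add: even_part_def odd_part_def)

lemma \<sigma>_even: "c \<in> carrier C \<Longrightarrow> \<sigma> (even_part c) = even_part c"
  by (simp add: even_part_def \<sigma>_half ring_hom_add[OF \<sigma>] \<sigma>\<sigma> C.a_comm)

lemma \<sigma>_odd:
  assumes "c \<in> carrier C"
  shows "\<sigma> (odd_part c) = \<ominus>\<^bsub>C\<^esub> odd_part c"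
proof -
  note cl = assms \<sigma>_closed[OF assms]
  have "\<sigma> (c \<ominus>\<^bsub>C\<^esub> \<sigma> c) = \<sigma> c \<ominus>\<^bsub>C\<^esub> c"
    using cl by (simp only: ring_hom_diff[OF C.ring_axioms C.ring_axioms \<sigma>] \<sigma>\<sigma>)
  also have "\<dots> = \<ominus>\<^bsub>C\<^esub> (c \<ominus>\<^bsub>C\<^esub> \<sigma> c)" using cl by algebra
  finally show ?thesis using cl by (simp add: odd_part_def \<sigma>_half half_uminus)
qed

lemma even_plus_odd: "c \<in> carrier C \<Longrightarrow> even_part c \<oplus>\<^bsub>C\<^esub> odd_part c = c"
proof -
  assume c: "c \<in> carrier C"
  have "even_part c \<oplus>\<^bsub>C\<^esub> odd_part c = half C ((c \<oplus>\<^bsub>C\<^esub> \<sigma> c) \<oplus>\<^bsub>C\<^esub> (c \<ominus>\<^bsub>C\<^esub> \<sigma> c))"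
    using c by (simp add: even_part_def odd_part_def half_add)
  also have "(c \<oplus>\<^bsub>C\<^esub> \<sigma> c) \<oplus>\<^bsub>C\<^esub> (c \<ominus>\<^bsub>C\<^esub> \<sigma> c) = c \<oplus>\<^bsub>C\<^esub> c"
    using c \<sigma>_closed[OF c] by algebra
  also have "half C \<dots> = c" using c by (simp add: half_C_unique)
  finally show ?thesis .
qed

lemma parts_of_invariant:
  assumes "c \<in> carrier C" "\<sigma> c = c"
  shows "even_part c = c" "odd_part c = \<zero>\<^bsub>C\<^esub>"
  using assms by (auto simp: even_part_def odd_part_def C.minus_eq C.r_neg intro: half_C_unique)

lemma parts_of_anti_invariant:
  assumes "c \<in> carrier C" "\<sigma> c = \<ominus>\<^bsub>C\<^esub> c"
  shows "even_part c = \<zero>\<^bsub>C\<^esub>" "odd_part c = c"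
  using assms by (auto simp: even_part_def odd_part_def C.minus_eq C.r_neg intro: half_C_unique)

lemma parts_add:
  assumes c: "c \<in> carrier C" and d: "d \<in> carrier C"
  shows "even_part (c \<oplus>\<^bsub>C\<^esub> d) = even_part c \<oplus>\<^bsub>C\<^esub> even_part d"
    and "odd_part (c \<oplus>\<^bsub>C\<^esub> d) = odd_part c \<oplus>\<^bsub>C\<^esub> odd_part d"
proof -
  note cl = c d \<sigma>_closed[OF c] \<sigma>_closed[OF d]
  have "c \<oplus>\<^bsub>C\<^esub> d \<oplus>\<^bsub>C\<^esub> (\<sigma> c \<oplus>\<^bsub>C\<^esub> \<sigma> d) = (c \<oplus>\<^bsub>C\<^esub> \<sigma> c) \<oplus>\<^bsub>C\<^esub> (d \<oplus>\<^bsub>C\<^esub> \<sigma> d)"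
    using cl by algebra
  then show "even_part (c \<oplus>\<^bsub>C\<^esub> d) = even_part c \<oplus>\<^bsub>C\<^esub> even_part d"
    using cl by (simp add: even_part_def ring_hom_add[OF \<sigma>] half_add)
  have "(c \<oplus>\<^bsub>C\<^esub> d) \<ominus>\<^bsub>C\<^esub> (\<sigma> c \<oplus>\<^bsub>C\<^esub> \<sigma> d) = (c \<ominus>\<^bsub>C\<^esub> \<sigma> c) \<oplus>\<^bsub>C\<^esub> (d \<ominus>\<^bsub>C\<^esub> \<sigma> d)"
    using cl by algebra
  then show "odd_part (c \<oplus>\<^bsub>C\<^esub> d) = odd_part c \<oplus>\<^bsub>C\<^esub> odd_part d"
    using cl by (simp add: odd_part_def ring_hom_add[OF \<sigma>] half_add)
qed

text \<open>The decomposition into an invariant and an anti-invariant summand is unique: exhibiting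
  an element as such a sum is enough to read off its parts.\<close>

lemma parts_unique:
  assumes "e \<in> carrier C" "f \<in> carrier C" "\<sigma> e = e" "\<sigma> f = \<ominus>\<^bsub>C\<^esub> f"
  shows "even_part (e \<oplus>\<^bsub>C\<^esub> f) = e" "odd_part (e \<oplus>\<^bsub>C\<^esub> f) = f"
  using assms by (simp_all add: parts_add parts_of_invariant parts_of_anti_invariant)

lemma parts_uminus:
  assumes "c \<in> carrier C"
  shows "even_part (\<ominus>\<^bsub>C\<^esub> c) = \<ominus>\<^bsub>C\<^esub> even_part c" "odd_part (\<ominus>\<^bsub>C\<^esub> c) = \<ominus>\<^bsub>C\<^esub> odd_part c"
proof -
  have "\<ominus>\<^bsub>C\<^esub> c = \<ominus>\<^bsub>C\<^esub> even_part c \<oplus>\<^bsub>C\<^esub> \<ominus>\<^bsub>C\<^esub> odd_part c"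
    using assms even_plus_odd[OF assms] C.minus_add[of "even_part c" "odd_part c"] by simp
  then show "even_part (\<ominus>\<^bsub>C\<^esub> c) = \<ominus>\<^bsub>C\<^esub> even_part c" "odd_part (\<ominus>\<^bsub>C\<^esub> c) = \<ominus>\<^bsub>C\<^esub> odd_part c"
    using assms parts_unique[of "\<ominus>\<^bsub>C\<^esub> even_part c" "\<ominus>\<^bsub>C\<^esub> odd_part c"]
    by (simp_all add: ring_hom_minus[OF C.ring_axioms C.ring_axioms \<sigma>] \<sigma>_even \<sigma>_odd)
qed

text \<open>The decomposition is a grading by Z/2: products of two parts of equal parity are
  invariant, products of mixed parity are anti-invariant.\<close>

lemma parts_mult:
  assumes c: "c \<in> carrier C" and d: "d \<in> carrier C"
  shows "even_part (c \<otimes>\<^bsub>C\<^esub> d) = even_part c \<otimes>\<^bsub>C\<^esub> even_part d \<oplus>\<^bsub>C\<^esub> odd_part c \<otimes>\<^bsub>C\<^esub> odd_part d" (is ?e)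
    and "odd_part (c \<otimes>\<^bsub>C\<^esub> d) = even_part c \<otimes>\<^bsub>C\<^esub> odd_part d \<oplus>\<^bsub>C\<^esub> odd_part c \<otimes>\<^bsub>C\<^esub> even_part d" (is ?o)
proof -
  note cl = parts_closed[OF c] parts_closed[OF d]
  have "(even_part c \<oplus>\<^bsub>C\<^esub> odd_part c) \<otimes>\<^bsub>C\<^esub> (even_part d \<oplus>\<^bsub>C\<^esub> odd_part d) =
    (even_part c \<otimes>\<^bsub>C\<^esub> even_part d \<oplus>\<^bsub>C\<^esub> odd_part c \<otimes>\<^bsub>C\<^esub> odd_part d)
    \<oplus>\<^bsub>C\<^esub> (even_part c \<otimes>\<^bsub>C\<^esub> odd_part d \<oplus>\<^bsub>C\<^esub> odd_part c \<otimes>\<^bsub>C\<^esub> even_part d)"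
    using cl by algebra
  then have eq: "c \<otimes>\<^bsub>C\<^esub> d = (even_part c \<otimes>\<^bsub>C\<^esub> even_part d \<oplus>\<^bsub>C\<^esub> odd_part c \<otimes>\<^bsub>C\<^esub> odd_part d)
    \<oplus>\<^bsub>C\<^esub> (even_part c \<otimes>\<^bsub>C\<^esub> odd_part d \<oplus>\<^bsub>C\<^esub> odd_part c \<otimes>\<^bsub>C\<^esub> even_part d)"
    by (simp add: even_plus_odd c d)
  have "\<sigma> (even_part c \<otimes>\<^bsub>C\<^esub> even_part d \<oplus>\<^bsub>C\<^esub> odd_part c \<otimes>\<^bsub>C\<^esub> odd_part d)
    = even_part c \<otimes>\<^bsub>C\<^esub> even_part d \<oplus>\<^bsub>C\<^esub> odd_part c \<otimes>\<^bsub>C\<^esub> odd_part d"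
    and "\<sigma> (even_part c \<otimes>\<^bsub>C\<^esub> odd_part d \<oplus>\<^bsub>C\<^esub> odd_part c \<otimes>\<^bsub>C\<^esub> even_part d)
    = \<ominus>\<^bsub>C\<^esub> (even_part c \<otimes>\<^bsub>C\<^esub> odd_part d \<oplus>\<^bsub>C\<^esub> odd_part c \<otimes>\<^bsub>C\<^esub> even_part d)"
    using cl c d by (simp_all add: ring_hom_add[OF \<sigma>] ring_hom_mult[OF \<sigma>] \<sigma>_even \<sigma>_odd
        C.l_minus C.r_minus C.minus_add)
  then show ?e ?o
    unfolding eq using cl by (simp_all add: parts_unique)
qed

lemma parts_\<phi>: "r \<in> carrier R \<Longrightarrow> even_part (\<phi> r) = \<phi> r" "r \<in> carrier R \<Longrightarrow> odd_part (\<phi> r) = \<zero>\<^bsub>C\<^esub>"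
  by (simp_all add: parts_of_invariant \<sigma>\<phi>)

section \<open>The contraction as a subring of the Laurent ring\<close>

abbreviation LC where "LC \<equiv> laurent C"
abbreviation CC where "CC \<equiv> contraction R C \<phi> \<sigma>"

sublocale LC: cring LC by (rule laurent_cring[OF C.cring_axioms])

lemmas single_simps =
  laurent_single_closed[OF C.cring_axioms] laurent_single_mult[OF C.cring_axioms]
  laurent_single_add[OF C.cring_axioms] laurent_single_uminus[OF C.cring_axioms]
  laurent_one[OF C.cring_axioms]

lemma single_zero: "single C \<zero>\<^bsub>C\<^esub> n = \<zero>\<^bsub>LC\<^esub>"
  by (rule monoid_ring_setup.single_zero[OF laurent_setup[OF C.cring_axioms]])

definition contraction_gens where
  "contraction_gens = poly_to_laurent R C \<phi> 2 ` carrier (UP R)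
     \<union> {single C c 0 | c. c \<in> carrier C \<and> \<sigma> c = c}
     \<union> {single C c (-1) | c. c \<in> carrier C \<and> \<sigma> c = \<ominus>\<^bsub>C\<^esub> c}"

lemma contraction_eq: "CC = LC\<lparr>carrier := generate_ring LC contraction_gens\<rparr>"
  by (simp only: contraction_def contraction_gens_def)

lemma contraction_ops:
  "x \<otimes>\<^bsub>CC\<^esub> y = x \<otimes>\<^bsub>LC\<^esub> y" "x \<oplus>\<^bsub>CC\<^esub> y = x \<oplus>\<^bsub>LC\<^esub> y" "\<one>\<^bsub>CC\<^esub> = \<one>\<^bsub>LC\<^esub>" "\<zero>\<^bsub>CC\<^esub> = \<zero>\<^bsub>LC\<^esub>"
  by (simp_all add: contraction_def)

lemma carrier_contraction: "carrier CC = generate_ring LC contraction_gens"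
  by (simp add: contraction_eq)

lemmas poly = poly_to_laurent_hom[OF R.cring_axioms C.cring_axioms \<phi>]

lemma contraction_gens_closed: "contraction_gens \<subseteq> carrier LC"
  by (auto simp: contraction_gens_def single_simps ring_hom_closed[OF poly(1)])

lemma contraction_subring: "subring (carrier CC) LC"
  unfolding carrier_contraction by (rule LC.generate_ring_is_subring[OF contraction_gens_closed])

lemma contraction_cring: "cring CC"
  using LC.subcring_iff[of "carrier CC"] LC.subcringI'[OF contraction_subring]
    subringE(1)[OF contraction_subring]
  by (simp add: contraction_eq)

sublocale CC: cring CC by (rule contraction_cring)

lemma incl_hom: "(\<lambda>x. x) \<in> ring_hom CC LC"
  using subringE(1)[OF contraction_subring] by (auto simp: ring_hom_def contraction_ops)

lemma CC_in_LC: "x \<in> carrier CC \<Longrightarrow> x \<in> carrier LC"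
  using subringE(1)[OF contraction_subring] by blast

text \<open>Sum and product of the contraction are those of the Laurent ring by definition, but
  negation is described through the carrier, so it has to be transferred along the
  inclusion.\<close>

lemma contraction_uminus: "x \<in> carrier CC \<Longrightarrow> \<ominus>\<^bsub>CC\<^esub> x = \<ominus>\<^bsub>LC\<^esub> x"
  using ring_hom_minus[OF CC.ring_axioms LC.ring_axioms incl_hom] by simp

lemma contraction_minus: "x \<in> carrier CC \<Longrightarrow> y \<in> carrier CC \<Longrightarrow> x \<ominus>\<^bsub>CC\<^esub> y = x \<ominus>\<^bsub>LC\<^esub> y"
  using ring_hom_diff[OF CC.ring_axioms LC.ring_axioms incl_hom] by simp

lemma structure_hom: "poly_to_laurent R C \<phi> 2 \<in> ring_hom (UP R) CC"
proof -
  have "poly_to_laurent R C \<phi> 2 p \<in> carrier CC" if "p \<in> carrier (UP R)" for p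
    unfolding carrier_contraction using that
    by (intro generate_ring.incl) (auto simp: contraction_gens_def)
  then show ?thesis
    using poly(1)[of 2] by (auto simp: ring_hom_def contraction_ops)
qed

lemma const_in_CC: "r \<in> carrier R \<Longrightarrow> single C (\<phi> r) 0 \<in> carrier CC"
  using ring_hom_closed[OF structure_hom, of "monom (UP R) r 0"] poly(2)
    UP_ring.monom_closed[of R r 0] by (simp add: UP_ring_def R.ring_axioms)

lemma s_in_CC: "single C \<one>\<^bsub>C\<^esub> 2 \<in> carrier CC"
  using ring_hom_closed[OF structure_hom, of "monom (UP R) \<one>\<^bsub>R\<^esub> 1"] poly(3)
    UP_ring.monom_closed[of R "\<one>\<^bsub>R\<^esub>" 1] by (simp add: UP_ring_def R.ring_axioms)

lemma even_in_CC: "c \<in> carrier C \<Longrightarrow> single C (even_part c) 0 \<in> carrier CC"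
  unfolding carrier_contraction
  by (intro generate_ring.incl) (auto simp: contraction_gens_def \<sigma>_even)

lemma odd_in_CC: "c \<in> carrier C \<Longrightarrow> single C (odd_part c) (- 1) \<in> carrier CC"
  unfolding carrier_contraction
  by (intro generate_ring.incl) (auto simp: contraction_gens_def \<sigma>_odd)

lemma s_times_odd:
  "c \<in> carrier C \<Longrightarrow>
    single C \<one>\<^bsub>C\<^esub> 2 \<otimes>\<^bsub>LC\<^esub> single C (odd_part c) (- 1) = single C (odd_part c) 1"
  by (simp add: single_simps)

text \<open>This is the element (s / \<surd>s) c_-, the image of the coordinate in block (1,
  2).\<close>

lemma odd_in_CC': "c \<in> carrier C \<Longrightarrow> single C (odd_part c) 1 \<in> carrier CC"
  using CC.m_closed[OF s_in_CC odd_in_CC] by (simp add: contraction_ops s_times_odd)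

lemma coord_eq:
  "contraction_coord C \<sigma> c (p, q, \<mu>) =
    (if p = q then single C (even_part (c \<mu>)) 0
     else single C (odd_part (c \<mu>)) (if (p, q) = (1, 2) then 1 else - 1))"
  by (simp add: contraction_coord_def even_part_def odd_part_def)

lemma coord_closed:
  assumes "v \<in> block_vars M" "\<And>\<mu>. \<mu> \<in> M \<Longrightarrow> c \<mu> \<in> carrier C"
  shows "contraction_coord C \<sigma> c v \<in> carrier CC"
proof -
  obtain p q \<mu> where v: "v = (p, q, \<mu>)" by (cases v)
  then have "c \<mu> \<in> carrier C" using assms by (auto simp: block_vars_def)
  then show ?thesis by (simp add: v coord_eq even_in_CC odd_in_CC odd_in_CC')
qed

section \<open>Generators of the contraction and its closed immersion\<close>

lemma subring_trans:
  assumes "subring E CC"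
  shows "subring E LC"
  using subringE[OF assms] CC_in_LC contraction_uminus
  by (intro LC.subringI) (auto simp: contraction_ops subset_iff)

text \<open>The elements of \<open>C\<close> whose even part, and whose odd part over the root, both
  land in \<open>E\<close> form a subalgebra. Both claims are carried through one induction because
  each product rule involves parts of both kinds. The generators of the contraction are then
  reached, since an invariant or anti-invariant element is its own even or odd part.\<close>

lemma CC_least:
  assumes gen: "generates_algebra R C \<phi> (c ` M)" and E: "subring E LC"
    and const: "\<And>r. r \<in> carrier R \<Longrightarrow> single C (\<phi> r) 0 \<in> E" and s: "single C \<one>\<^bsub>C\<^esub> 2 \<in> E"
    and even: "\<And>\<mu>. \<mu> \<in> M \<Longrightarrow> single C (even_part (c \<mu>)) 0 \<in> E"
    and odd: "\<And>\<mu>. \<mu> \<in> M \<Longrightarrow> single C (odd_part (c \<mu>)) (- 1) \<in> E"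
  shows "carrier CC \<subseteq> E"
proof -
  note E' = subringE[OF E]
  have sub: "\<phi> ` carrier R \<union> c ` M \<subseteq> carrier C"
    using gen by (auto simp: generates_algebra_def)
  note inC = C.generate_ring_in_carrier[OF sub]
  have parts: "single C (even_part x) 0 \<in> E \<and> single C (odd_part x) (- 1) \<in> E"
    if "x \<in> generate_ring C (\<phi> ` carrier R \<union> c ` M)" for x
    using that
  proof induction
    case one
    have "\<phi> \<one>\<^bsub>R\<^esub> = \<one>\<^bsub>C\<^esub>" by (rule ring_hom_one[OF \<phi>])
    then show ?case
      using const[of "\<one>\<^bsub>R\<^esub>"] E'(2) parts_\<phi>[of "\<one>\<^bsub>R\<^esub>"] by (simp add: single_zero)
  next
    case (incl h)
    then show ?case using const even odd E'(2) by (auto simp: parts_\<phi> single_zero)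
  next
    case (a_inv x)
    note x = inC[OF a_inv.hyps]
    show ?case
      using a_inv.IH E'(5) x by (simp add: parts_uminus single_simps(4)[symmetric])
  next
    case (eng_add x y)
    note x = inC[OF eng_add.hyps(1)] and y = inC[OF eng_add.hyps(2)]
    show ?case
      using eng_add.IH E'(7) x y by (simp add: parts_add single_simps(3)[symmetric])
  next
    case (eng_mult x y)
    note x = inC[OF eng_mult.hyps(1)] and y = inC[OF eng_mult.hyps(2)]
    \<comment> \<open>The exponents 2, - 1 and - 1 add up to 0: the factor s cancels the two
      denominators.\<close>
    have e: "single C (even_part (x \<otimes>\<^bsub>C\<^esub> y)) 0 =
        single C (even_part x) 0 \<otimes>\<^bsub>LC\<^esub> single C (even_part y) 0 \<oplus>\<^bsub>LC\<^esub>
        single C \<one>\<^bsub>C\<^esub> 2 \<otimes>\<^bsub>LC\<^esub> (single C (odd_part x) (- 1) \<otimes>\<^bsub>LC\<^esub> single C (odd_part y) (- 1))"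
      using x y by (simp add: single_simps parts_mult)
    have o: "single C (odd_part (x \<otimes>\<^bsub>C\<^esub> y)) (- 1) =
        single C (even_part x) 0 \<otimes>\<^bsub>LC\<^esub> single C (odd_part y) (- 1) \<oplus>\<^bsub>LC\<^esub>
        single C (odd_part x) (- 1) \<otimes>\<^bsub>LC\<^esub> single C (even_part y) 0"
      using x y by (simp add: single_simps parts_mult)
    show ?case
      unfolding e o using eng_mult.IH s by (intro conjI E'(6,7)) auto
  qed
  have parts': "single C (even_part x) 0 \<in> E" "single C (odd_part x) (- 1) \<in> E"
    if "x \<in> carrier C" for x
    using parts gen that by (auto simp: generates_algebra_def)
  interpret UP: cring "UP R" by (rule UP_is_cring[OF R.cring_axioms])
  interpret UPR: UP_ring R "UP R" by (simp add: UP_ring_def R.ring_axioms)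
  \<comment> \<open>R[s] is generated by the constants and s, whose images are in
    \<open>E\<close>.\<close>
  have poly_in: "poly_to_laurent R C \<phi> 2 p \<in> E" if p: "p \<in> carrier (UP R)" for p
  proof (rule ring_hom_image_in_subring[OF UP.ring_axioms LC.ring_axioms poly(1) _ E _
        subsetD[OF UP_generated[OF R.cring_axioms] p]])
    fix h assume "h \<in> (\<lambda>r. monom (UP R) r 0) ` carrier R \<union> {monom (UP R) \<one>\<^bsub>R\<^esub> 1}"
    then show "poly_to_laurent R C \<phi> 2 h \<in> E"
      using const s by (elim UnE imageE insertE emptyE) (simp_all only: poly(2,3))
  qed auto
  have "contraction_gens \<subseteq> E"
  proof
    fix x assume "x \<in> contraction_gens"
    then show "x \<in> E"
      unfolding contraction_gens_def
    proof (elim UnE imageE CollectE exE conjE)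
      fix a assume "x = single C a 0" "a \<in> carrier C" "\<sigma> a = a"
      then show ?thesis using parts'(1)[of a] by (simp add: parts_of_invariant)
    next
      fix a assume "x = single C a (- 1)" "a \<in> carrier C" "\<sigma> a = \<ominus>\<^bsub>C\<^esub> a"
      then show ?thesis using parts'(2)[of a] by (simp add: parts_of_anti_invariant)
    qed (simp add: poly_in)
  qed
  then show ?thesis
    unfolding carrier_contraction
    by (rule LC.generate_ring_min_subring1[OF contraction_gens_closed E])
qed

text \<open>Generators of R[s], together with the images of the coordinates in the blocks (1, 1) and
  (2, 1).\<close>

definition small_gens :: "('m \<Rightarrow> 'c) \<Rightarrow> 'm set \<Rightarrow> (int \<Rightarrow> 'c) set" where
  "small_gens c M = (\<lambda>r. single C (\<phi> r) 0) ` carrier R \<union> {single C \<one>\<^bsub>C\<^esub> 2}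
     \<union> (\<lambda>\<mu>. single C (even_part (c \<mu>)) 0) ` M \<union> (\<lambda>\<mu>. single C (odd_part (c \<mu>)) (- 1)) ` M"

lemma small_gens_closed: "c ` M \<subseteq> carrier C \<Longrightarrow> small_gens c M \<subseteq> carrier CC"
  by (auto simp: small_gens_def const_in_CC s_in_CC even_in_CC odd_in_CC)

text \<open>The minimality statement speaks of subrings of the Laurent ring, hence the passage to it
  from a subring of the contraction.\<close>

lemma CC_generated:
  assumes gen: "generates_algebra R C \<phi> (c ` M)"
  shows "carrier CC \<subseteq> generate_ring CC (small_gens c M)"
proof -
  have cM: "c ` M \<subseteq> carrier C" using gen by (simp add: generates_algebra_def)
  have "subring (generate_ring CC (small_gens c M)) LC"
    using CC.generate_ring_is_subring[OF small_gens_closed[OF cM]] by (rule subring_trans)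
  then show ?thesis
    by (rule CC_least[OF gen]) (auto simp: small_gens_def intro: generate_ring.incl)
qed

text \<open>With all of \<open>C\<close> as generating family, homomorphisms on the contraction can
  be compared when no particular family is given.\<close>

lemma generates_carrier: "generates_algebra R C \<phi> (id ` carrier C)"
proof -
  have "generate_ring C (\<phi> ` carrier R \<union> id ` carrier C) \<subseteq> carrier C"
    by (rule C.generate_ring_incl) auto
  then show ?thesis
    by (auto simp: generates_algebra_def intro: generate_ring.incl)
qed

text \<open>This is what makes iteration possible: the coordinates of the first embedding serve as
  the generating family for the second, over R[s] instead of R.\<close>

lemma coords_generate:
  assumes gen: "generates_algebra R C \<phi> (c ` M)"
  shows "generates_algebra (UP R) CC (poly_to_laurent R C \<phi> 2) (contraction_coord C \<sigma> c ` block_vars M)"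
proof -
  have cM: "c \<mu> \<in> carrier C" if "\<mu> \<in> M" for \<mu> using gen that by (auto simp: generates_algebra_def)
  let ?G = "poly_to_laurent R C \<phi> 2 ` carrier (UP R) \<union> contraction_coord C \<sigma> c ` block_vars M"
  interpret UPR: UP_ring R "UP R" by (simp add: UP_ring_def R.ring_axioms)
  have coord: "contraction_coord C \<sigma> c ` block_vars M \<subseteq> carrier CC"
    using coord_closed[of _ M c] cM by blast
  have G: "?G \<subseteq> carrier CC" using coord ring_hom_closed[OF structure_hom] by auto
  have "small_gens c M \<subseteq> ?G"
    unfolding small_gens_def
  proof (intro Un_least image_subsetI)
    fix r assume r: "r \<in> carrier R"
    show "single C (\<phi> r) 0 \<in> ?G"
      unfolding poly(2)[OF r, of 2, symmetric] using r by (intro UnI1 imageI) auto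
  next
    show "{single C \<one>\<^bsub>C\<^esub> 2} \<subseteq> ?G" unfolding poly(3)[of 2, symmetric] by auto
  next
    fix \<mu> assume \<mu>: "\<mu> \<in> M"
    have "single C (even_part (c \<mu>)) 0 = contraction_coord C \<sigma> c (1, 1, \<mu>)"
      by (simp only: coord_eq) simp
    then show "single C (even_part (c \<mu>)) 0 \<in> ?G" using \<mu> by (auto simp: block_vars_def)
    have "single C (odd_part (c \<mu>)) (- 1) = contraction_coord C \<sigma> c (2, 1, \<mu>)"
      by (simp only: coord_eq) simp
    then show "single C (odd_part (c \<mu>)) (- 1) \<in> ?G" using \<mu> by (auto simp: block_vars_def)
  qed
  then have "generate_ring CC (small_gens c M) \<subseteq> generate_ring CC ?G"
    by (rule CC.mono_generate_ring[OF _ G])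
  then show ?thesis
    using CC_generated[OF gen] CC.generate_ring_incl[OF G] coord
    by (auto simp: generates_algebra_def)
qed

lemma embedding_hom:
  assumes "\<And>\<mu>. \<mu> \<in> M \<Longrightarrow> c \<mu> \<in> carrier C"
  shows "contraction_embedding R C \<phi> \<sigma> c \<in> ring_hom (mpoly (UP R) (block_vars M)) CC"
    and "\<And>r. r \<in> carrier (UP R) \<Longrightarrow>
      contraction_embedding R C \<phi> \<sigma> c (mpoly_const (UP R) r) = poly_to_laurent R C \<phi> 2 r"
    and "\<And>v. v \<in> block_vars M \<Longrightarrow>
      contraction_embedding R C \<phi> \<sigma> c (mpoly_var (UP R) v) = contraction_coord C \<sigma> c v"
proof -
  have d: "contraction_coord C \<sigma> c v \<in> carrier CC" if "v \<in> block_vars M" for v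
    by (rule coord_closed[of v M c, OF that assms])
  note ev = mpoly_eval_hom[of "UP R" CC _ "block_vars M" "contraction_coord C \<sigma> c",
      OF UP_is_cring[OF R.cring_axioms] contraction_cring structure_hom d]
  show "contraction_embedding R C \<phi> \<sigma> c \<in> ring_hom (mpoly (UP R) (block_vars M)) CC"
    unfolding contraction_embedding_def using ev(1) by simp
  show "contraction_embedding R C \<phi> \<sigma> c (mpoly_const (UP R) r) = poly_to_laurent R C \<phi> 2 r"
    if "r \<in> carrier (UP R)" for r
    unfolding contraction_embedding_def using ev(2) that by simp
  show "contraction_embedding R C \<phi> \<sigma> c (mpoly_var (UP R) v) = contraction_coord C \<sigma> c v"
    if "v \<in> block_vars M" for v
    unfolding contraction_embedding_def using ev(3) that by simp
qed

lemma embedding_closed_immersion: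
  assumes gen: "generates_algebra R C \<phi> (c ` M)"
  shows "closed_immersion (mpoly (UP R) (block_vars M)) CC (contraction_embedding R C \<phi> \<sigma> c)"
proof -
  have cM: "c \<mu> \<in> carrier C" if "\<mu> \<in> M" for \<mu> using gen that by (auto simp: generates_algebra_def)
  note UP = UP_is_cring[OF R.cring_axioms]
  interpret P: cring "mpoly (UP R) (block_vars M)" by (rule mpoly_cring[OF UP])
  have e: "contraction_embedding R C \<phi> \<sigma> c \<in> ring_hom (mpoly (UP R) (block_vars M)) CC"
    "\<And>r. r \<in> carrier (UP R) \<Longrightarrow>
      contraction_embedding R C \<phi> \<sigma> c (mpoly_const (UP R) r) = poly_to_laurent R C \<phi> 2 r"
    "\<And>v. v \<in> block_vars M \<Longrightarrow>
      contraction_embedding R C \<phi> \<sigma> c (mpoly_var (UP R) v) = contraction_coord C \<sigma> c v"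
    by (rule embedding_hom[of M c], erule cM, assumption?)+
  let ?G = "poly_to_laurent R C \<phi> 2 ` carrier (UP R) \<union> contraction_coord C \<sigma> c ` block_vars M"
  have "contraction_embedding R C \<phi> \<sigma> c ` carrier (mpoly (UP R) (block_vars M)) = carrier CC"
  proof (rule ring_hom_surj_on_generators[OF P.ring_axioms CC.ring_axioms])
    show "contraction_embedding R C \<phi> \<sigma> c \<in> ring_hom (mpoly (UP R) (block_vars M)) CC"
      using e(1) .
    show "carrier CC \<subseteq> generate_ring CC ?G"
      using coords_generate[OF gen] by (simp add: generates_algebra_def)
    show "?G \<subseteq> contraction_embedding R C \<phi> \<sigma> c ` carrier (mpoly (UP R) (block_vars M))"
    proof (intro Un_least image_subsetI)
      fix r assume r: "r \<in> carrier (UP R)"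
      show "poly_to_laurent R C \<phi> 2 r \<in> contraction_embedding R C \<phi> \<sigma> c ` carrier (mpoly (UP R) (block_vars M))"
        unfolding e(2)[OF r, symmetric]
        by (rule imageI) (rule ring_hom_closed[OF mpoly_const_hom[OF UP] r])
    next
      fix v assume v: "v \<in> block_vars M"
      show "contraction_coord C \<sigma> c v \<in> contraction_embedding R C \<phi> \<sigma> c ` carrier (mpoly (UP R) (block_vars M))"
        unfolding e(3)[OF v, symmetric]
        by (rule imageI) (rule mpoly_var_closed[OF UP v])
    qed
  qed
  then show ?thesis using e(1) by (simp add: closed_immersion_def)
qed

section \<open>Adjoining an invertible square root of s\<close>

lemma contraction_and_sqrt_generate:
  assumes E: "subring E LC" and CC: "carrier CC \<subseteq> E"
    and u: "single C \<one>\<^bsub>C\<^esub> 1 \<in> E" "single C \<one>\<^bsub>C\<^esub> (- 1) \<in> E"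
  shows "carrier LC \<subseteq> E"
proof -
  note E' = subringE[OF E]
  have "single C c 0 \<in> E" if c: "c \<in> carrier C" for c
  proof -
    \<comment> \<open>With u the square root of s, c = c_+ + (c_- / u) u.\<close>
    have "single C (even_part c) 0 \<oplus>\<^bsub>LC\<^esub> single C (odd_part c) (- 1) \<otimes>\<^bsub>LC\<^esub> single C \<one>\<^bsub>C\<^esub> 1 \<in> E"
      using even_in_CC[OF c] odd_in_CC[OF c] CC u by (intro E'(6,7)) auto
    then show ?thesis using c by (simp add: single_simps even_plus_odd)
  qed
  then have "(\<lambda>c. single C c 0) ` carrier C \<union> {single C \<one>\<^bsub>C\<^esub> 1, single C \<one>\<^bsub>C\<^esub> (- 1)} \<subseteq> E"
    using u by auto
  then have "generate_ring LC
      ((\<lambda>c. single C c 0) ` carrier C \<union> {single C \<one>\<^bsub>C\<^esub> 1, single C \<one>\<^bsub>C\<^esub> (- 1)}) \<subseteq> E"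
    by (intro LC.generate_ring_min_subring1 E) (auto simp: single_simps)
  with laurent_generated[OF C.cring_axioms] show ?thesis by (rule subset_trans)
qed

text \<open>With \<open>je\<close> and \<open>jo\<close> the values of \<open>j\<close> on c_+ and
  on c_- / \<surd>s, the product rules for the parts become the rules for multiplying expressions e
  + o v with v^2 = j s. So \<psi> is a homomorphism on \<open>C\<close>, and the universal property
  of the Laurent ring applies to it and to the unit \<open>v\<close>.\<close>

lemma contraction_extension:
  assumes D: "cring D" and j: "j \<in> ring_hom CC D" and v: "v \<in> Units D"
    and vv: "v \<otimes>\<^bsub>D\<^esub> v = j (single C \<one>\<^bsub>C\<^esub> 2)"
  obtains F where "F \<in> ring_hom LC D" "\<And>f. f \<in> carrier CC \<Longrightarrow> F f = j f" "F (single C \<one>\<^bsub>C\<^esub> 1) = v"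
proof -
  interpret D: cring D by fact
  define je where "je c = j (single C (even_part c) 0)" for c
  define jo where "jo c = j (single C (odd_part c) (- 1))" for c
  have cl: "je c \<in> carrier D" "jo c \<in> carrier D" if "c \<in> carrier C" for c
    using that ring_hom_closed[OF j] by (auto simp: je_def jo_def even_in_CC odd_in_CC)
  have vc: "v \<in> carrier D" using v by (rule D.Units_closed)
  have j0: "j \<zero>\<^bsub>LC\<^esub> = \<zero>\<^bsub>D\<^esub>"
    using ring_hom_zero[OF j CC.ring_axioms D.ring_axioms] by (simp add: contraction_ops)
  have jadd: "j (x \<oplus>\<^bsub>LC\<^esub> y) = j x \<oplus>\<^bsub>D\<^esub> j y" if "x \<in> carrier CC" "y \<in> carrier CC" for x y
    using ring_hom_add[OF j that] by (simp add: contraction_ops)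
  have jmult: "j (x \<otimes>\<^bsub>LC\<^esub> y) = j x \<otimes>\<^bsub>D\<^esub> j y" if "x \<in> carrier CC" "y \<in> carrier CC" for x y
    using ring_hom_mult[OF j that] by (simp add: contraction_ops)
  have m_in: "x \<otimes>\<^bsub>LC\<^esub> y \<in> carrier CC" if "x \<in> carrier CC" "y \<in> carrier CC" for x y
    using CC.m_closed[OF that] by (simp add: contraction_ops)
  have je_add: "je (c \<oplus>\<^bsub>C\<^esub> d) = je c \<oplus>\<^bsub>D\<^esub> je d" and jo_add: "jo (c \<oplus>\<^bsub>C\<^esub> d) = jo c \<oplus>\<^bsub>D\<^esub> jo d"
    if "c \<in> carrier C" "d \<in> carrier C" for c d
    using that
    by (simp_all add: je_def jo_def parts_add single_simps(3)[symmetric] jadd even_in_CC odd_in_CC)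
  have je_mult: "je (c \<otimes>\<^bsub>C\<^esub> d) = je c \<otimes>\<^bsub>D\<^esub> je d \<oplus>\<^bsub>D\<^esub> (v \<otimes>\<^bsub>D\<^esub> v) \<otimes>\<^bsub>D\<^esub> (jo c \<otimes>\<^bsub>D\<^esub> jo d)"
    if c: "c \<in> carrier C" and d: "d \<in> carrier C" for c d
  proof -
    have eq: "single C (even_part (c \<otimes>\<^bsub>C\<^esub> d)) 0 =
        single C (even_part c) 0 \<otimes>\<^bsub>LC\<^esub> single C (even_part d) 0 \<oplus>\<^bsub>LC\<^esub>
        single C \<one>\<^bsub>C\<^esub> 2 \<otimes>\<^bsub>LC\<^esub> (single C (odd_part c) (- 1) \<otimes>\<^bsub>LC\<^esub> single C (odd_part d) (- 1))"
      using c d by (simp add: single_simps parts_mult)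
    show ?thesis
      unfolding je_def jo_def eq vv
      using c d by (simp only: jadd jmult m_in s_in_CC even_in_CC odd_in_CC)
  qed
  have jo_mult: "jo (c \<otimes>\<^bsub>C\<^esub> d) = je c \<otimes>\<^bsub>D\<^esub> jo d \<oplus>\<^bsub>D\<^esub> jo c \<otimes>\<^bsub>D\<^esub> je d"
    if c: "c \<in> carrier C" and d: "d \<in> carrier C" for c d
  proof -
    have eq: "single C (odd_part (c \<otimes>\<^bsub>C\<^esub> d)) (- 1) =
        single C (even_part c) 0 \<otimes>\<^bsub>LC\<^esub> single C (odd_part d) (- 1) \<oplus>\<^bsub>LC\<^esub>
        single C (odd_part c) (- 1) \<otimes>\<^bsub>LC\<^esub> single C (even_part d) 0"
      using c d by (simp add: single_simps parts_mult)
    show ?thesis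
      unfolding je_def jo_def eq
      using c d by (simp only: jadd jmult m_in s_in_CC even_in_CC odd_in_CC)
  qed
  have je_one: "je \<one>\<^bsub>C\<^esub> = \<one>\<^bsub>D\<^esub>" and jo_one: "jo \<one>\<^bsub>C\<^esub> = \<zero>\<^bsub>D\<^esub>"
    using ring_hom_one[OF j]
    by (simp_all add: je_def jo_def parts_of_invariant ring_hom_one[OF \<sigma>] single_zero j0
        contraction_ops single_simps)
  define \<psi> where "\<psi> c = je c \<oplus>\<^bsub>D\<^esub> jo c \<otimes>\<^bsub>D\<^esub> v" for c
  have \<psi>: "\<psi> \<in> ring_hom C D"
  proof (rule ring_hom_memI)
    fix c d assume c: "c \<in> carrier C" and d: "d \<in> carrier C"
    note cl' = cl[OF c] cl[OF d] vc
    show "\<psi> c \<in> carrier D" using cl' by (simp add: \<psi>_def)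
    show "\<psi> (c \<otimes>\<^bsub>C\<^esub> d) = \<psi> c \<otimes>\<^bsub>D\<^esub> \<psi> d"
      unfolding \<psi>_def je_mult[OF c d] jo_mult[OF c d] using cl' by algebra
    show "\<psi> (c \<oplus>\<^bsub>C\<^esub> d) = \<psi> c \<oplus>\<^bsub>D\<^esub> \<psi> d"
      unfolding \<psi>_def je_add[OF c d] jo_add[OF c d] using cl' by algebra
  next
    show "\<psi> \<one>\<^bsub>C\<^esub> = \<one>\<^bsub>D\<^esub>" by (simp add: \<psi>_def je_one jo_one vc)
  qed
  obtain F where F: "F \<in> ring_hom LC D" and F_const: "\<And>c. c \<in> carrier C \<Longrightarrow> F (single C c 0) = \<psi> c"
    and F_var: "F (single C \<one>\<^bsub>C\<^esub> 1) = v"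
    using laurent_hom_exists[OF C.cring_axioms D \<psi> v] by metis
  have F_mult: "F (x \<otimes>\<^bsub>LC\<^esub> y) = F x \<otimes>\<^bsub>D\<^esub> F y" if "x \<in> carrier LC" "y \<in> carrier LC" for x y
    by (rule ring_hom_mult[OF F that])
  have F_even: "F (single C a 0) = j (single C a 0)" if "a \<in> carrier C" "\<sigma> a = a" for a
    using that cl[of a] by (simp add: F_const \<psi>_def je_def jo_def parts_of_invariant single_zero j0 vc)
  \<comment> \<open>The division by the root has to be undone: \<psi> a is \<open>jo a\<close> times
    \<open>v\<close>, and the inverse variable contributes the inverse of \<open>v\<close>.\<close>
  have F_odd: "F (single C a (- 1)) = j (single C a (- 1))" if a: "a \<in> carrier C" "\<sigma> a = \<ominus>\<^bsub>C\<^esub> a" for a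
  proof -
    let ?w = "F (single C \<one>\<^bsub>C\<^esub> (- 1))"
    have w: "?w \<in> carrier D" by (rule ring_hom_closed[OF F]) (simp add: single_simps)
    have vw: "v \<otimes>\<^bsub>D\<^esub> ?w = \<one>\<^bsub>D\<^esub>"
      using F_mult[of "single C \<one>\<^bsub>C\<^esub> 1" "single C \<one>\<^bsub>C\<^esub> (- 1)"] ring_hom_one[OF F]
      by (simp add: F_var single_simps)
    have ja: "jo a \<in> carrier D" using cl a by simp
    have "F (single C a (- 1)) = \<psi> a \<otimes>\<^bsub>D\<^esub> ?w"
      using F_mult[of "single C a 0" "single C \<one>\<^bsub>C\<^esub> (- 1)"] a by (simp add: F_const single_simps)
    also have "\<psi> a = jo a \<otimes>\<^bsub>D\<^esub> v"
      using a ja vc by (simp add: \<psi>_def je_def parts_of_anti_invariant single_zero j0)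
    also have "jo a \<otimes>\<^bsub>D\<^esub> v \<otimes>\<^bsub>D\<^esub> ?w = jo a" using ja vc w by (simp add: D.m_assoc vw)
    finally show ?thesis using a by (simp add: jo_def parts_of_anti_invariant)
  qed
  have F': "F \<in> ring_hom CC D"
    using F CC_in_LC by (auto simp: ring_hom_def contraction_ops)
  have F_j: "F f = j f" if f: "f \<in> carrier CC" for f
  proof (rule ring_hom_eq_on_generate_ring[OF CC.ring_axioms D.ring_axioms _ F' j _
        subsetD[OF CC_generated[OF generates_carrier] f]])
    show "small_gens id (carrier C) \<subseteq> carrier CC" by (rule small_gens_closed) auto
    fix h assume "h \<in> small_gens id (carrier C)"
    then show "F h = j h"
      unfolding small_gens_def
    proof (elim UnE imageE insertE emptyE)
      assume h: "h = single C \<one>\<^bsub>C\<^esub> 2"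
      have "F h = v \<otimes>\<^bsub>D\<^esub> v"
        using F_mult[of "single C \<one>\<^bsub>C\<^esub> 1" "single C \<one>\<^bsub>C\<^esub> 1"] by (simp add: h F_var single_simps)
      then show ?thesis by (simp add: h vv)
    qed (simp_all add: F_even F_odd \<sigma>_even \<sigma>_odd \<sigma>\<phi>)
  qed
  show ?thesis by (rule that[OF F F_j F_var])
qed

end

section \<open>The twofold contraction\<close>

lemma ring_hom_Units:
  assumes X: "cring X" and Y: "cring Y" and F: "F \<in> ring_hom X Y" and x: "x \<in> Units X"
  shows "F x \<in> Units Y"
proof -
  interpret X: cring X by fact
  interpret Y: cring Y by fact
  obtain y where y: "y \<in> carrier X" "y \<otimes>\<^bsub>X\<^esub> x = \<one>\<^bsub>X\<^esub>" using x by (auto simp: Units_def)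
  have xc: "x \<in> carrier X" using x by (rule X.Units_closed)
  have "F y \<otimes>\<^bsub>Y\<^esub> F x = \<one>\<^bsub>Y\<^esub>"
    using ring_hom_mult[OF F y(1) xc] y(2) ring_hom_one[OF F] by simp
  moreover have "F x \<in> carrier Y" "F y \<in> carrier Y"
    using ring_hom_closed[OF F] xc y(1) by auto
  ultimately show ?thesis
    unfolding Units_def using Y.m_comm[of "F x" "F y"] by (auto intro!: bexI[of _ "F y"])
qed

lemma ring_hom_preimage_subring:
  assumes X: "ring X" and D: "ring D" and F: "F \<in> ring_hom X D" and E: "subring E D"
  shows "subring {x \<in> carrier X. F x \<in> E} X"
proof -
  interpret X: ring X by fact
  note E' = subringE[OF E]
  show ?thesis
    using E'(3,5-7)
    by (intro X.subringI)
      (auto simp: ring_hom_one[OF F] ring_hom_minus[OF X D F] ring_hom_add[OF F] ring_hom_mult[OF F])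
qed

lemma ring_hom_ident: "(\<lambda>x. x) \<in> ring_hom X X"
  by (auto simp: ring_hom_def)

lemma laurent_map_hom:
  "cring X \<Longrightarrow> cring Y \<Longrightarrow> F \<in> ring_hom X Y \<Longrightarrow> (\<lambda>f m. F (f m)) \<in> ring_hom (laurent X) (laurent Y)"
  using abelian_integer_group by (intro monoid_ring_map_hom) (auto simp: comm_group_def)

lemma mpoly_map_hom:
  assumes "cring X" "cring Y" "F \<in> ring_hom X Y"
  shows "(\<lambda>f m. F (f m)) \<in> ring_hom (mpoly X V) (mpoly Y V)"
  using assms mpoly_setup[of X V] unfolding monoid_ring_setup_def
  by (intro monoid_ring_map_hom) auto

lemma map_single:
  assumes "cring X" "cring Y" "F \<in> ring_hom X Y"
  shows "(\<lambda>n. F (single X x m n)) = single Y (F x) m"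
  using ring_hom_zero[OF assms(3) _ _] assms(1,2) by (auto simp: single_def cring_def)

section \<open>Laurent polynomials and polynomials in two variables\<close>

lemma laurent2_cring: "cring C \<Longrightarrow> cring (laurent2 C)"
  by (intro laurent_cring)

lemma single2_closed: "cring C \<Longrightarrow> c \<in> carrier C \<Longrightarrow> single2 C c m n \<in> carrier (laurent2 C)"
  unfolding single2_def by (intro laurent_single_closed laurent_cring)

lemma single2_mult:
  assumes "cring C" "c \<in> carrier C" "d \<in> carrier C"
  shows "single2 C c m n \<otimes>\<^bsub>laurent2 C\<^esub> single2 C d m' n' = single2 C (c \<otimes>\<^bsub>C\<^esub> d) (m + m') (n + n')"
  using assms
  by (simp add: single2_def laurent_single_mult laurent_cring laurent_single_closed)

lemma single2_one: "cring C \<Longrightarrow> single2 C \<one>\<^bsub>C\<^esub> 0 0 = \<one>\<^bsub>laurent2 C\<^esub>"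
  by (simp add: single2_def laurent_one laurent_cring)

lemma single2_Units:
  assumes "cring C"
  shows "single2 C \<one>\<^bsub>C\<^esub> m n \<in> Units (laurent2 C)"
proof -
  interpret cring C by fact
  show ?thesis
    using assms unfolding Units_def
    by (auto simp: single2_closed single2_mult single2_one intro!: bexI[of _ "single2 C \<one>\<^bsub>C\<^esub> (- m) (- n)"])
qed

lemma single2_const_hom: "cring C \<Longrightarrow> (\<lambda>c. single2 C c 0 0) \<in> ring_hom C (laurent2 C)"
  using ring_hom_trans[OF laurent_const_hom laurent_const_hom[OF laurent_cring]]
  by (auto simp: single2_def comp_def)

lemma single2_var2: "cring C \<Longrightarrow> single2 C \<one>\<^bsub>C\<^esub> 0 n = single (laurent C) \<one>\<^bsub>laurent C\<^esub> n"
  by (simp add: single2_def laurent_one)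

text \<open>The one-variable statement is applied to the outer variable and, after composition with
  the constant embedding, to the inner one.\<close>

lemma laurent2_hom_unique:
  assumes C: "cring C" and D: "cring D"
    and F: "F \<in> ring_hom (laurent2 C) D" and G: "G \<in> ring_hom (laurent2 C) D"
    and const: "\<And>c. c \<in> carrier C \<Longrightarrow> F (single2 C c 0 0) = G (single2 C c 0 0)"
    and u1: "F (single2 C \<one>\<^bsub>C\<^esub> 1 0) = G (single2 C \<one>\<^bsub>C\<^esub> 1 0)"
    and u2: "F (single2 C \<one>\<^bsub>C\<^esub> 0 1) = G (single2 C \<one>\<^bsub>C\<^esub> 0 1)"
    and f: "f \<in> carrier (laurent2 C)"
  shows "F f = G f"
proof (rule laurent_hom_unique[OF laurent_cring[OF C] D F G _ _ f])
  note hom = laurent_const_hom[OF laurent_cring[OF C]]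
  fix g assume g: "g \<in> carrier (laurent C)"
  have "(F \<circ> (\<lambda>g. single (laurent C) g 0)) g = (G \<circ> (\<lambda>g. single (laurent C) g 0)) g"
    using const u1 unfolding single2_def
    by (intro laurent_hom_unique[OF C D ring_hom_trans[OF hom F] ring_hom_trans[OF hom G] _ _ g]) simp_all
  then show "F (single (laurent C) g 0) = G (single (laurent C) g 0)" by simp
qed (use u2 C in \<open>simp add: single2_var2\<close>)

lemma laurent2_hom_exists:
  assumes C: "cring C" and D: "cring D" and \<psi>: "\<psi> \<in> ring_hom C D"
    and v1: "v1 \<in> Units D" and v2: "v2 \<in> Units D"
  obtains F where "F \<in> ring_hom (laurent2 C) D"
    and "\<And>c. c \<in> carrier C \<Longrightarrow> F (single2 C c 0 0) = \<psi> c"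
    and "F (single2 C \<one>\<^bsub>C\<^esub> 1 0) = v1" and "F (single2 C \<one>\<^bsub>C\<^esub> 0 1) = v2"
proof -
  obtain F1 where F1: "F1 \<in> ring_hom (laurent C) D"
    "\<And>c. c \<in> carrier C \<Longrightarrow> F1 (single C c 0) = \<psi> c" "F1 (single C \<one>\<^bsub>C\<^esub> 1) = v1"
    using laurent_hom_exists[OF C D \<psi> v1] by metis
  obtain F where F: "F \<in> ring_hom (laurent2 C) D"
    "\<And>c. c \<in> carrier (laurent C) \<Longrightarrow> F (single (laurent C) c 0) = F1 c"
    "F (single (laurent C) \<one>\<^bsub>laurent C\<^esub> 1) = v2"
    using laurent_hom_exists[OF laurent_cring[OF C] D F1(1) v2] by metis
  show ?thesis
  proof (rule that[OF F(1)])
    show "F (single2 C c 0 0) = \<psi> c" if "c \<in> carrier C" for c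
      using that C F(2) F1(2) by (simp add: single2_def laurent_single_closed)
    show "F (single2 C \<one>\<^bsub>C\<^esub> 1 0) = v1"
      using C F(2) F1(3) by (simp add: single2_def laurent_single_closed cring.cring_simprules(6))
    show "F (single2 C \<one>\<^bsub>C\<^esub> 0 1) = v2"
      using C F(3) by (simp add: single2_var2)
  qed
qed

definition laurent2_vars where
  "laurent2_vars C = {single2 C \<one>\<^bsub>C\<^esub> 1 0, single2 C \<one>\<^bsub>C\<^esub> (- 1) 0, single2 C \<one>\<^bsub>C\<^esub> 0 1, single2 C \<one>\<^bsub>C\<^esub> 0 (- 1)}"

text \<open>The inner Laurent polynomials whose constant image lies in the generated subring form a
  subring themselves, and it contains the inner generators.\<close>

lemma laurent2_generated:
  assumes C: "cring C"
  shows "carrier (laurent2 C) \<subseteq>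
    generate_ring (laurent2 C) ((\<lambda>c. single2 C c 0 0) ` carrier C \<union> laurent2_vars C)"
    (is "_ \<subseteq> generate_ring ?L ?H")
proof -
  interpret C: cring C by fact
  interpret L1: cring "laurent C" by (rule laurent_cring) fact
  interpret L: cring ?L by (rule laurent2_cring) fact
  have H: "?H \<subseteq> carrier ?L" by (auto simp: laurent2_vars_def single2_closed C)
  note E = L.generate_ring_is_subring[OF H]
  note hom = laurent_const_hom[OF laurent_cring[OF C]]
  have sub: "subring {g \<in> carrier (laurent C). single (laurent C) g 0 \<in> generate_ring ?L ?H} (laurent C)"
    by (rule ring_hom_preimage_subring[OF L1.ring_axioms L.ring_axioms hom E])
  have "generate_ring (laurent C)
      ((\<lambda>c. single C c 0) ` carrier C \<union> {single C \<one>\<^bsub>C\<^esub> 1, single C \<one>\<^bsub>C\<^esub> (- 1)})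
    \<subseteq> {g \<in> carrier (laurent C). single (laurent C) g 0 \<in> generate_ring ?L ?H}"
    using C by (intro L1.generate_ring_min_subring1 sub)
      (auto simp: laurent_single_closed laurent2_vars_def single2_def[symmetric] intro: generate_ring.incl)
  then have 1: "(\<lambda>g. single (laurent C) g 0) ` carrier (laurent C) \<subseteq> generate_ring ?L ?H"
    using laurent_generated[OF C] by auto
  have "single (laurent C) \<one>\<^bsub>laurent C\<^esub> n \<in> generate_ring ?L ?H" if "n \<in> {1, - 1}" for n
    using that C
    by (auto simp: single2_var2[symmetric] laurent2_vars_def intro: generate_ring.incl)
  with 1 have "(\<lambda>g. single (laurent C) g 0) ` carrier (laurent C) \<union>
      {single (laurent C) \<one>\<^bsub>laurent C\<^esub> 1, single (laurent C) \<one>\<^bsub>laurent C\<^esub> (- 1)} \<subseteq> generate_ring ?L ?H"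
    by auto
  then have "generate_ring ?L ((\<lambda>g. single (laurent C) g 0) ` carrier (laurent C) \<union>
      {single (laurent C) \<one>\<^bsub>laurent C\<^esub> 1, single (laurent C) \<one>\<^bsub>laurent C\<^esub> (- 1)}) \<subseteq> generate_ring ?L ?H"
    by (rule L.generate_ring_subset[OF _ H])
  with laurent_generated[OF laurent_cring[OF C]] show ?thesis by (rule subset_trans)
qed

lemma poly2_to_laurent2_hom:
  assumes k: "cring k"
  shows "poly2_to_laurent2 k n \<in> ring_hom (UP (UP k)) (laurent2 k)"
    and "\<And>r. r \<in> carrier (UP k) \<Longrightarrow> poly2_to_laurent2 k n (monom (UP (UP k)) r 0)
      = single (laurent k) (poly_to_laurent k k (\<lambda>r. r) n r) 0"
    and "poly2_to_laurent2 k n (monom (UP (UP k)) \<one>\<^bsub>UP k\<^esub> 1) = single2 k \<one>\<^bsub>k\<^esub> 0 n"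
proof -
  note h = poly_to_laurent_hom[OF k k ring_hom_ident]
  note h2 = poly_to_laurent_hom[OF UP_is_cring[OF k] laurent_cring[OF k] h(1)]
  show "poly2_to_laurent2 k n \<in> ring_hom (UP (UP k)) (laurent2 k)"
    unfolding poly2_to_laurent2_def by (rule h2(1))
  show "poly2_to_laurent2 k n (monom (UP (UP k)) r 0)
      = single (laurent k) (poly_to_laurent k k (\<lambda>r. r) n r) 0" if "r \<in> carrier (UP k)" for r
    unfolding poly2_to_laurent2_def by (rule h2(2)[OF that])
  show "poly2_to_laurent2 k n (monom (UP (UP k)) \<one>\<^bsub>UP k\<^esub> 1) = single2 k \<one>\<^bsub>k\<^esub> 0 n"
    unfolding poly2_to_laurent2_def single2_var2[OF k] by (rule h2(3))
qed

lemma UP2_hom_eqI: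
  assumes k: "cring k" and D: "cring D"
    and F: "F \<in> ring_hom (UP (UP k)) D" and G: "G \<in> ring_hom (UP (UP k)) D"
    and const: "\<And>r. r \<in> carrier k \<Longrightarrow>
      F (monom (UP (UP k)) (monom (UP k) r 0) 0) = G (monom (UP (UP k)) (monom (UP k) r 0) 0)"
    and t1: "F (monom (UP (UP k)) (monom (UP k) \<one>\<^bsub>k\<^esub> 1) 0) = G (monom (UP (UP k)) (monom (UP k) \<one>\<^bsub>k\<^esub> 1) 0)"
    and t2: "F (monom (UP (UP k)) \<one>\<^bsub>UP k\<^esub> 1) = G (monom (UP (UP k)) \<one>\<^bsub>UP k\<^esub> 1)"
    and f: "f \<in> carrier (UP (UP k))"
  shows "F f = G f"
proof (rule UP_hom_eqI[OF UP_is_cring[OF k] D F G _ t2 f])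
  fix r assume r: "r \<in> carrier (UP k)"
  interpret UP_ring "UP k" "UP (UP k)"
    using UP_is_cring[OF k] by (simp add: UP_ring_def cring_def)
  have hom: "(\<lambda>r. monom (UP (UP k)) r 0) \<in> ring_hom (UP k) (UP (UP k))"
    by (rule const_ring_hom)
  have "(F \<circ> (\<lambda>r. monom (UP (UP k)) r 0)) r = (G \<circ> (\<lambda>r. monom (UP (UP k)) r 0)) r"
    using const t1
    by (intro UP_hom_eqI[OF k D ring_hom_trans[OF hom F] ring_hom_trans[OF hom G] _ _ r]) simp_all
  then show "F (monom (UP (UP k)) r 0) = G (monom (UP (UP k)) r 0)" by simp
qed

section \<open>The action of \<eta> on the first contraction, and the second contraction\<close>

locale twofold_contraction = k: cring k + A: cring A
  for k :: "('k, 'kx) ring_scheme" and A :: "('a, 'ax) ring_scheme" and \<iota> :: "'k \<Rightarrow> 'a"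
    and \<theta> :: "'a \<Rightarrow> 'a" and \<eta> :: "'a \<Rightarrow> 'a" +
  assumes two: "\<one>\<^bsub>k\<^esub> \<oplus>\<^bsub>k\<^esub> \<one>\<^bsub>k\<^esub> \<in> Units k"
    and \<iota>: "\<iota> \<in> ring_hom k A"
    and \<theta>_invol: "involution_over k A \<iota> \<theta>" and \<eta>_invol: "involution_over k A \<iota> \<eta>"
    and commute: "\<And>b. b \<in> carrier A \<Longrightarrow> \<theta> (\<eta> b) = \<eta> (\<theta> b)"
begin

sublocale C1: contraction_setup k A \<iota> \<theta>
  using two \<iota> \<theta>_invol by unfold_locales

lemma \<eta>: "\<eta> \<in> ring_hom A A" "\<And>b. b \<in> carrier A \<Longrightarrow> \<eta> (\<eta> b) = b"
  "\<And>r. r \<in> carrier k \<Longrightarrow> \<eta> (\<iota> r) = \<iota> r"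
  using \<eta>_invol by (auto simp: involution_over_def)

lemma \<eta>_closed [simp]: "b \<in> carrier A \<Longrightarrow> \<eta> b \<in> carrier A"
  by (rule ring_hom_closed[OF \<eta>(1)])

abbreviation \<phi>\<^sub>1 where "\<phi>\<^sub>1 \<equiv> poly_to_laurent k A \<iota> 2"

lemma UPk: "cring (UP k)" by (rule UP_is_cring[OF k.cring_axioms])

lemma \<eta>_laurent: "(\<lambda>f. \<eta> \<circ> f) \<in> ring_hom C1.LC C1.LC"
  using laurent_map_hom[OF A.cring_axioms A.cring_axioms \<eta>(1)] by (simp add: comp_def)

lemma \<eta>_single: "\<eta> \<circ> single A c m = single A (\<eta> c) m"
  using map_single[OF A.cring_axioms A.cring_axioms \<eta>(1)] by (simp add: comp_def)

lemma \<eta>_\<phi>\<^sub>1: "p \<in> carrier (UP k) \<Longrightarrow> \<eta> \<circ> \<phi>\<^sub>1 p = \<phi>\<^sub>1 p"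
  using UP_hom_eqI[OF k.cring_axioms C1.LC.cring_axioms ring_hom_trans[OF C1.poly(1) \<eta>_laurent] C1.poly(1),
      where f = p]
    C1.poly(2,3) \<eta>(3) ring_hom_one[OF \<eta>(1)]
  by (simp add: \<eta>_single)

text \<open>Commutation of the involutions enters here: if \<theta> c = c or \<theta> c = - c, the
  same holds for \<eta> c, so \<eta> maps generators of the contraction to generators.\<close>

lemma \<eta>_contraction: "(\<lambda>f. \<eta> \<circ> f) \<in> ring_hom C1.CC C1.CC"
proof -
  have "\<eta> \<circ> f \<in> carrier C1.CC" if f: "f \<in> carrier C1.CC" for f
  proof (rule ring_hom_image_in_subring[OF C1.LC.ring_axioms C1.LC.ring_axioms \<eta>_laurent
        C1.contraction_gens_closed C1.contraction_subring _ f[unfolded C1.carrier_contraction]])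
    fix h assume "h \<in> C1.contraction_gens"
    then have "\<eta> \<circ> h \<in> C1.contraction_gens"
      unfolding C1.contraction_gens_def
    proof (elim UnE imageE CollectE exE conjE)
      fix c assume "h = single A c 0" "c \<in> carrier A" "\<theta> c = c"
      then show "\<eta> \<circ> h \<in> \<phi>\<^sub>1 ` carrier (UP k) \<union> {single A c 0 |c. c \<in> carrier A \<and> \<theta> c = c} \<union>
        {single A c (- 1) |c. c \<in> carrier A \<and> \<theta> c = \<ominus>\<^bsub>A\<^esub> c}"
        using commute[of c] by (auto simp: \<eta>_single)
    next
      fix c assume "h = single A c (- 1)" "c \<in> carrier A" "\<theta> c = \<ominus>\<^bsub>A\<^esub> c"
      then show "\<eta> \<circ> h \<in> \<phi>\<^sub>1 ` carrier (UP k) \<union> {single A c 0 |c. c \<in> carrier A \<and> \<theta> c = c} \<union>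
        {single A c (- 1) |c. c \<in> carrier A \<and> \<theta> c = \<ominus>\<^bsub>A\<^esub> c}"
        using commute[of c] ring_hom_minus[OF A.ring_axioms A.ring_axioms \<eta>(1), of c]
        by (auto simp: \<eta>_single)
    qed (auto simp: \<eta>_\<phi>\<^sub>1)
    then show "\<eta> \<circ> h \<in> carrier C1.CC"
      unfolding C1.carrier_contraction by (rule generate_ring.incl)
  qed
  then show ?thesis
    using \<eta>_laurent C1.CC_in_LC by (auto simp: ring_hom_def C1.contraction_ops)
qed

lemma laurent_A_coeff: "f \<in> carrier C1.LC \<Longrightarrow> f m \<in> carrier A"
  by (rule monoid_ring_setup.coeff_closed[OF laurent_setup[OF A.cring_axioms]])

lemma \<eta>_contraction_invol: "involution_over (UP k) C1.CC \<phi>\<^sub>1 (\<lambda>f. \<eta> \<circ> f)"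
  using \<eta>_contraction \<eta>_\<phi>\<^sub>1 \<eta>(2) C1.CC_in_LC laurent_A_coeff
  by (simp add: involution_over_def comp_def)

lemma two_UPk: "\<one>\<^bsub>UP k\<^esub> \<oplus>\<^bsub>UP k\<^esub> \<one>\<^bsub>UP k\<^esub> \<in> Units (UP k)"
proof -
  interpret UP_ring k "UP k" by (simp add: UP_ring_def k.ring_axioms)
  show ?thesis by (rule two_Unit_hom[OF k.cring_axioms UPk const_ring_hom two])
qed

text \<open>The first contraction, with base k[t_1] and involution \<eta>, takes the place of
  \<open>C\<close> and \<sigma>, so every result on contractions becomes available a second
  time.\<close>

sublocale C2: contraction_setup "UP k" C1.CC \<phi>\<^sub>1 "\<lambda>f. \<eta> \<circ> f"
  using UPk C1.contraction_cring C1.structure_hom \<eta>_contraction_invol two_UPk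
  by (simp add: contraction_setup_def contraction_setup_axioms_def)

section \<open>Structure maps from k[t_1, t_2]\<close>

abbreviation K where "K \<equiv> laurent2 k"
abbreviation L where "L \<equiv> laurent2 A"
abbreviation Rt where "Rt \<equiv> UP (UP k)"
abbreviation B where "B \<equiv> C2.CC"
abbreviation \<beta> where "\<beta> \<equiv> contraction2_structure k A \<iota> \<theta>"
abbreviation \<kappa> where "\<kappa> \<equiv> poly2_to_laurent2 k"
abbreviation \<iota>\<^sub>K where "\<iota>\<^sub>K \<equiv> \<lambda>f m n. \<iota> (f m n)"

sublocale K: cring K by (rule laurent2_cring[OF k.cring_axioms])
sublocale L: cring L by (rule laurent2_cring[OF A.cring_axioms])
sublocale Rt: cring Rt by (rule UP_is_cring[OF UPk])

text \<open>\<open>single\<close> depends on its ring through zero alone, and a contraction has the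
  zero of its Laurent ring. Single terms over the first contraction are therefore literally single
  terms over \<open>laurent A\<close>.\<close>

lemma single_CC: "single C1.CC f n = single C1.LC f n"
  by (simp only: single_def C1.contraction_ops)

text \<open>The convolution product over the first contraction takes its sums in that ring, the one
  over \<open>laurent A\<close> in the larger ring. Functoriality in the coefficient ring shows that
  the identity function respects both.\<close>

lemma incl_laurent: "(\<lambda>f. f) \<in> ring_hom C2.LC L"
  using laurent_map_hom[OF C1.contraction_cring C1.LC.cring_axioms C1.incl_hom] by simp

lemma incl_B: "(\<lambda>b. b) \<in> ring_hom B L"
  using ring_hom_trans[OF C2.incl_hom incl_laurent] by (simp add: comp_def)

lemma \<iota>\<^sub>K: "\<iota>\<^sub>K \<in> ring_hom K L"
  using laurent_map_hom[OF laurent_cring[OF k.cring_axioms] C1.LC.cring_axioms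
      laurent_map_hom[OF k.cring_axioms A.cring_axioms \<iota>]] .

lemma \<iota>\<^sub>K_single: "\<iota>\<^sub>K (single (laurent k) f n) = single C1.LC (\<lambda>m. \<iota> (f m)) n"
  using map_single[OF laurent_cring[OF k.cring_axioms] C1.LC.cring_axioms
      laurent_map_hom[OF k.cring_axioms A.cring_axioms \<iota>]] .

lemma \<iota>\<^sub>K_single2: "\<iota>\<^sub>K (single2 k r m n) = single2 A (\<iota> r) m n"
  unfolding single2_def \<iota>\<^sub>K_single map_single[OF k.cring_axioms A.cring_axioms \<iota>] ..

lemma \<kappa>_monoms:
  "r \<in> carrier k \<Longrightarrow> \<kappa> n (monom Rt (monom (UP k) r 0) 0) = single2 k r 0 0"
  "\<kappa> n (monom Rt (monom (UP k) \<one>\<^bsub>k\<^esub> 1) 0) = single2 k \<one>\<^bsub>k\<^esub> n 0"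
  "\<kappa> n (monom Rt \<one>\<^bsub>UP k\<^esub> 1) = single2 k \<one>\<^bsub>k\<^esub> 0 n"
proof -
  interpret UP_ring k "UP k" by (simp add: UP_ring_def k.ring_axioms)
  note h = poly_to_laurent_hom[OF k.cring_axioms k.cring_axioms ring_hom_ident]
  note h2 = poly2_to_laurent2_hom[OF k.cring_axioms]
  show "r \<in> carrier k \<Longrightarrow> \<kappa> n (monom Rt (monom (UP k) r 0) 0) = single2 k r 0 0"
    by (subst h2(2)) (simp_all add: h(2) single2_def)
  show "\<kappa> n (monom Rt (monom (UP k) \<one>\<^bsub>k\<^esub> 1) 0) = single2 k \<one>\<^bsub>k\<^esub> n 0"
    by (subst h2(2)) (simp_all only: monom_closed k.one_closed h(3) single2_def)
  show "\<kappa> n (monom Rt \<one>\<^bsub>UP k\<^esub> 1) = single2 k \<one>\<^bsub>k\<^esub> 0 n"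
    by (rule h2(3))
qed

lemma \<beta>_monoms:
  "r \<in> carrier k \<Longrightarrow> \<beta> (monom Rt (monom (UP k) r 0) 0) = single2 A (\<iota> r) 0 0"
  "\<beta> (monom Rt (monom (UP k) \<one>\<^bsub>k\<^esub> 1) 0) = single2 A \<one>\<^bsub>A\<^esub> 2 0"
  "\<beta> (monom Rt \<one>\<^bsub>UP k\<^esub> 1) = single2 A \<one>\<^bsub>A\<^esub> 0 2"
proof -
  interpret UP_ring k "UP k" by (simp add: UP_ring_def k.ring_axioms)
  show "r \<in> carrier k \<Longrightarrow> \<beta> (monom Rt (monom (UP k) r 0) 0) = single2 A (\<iota> r) 0 0"
    by (subst C2.poly(2)) (simp_all add: C1.poly(2) single2_def single_CC)
  show "\<beta> (monom Rt (monom (UP k) \<one>\<^bsub>k\<^esub> 1) 0) = single2 A \<one>\<^bsub>A\<^esub> 2 0"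
    by (subst C2.poly(2)) (simp_all only: monom_closed k.one_closed C1.poly(3) single2_def single_CC)
  show "\<beta> (monom Rt \<one>\<^bsub>UP k\<^esub> 1) = single2 A \<one>\<^bsub>A\<^esub> 0 2"
    using C2.poly(3)[of 2]
    by (simp only: single2_var2[OF A.cring_axioms] single_CC C1.contraction_ops)
qed

lemma \<kappa>_hom: "\<kappa> n \<in> ring_hom Rt K"
  by (rule poly2_to_laurent2_hom(1)[OF k.cring_axioms])

text \<open>Viewed in \<open>L\<close>, the structure map of \<open>B\<close> passes through
  \<open>K\<close> with t_i going to u_i^2. This is the compatibility that makes \<Phi> a map on the
  tensor product.\<close>

lemma \<beta>_eq: "r \<in> carrier Rt \<Longrightarrow> \<beta> r = \<iota>\<^sub>K (\<kappa> 2 r)"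
proof -
  assume r: "r \<in> carrier Rt"
  have "((\<lambda>b. b) \<circ> \<beta>) r = (\<iota>\<^sub>K \<circ> \<kappa> 2) r"
    by (rule UP2_hom_eqI[OF k.cring_axioms L.cring_axioms ring_hom_trans[OF C2.structure_hom incl_B]
          ring_hom_trans[OF \<kappa>_hom \<iota>\<^sub>K] _ _ _ r])
      (simp_all only: comp_def \<beta>_monoms \<kappa>_monoms \<iota>\<^sub>K_single2 ring_hom_one[OF \<iota>])
  then show ?thesis by simp
qed

text \<open>The substitution of u_i^2 for u_i: it is the inclusion of k[t_1, 1/t_1, t_2, 1/t_2] into
  its extension by square roots, both rings being represented by \<open>K\<close>.\<close>

lemma square_root_substitution:
  obtains \<pi> where "\<pi> \<in> ring_hom K K" "\<And>r. r \<in> carrier Rt \<Longrightarrow> \<pi> (\<kappa> 1 r) = \<kappa> 2 r"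
proof -
  obtain \<pi> where \<pi>: "\<pi> \<in> ring_hom K K" "\<And>r. r \<in> carrier k \<Longrightarrow> \<pi> (single2 k r 0 0) = single2 k r 0 0"
    "\<pi> (single2 k \<one>\<^bsub>k\<^esub> 1 0) = single2 k \<one>\<^bsub>k\<^esub> 2 0" "\<pi> (single2 k \<one>\<^bsub>k\<^esub> 0 1) = single2 k \<one>\<^bsub>k\<^esub> 0 2"
    using laurent2_hom_exists[OF k.cring_axioms K.cring_axioms single2_const_hom[OF k.cring_axioms]
        single2_Units[OF k.cring_axioms] single2_Units[OF k.cring_axioms]] by metis
  have "(\<pi> \<circ> \<kappa> 1) r = \<kappa> 2 r" if r: "r \<in> carrier Rt" for r
    by (rule UP2_hom_eqI[OF k.cring_axioms K.cring_axioms ring_hom_trans[OF \<kappa>_hom \<pi>(1)] \<kappa>_hom _ _ _ r])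
      (simp_all only: comp_def \<kappa>_monoms \<pi>)
  then show ?thesis using that \<pi>(1) by simp
qed

text \<open>The parameter distinguishes two base changes along the same ring \<open>K\<close>:
  \<open>n = 1\<close> inverts t_1 and t_2, and \<open>n = 2\<close> adjoins invertible square roots
  of them.\<close>

sublocale T: tensor_setup Rt B \<beta> K "\<kappa> n" for n
  using ring_hom_closed[OF C2.structure_hom] ring_hom_closed[OF \<kappa>_hom]
  by unfold_locales auto

sublocale TA: tensor_setup k A \<iota> K "\<lambda>r. single2 k r 0 0"
  using ring_hom_closed[OF \<iota>] ring_hom_closed[OF single2_const_hom[OF k.cring_axioms]]
  by unfold_locales auto

section \<open>Comparison of the base changes with \<open>L\<close>\<close>

abbreviation \<Phi> where "\<Phi> \<equiv> tensor_lift L (\<lambda>b. b) \<iota>\<^sub>K"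
abbreviation \<Phi>\<^sub>A where "\<Phi>\<^sub>A \<equiv> tensor_lift L (\<lambda>b. single2 A b 0 0) \<iota>\<^sub>K"

lemma \<Phi>_hom: "\<Phi> \<in> ring_hom (T.T 2) L"
  by (rule T.tensor_lift_hom[OF L.cring_axioms incl_B \<iota>\<^sub>K \<beta>_eq])

lemma \<Phi>_pt: "b \<in> carrier B \<Longrightarrow> c \<in> carrier K \<Longrightarrow> \<Phi> (T.pt 2 b c) = b \<otimes>\<^bsub>L\<^esub> \<iota>\<^sub>K c"
  by (rule T.tensor_lift_pt[OF L.cring_axioms incl_B \<iota>\<^sub>K \<beta>_eq])

lemma \<Phi>\<^sub>A_hom: "\<Phi>\<^sub>A \<in> ring_hom TA.T L"
  by (rule TA.tensor_lift_hom[OF L.cring_axioms single2_const_hom[OF A.cring_axioms] \<iota>\<^sub>K])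
    (simp add: \<iota>\<^sub>K_single2)

lemma \<Phi>\<^sub>A_pt: "b \<in> carrier A \<Longrightarrow> c \<in> carrier K \<Longrightarrow> \<Phi>\<^sub>A (TA.pt b c) = single2 A b 0 0 \<otimes>\<^bsub>L\<^esub> \<iota>\<^sub>K c"
  by (rule TA.tensor_lift_pt[OF L.cring_axioms single2_const_hom[OF A.cring_axioms] \<iota>\<^sub>K])
    (simp add: \<iota>\<^sub>K_single2)

lemma \<iota>\<^sub>K_vars: "laurent2_vars A \<subseteq> \<iota>\<^sub>K ` carrier K"
  unfolding laurent2_vars_def
  by (auto simp: ring_hom_one[OF \<iota>, symmetric] \<iota>\<^sub>K_single2[symmetric] single2_closed k.cring_axioms)

text \<open>Adjoining square roots of \<open>t\<^sub>1\<close> and \<open>t\<^sub>2\<close> to \<open>B\<close> gives all of \<open>L\<close>, so a homomorphism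
  on \<open>B\<close> extends once square roots in the target are chosen.\<close>

lemma inverse_\<Phi>:
  obtains F where "F \<in> ring_hom L (T.T 2)" "\<And>b. b \<in> carrier B \<Longrightarrow> F b = T.pt 2 b \<one>\<^bsub>K\<^esub>"
    "\<And>c. c \<in> carrier K \<Longrightarrow> F (\<iota>\<^sub>K c) = T.pt 2 \<one>\<^bsub>B\<^esub> c"
proof -
  let ?T = "T.T 2"
  let ?j = "\<lambda>b. T.pt 2 b \<one>\<^bsub>K\<^esub>"
  let ?i = "\<lambda>c. T.pt 2 \<one>\<^bsub>B\<^esub> c"
  note kc = k.cring_axioms
  note T = T.tensor_cring[of 2]
  note j = T.pt_left_hom[of 2]
  note i = T.pt_right_hom[of 2]
  define v1 where "v1 = ?i (single2 k \<one>\<^bsub>k\<^esub> 1 0)"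
  define v2 where "v2 = ?i (single2 k \<one>\<^bsub>k\<^esub> 0 1)"
  interpret UPk: UP_ring k "UP k" by (simp add: UP_ring_def k.ring_axioms)
  interpret UPR: UP_ring "UP k" Rt using UPk by (simp add: UP_ring_def cring_def)
  have v: "v1 \<in> Units ?T" "v2 \<in> Units ?T"
    unfolding v1_def v2_def
    by (rule ring_hom_Units[OF K.cring_axioms T i single2_Units[OF kc]])+
  have ji: "?j (\<beta> r) = ?i (\<kappa> 2 r)" if "r \<in> carrier Rt" for r
    using that by (rule T.pt_balanced)
  have sq: "?i (single2 k \<one>\<^bsub>k\<^esub> m n) \<otimes>\<^bsub>?T\<^esub> ?i (single2 k \<one>\<^bsub>k\<^esub> m n) = ?i (single2 k \<one>\<^bsub>k\<^esub> (m + m) (n + n))" for m n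
    by (subst ring_hom_mult[OF i, symmetric]) (simp_all add: single2_closed[OF kc] single2_mult[OF kc])
  have "v2 \<otimes>\<^bsub>?T\<^esub> v2 = ?i (\<kappa> 2 (monom Rt \<one>\<^bsub>UP k\<^esub> 1))"
    unfolding v2_def sq \<kappa>_monoms by simp
  also have "\<dots> = ?j (single C1.CC \<one>\<^bsub>C1.CC\<^esub> 2)"
    by (subst ji[symmetric]) (simp_all only: UPR.monom_closed UPk.UP_one_closed C2.poly(3))
  finally have vv2: "v2 \<otimes>\<^bsub>?T\<^esub> v2 = ?j (single C1.CC \<one>\<^bsub>C1.CC\<^esub> 2)" .
  \<comment> \<open>\<open>B\<close> is a contraction with coefficients in the first contraction, so
    the choice of \<open>v2\<close> extends the map from \<open>B\<close> to all Laurent polynomials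
    in u_2 over the first contraction.\<close>
  obtain F2 where F2: "F2 \<in> ring_hom C2.LC ?T" "\<And>f. f \<in> carrier B \<Longrightarrow> F2 f = ?j f"
    "F2 (single C1.CC \<one>\<^bsub>C1.CC\<^esub> 1) = v2"
    using C2.contraction_extension[OF T j v(2) vv2] by metis
  \<comment> \<open>The constants among these Laurent polynomials are the first contraction, to
    which the root of t_1 can now be adjoined.\<close>
  define j1 where "j1 = F2 \<circ> (\<lambda>f. single C1.CC f 0)"
  have j1: "j1 \<in> ring_hom C1.CC ?T"
    unfolding j1_def by (rule ring_hom_trans[OF laurent_const_hom[OF C1.contraction_cring] F2(1)])
  have j1_eq: "j1 f = F2 (single C1.CC f 0)" for f by (simp add: j1_def)
  \<comment> \<open>On k[t_1] the values of \<open>j1\<close> are determined by balancedness; at t_1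
    this yields the square relation for \<open>v1\<close>.\<close>
  have j1_\<phi>: "j1 (\<phi>\<^sub>1 p) = ?i (\<kappa> 2 (monom Rt p 0))" if p: "p \<in> carrier (UP k)" for p
  proof -
    have "j1 (\<phi>\<^sub>1 p) = ?j (single C1.CC (\<phi>\<^sub>1 p) 0)"
      unfolding j1_eq by (rule F2(2)[OF C2.const_in_CC[OF p]])
    also have "\<dots> = ?j (\<beta> (monom Rt p 0))"
      by (simp only: C2.poly(2)[OF p])
    also have "\<dots> = ?i (\<kappa> 2 (monom Rt p 0))" using p by (intro ji) simp
    finally show ?thesis .
  qed
  have "v1 \<otimes>\<^bsub>?T\<^esub> v1 = ?i (\<kappa> 2 (monom Rt (monom (UP k) \<one>\<^bsub>k\<^esub> 1) 0))"
    unfolding v1_def sq \<kappa>_monoms by simp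
  also have "\<dots> = j1 (\<phi>\<^sub>1 (monom (UP k) \<one>\<^bsub>k\<^esub> 1))"
    by (rule j1_\<phi>[symmetric]) simp
  also have "\<phi>\<^sub>1 (monom (UP k) \<one>\<^bsub>k\<^esub> 1) = single A \<one>\<^bsub>A\<^esub> 2" by (rule C1.poly(3))
  finally have vv1: "v1 \<otimes>\<^bsub>?T\<^esub> v1 = j1 (single A \<one>\<^bsub>A\<^esub> 2)" .
  obtain F1 where F1: "F1 \<in> ring_hom C1.LC ?T" "\<And>f. f \<in> carrier C1.CC \<Longrightarrow> F1 f = j1 f"
    "F1 (single A \<one>\<^bsub>A\<^esub> 1) = v1"
    using C1.contraction_extension[OF T j1 v(1) vv1] by metis
  \<comment> \<open>\<open>F1\<close> lives on Laurent polynomials in the inner variable alone; the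
    outer variable is put back with the same value \<open>v2\<close>.\<close>
  obtain F where F: "F \<in> ring_hom L ?T"
    "\<And>f. f \<in> carrier C1.LC \<Longrightarrow> F (single C1.LC f 0) = F1 f" "F (single C1.LC \<one>\<^bsub>C1.LC\<^esub> 1) = v2"
    using laurent_hom_exists[OF C1.LC.cring_axioms T F1(1) v(2)] by metis
  \<comment> \<open>On Laurent polynomials over the first contraction, \<open>F\<close> and
    \<open>F2\<close> have the same values at the constants and at the variable. Hence
    \<open>F\<close> extends the given map on \<open>B\<close>.\<close>
  have "(F \<circ> (\<lambda>f. f)) f = F2 f" if f: "f \<in> carrier C2.LC" for f
  proof (rule laurent_hom_unique[OF C1.contraction_cring T ring_hom_trans[OF incl_laurent F(1)] F2(1) _ _ f])
    show "(F \<circ> (\<lambda>f. f)) (single C1.CC \<one>\<^bsub>C1.CC\<^esub> 1) = F2 (single C1.CC \<one>\<^bsub>C1.CC\<^esub> 1)"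
      using F(3) F2(3) by (simp add: single_CC C1.contraction_ops)
    fix c assume c: "c \<in> carrier C1.CC"
    then show "(F \<circ> (\<lambda>f. f)) (single C1.CC c 0) = F2 (single C1.CC c 0)"
      using F(2)[OF C1.CC_in_LC[OF c]] F1(2)[OF c] by (simp add: single_CC j1_def)
  qed
  then have F_B: "F b = ?j b" if "b \<in> carrier B" for b
    using that C2.CC_in_LC F2(2) by simp
  have "(F \<circ> \<iota>\<^sub>K) c = ?i c" if c: "c \<in> carrier K" for c
  proof (rule laurent2_hom_unique[OF kc T ring_hom_trans[OF \<iota>\<^sub>K F(1)] i _ _ _ c])
    fix r assume r: "r \<in> carrier k"
    have "(F \<circ> \<iota>\<^sub>K) (single2 k r 0 0) = F1 (single A (\<iota> r) 0)"
      using r F(2) by (simp add: \<iota>\<^sub>K_single2) (simp add: single2_def C1.single_simps)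
    also have "\<dots> = j1 (\<phi>\<^sub>1 (monom (UP k) r 0))"
      using F1(2)[OF C1.const_in_CC[OF r]] C1.poly(2)[OF r] by simp
    also have "\<dots> = ?i (single2 k r 0 0)"
      using r by (subst j1_\<phi>) (simp_all add: \<kappa>_monoms)
    finally show "(F \<circ> \<iota>\<^sub>K) (single2 k r 0 0) = ?i (single2 k r 0 0)" .
  next
    show "(F \<circ> \<iota>\<^sub>K) (single2 k \<one>\<^bsub>k\<^esub> 1 0) = ?i (single2 k \<one>\<^bsub>k\<^esub> 1 0)"
      using F(2)[of "single A \<one>\<^bsub>A\<^esub> 1"] F1(3)
      by (simp add: \<iota>\<^sub>K_single2 ring_hom_one[OF \<iota>] v1_def) (simp add: single2_def C1.single_simps)
    show "(F \<circ> \<iota>\<^sub>K) (single2 k \<one>\<^bsub>k\<^esub> 0 1) = ?i (single2 k \<one>\<^bsub>k\<^esub> 0 1)"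
      using F(3) by (simp add: \<iota>\<^sub>K_single2 ring_hom_one[OF \<iota>] v2_def single2_var2[OF A.cring_axioms])
  qed
  then show ?thesis using that[OF F(1) F_B] by simp
qed

text \<open>Inside the Laurent polynomials over the first contraction everything comes from
  \<open>B\<close> and the powers of u_2; inside \<open>laurent A\<close> everything comes from the
  first contraction and the powers of u_1. The subrings tested are the preimages of the generated
  subring under the inclusion and under the constant embedding.\<close>

lemma B_and_roots_generate: "carrier L \<subseteq> generate_ring L (carrier B \<union> \<iota>\<^sub>K ` carrier K)"
    (is "_ \<subseteq> generate_ring L ?H")
proof -
  have H: "?H \<subseteq> carrier L" using ring_hom_closed[OF incl_B] ring_hom_closed[OF \<iota>\<^sub>K] by auto
  note E = L.generate_ring_is_subring[OF H]
  have vars: "laurent2_vars A \<subseteq> generate_ring L ?H"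
    using \<iota>\<^sub>K_vars by (auto intro: generate_ring.incl)
  have "carrier C2.LC \<subseteq> {f \<in> carrier C2.LC. f \<in> generate_ring L ?H}"
  proof (rule C2.contraction_and_sqrt_generate)
    show "subring {f \<in> carrier C2.LC. f \<in> generate_ring L ?H} C2.LC"
      by (rule ring_hom_preimage_subring[OF C2.LC.ring_axioms L.ring_axioms incl_laurent E])
    show "carrier B \<subseteq> {f \<in> carrier C2.LC. f \<in> generate_ring L ?H}"
      using C2.CC_in_LC by (auto intro: generate_ring.incl)
    have "single C1.CC \<one>\<^bsub>C1.CC\<^esub> n = single2 A \<one>\<^bsub>A\<^esub> 0 n" for n
      by (simp add: single_CC C1.contraction_ops single2_var2[OF A.cring_axioms])
    then show "single C1.CC \<one>\<^bsub>C1.CC\<^esub> 1 \<in> {f \<in> carrier C2.LC. f \<in> generate_ring L ?H}"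
      "single C1.CC \<one>\<^bsub>C1.CC\<^esub> (- 1) \<in> {f \<in> carrier C2.LC. f \<in> generate_ring L ?H}"
      using vars C2.single_simps(1)[OF C1.CC.one_closed] by (auto simp: laurent2_vars_def)
  qed
  then have CC: "single C1.LC f 0 \<in> generate_ring L ?H" if "f \<in> carrier C1.CC" for f
    using C2.single_simps(1)[OF that, of 0] by (auto simp: single_CC)
  have "carrier C1.LC \<subseteq> {f \<in> carrier C1.LC. single C1.LC f 0 \<in> generate_ring L ?H}"
  proof (rule C1.contraction_and_sqrt_generate)
    show "subring {f \<in> carrier C1.LC. single C1.LC f 0 \<in> generate_ring L ?H} C1.LC"
      by (rule ring_hom_preimage_subring[OF C1.LC.ring_axioms L.ring_axioms
            laurent_const_hom[OF C1.LC.cring_axioms] E])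
    show "carrier C1.CC \<subseteq> {f \<in> carrier C1.LC. single C1.LC f 0 \<in> generate_ring L ?H}"
      using CC C1.CC_in_LC by auto
    show "single A \<one>\<^bsub>A\<^esub> 1 \<in> {f \<in> carrier C1.LC. single C1.LC f 0 \<in> generate_ring L ?H}"
      "single A \<one>\<^bsub>A\<^esub> (- 1) \<in> {f \<in> carrier C1.LC. single C1.LC f 0 \<in> generate_ring L ?H}"
      using vars by (auto simp: laurent2_vars_def single2_def C1.single_simps)
  qed
  then have "(\<lambda>c. single2 A c 0 0) ` carrier A \<union> laurent2_vars A \<subseteq> generate_ring L ?H"
    using vars C1.single_simps(1) by (auto simp: single2_def)
  then have "generate_ring L ((\<lambda>c. single2 A c 0 0) ` carrier A \<union> laurent2_vars A) \<subseteq> generate_ring L ?H"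
    by (rule L.generate_ring_subset[OF _ H])
  with laurent2_generated[OF A.cring_axioms] show ?thesis by (rule subset_trans)
qed

lemma \<Phi>_left: "b \<in> carrier B \<Longrightarrow> \<Phi> (T.pt 2 b \<one>\<^bsub>K\<^esub>) = b"
  using ring_hom_one[OF \<iota>\<^sub>K] ring_hom_closed[OF incl_B] by (simp add: \<Phi>_pt)

lemma \<Phi>_right: "c \<in> carrier K \<Longrightarrow> \<Phi> (T.pt 2 \<one>\<^bsub>B\<^esub> c) = \<iota>\<^sub>K c"
  using ring_hom_closed[OF \<iota>\<^sub>K, of c] \<Phi>_pt[OF C2.CC.one_closed, of c]
  unfolding ring_hom_one[OF incl_B] by simp

lemma \<Phi>_iso: "\<Phi> \<in> ring_iso (T.T 2) L"
proof -
  obtain F where F: "F \<in> ring_hom L (T.T 2)" "\<And>b. b \<in> carrier B \<Longrightarrow> F b = T.pt 2 b \<one>\<^bsub>K\<^esub>"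
    "\<And>c. c \<in> carrier K \<Longrightarrow> F (\<iota>\<^sub>K c) = T.pt 2 \<one>\<^bsub>B\<^esub> c"
    by (rule inverse_\<Phi>) (rule that)
  let ?H = "(\<lambda>b. T.pt 2 b \<one>\<^bsub>K\<^esub>) ` carrier B \<union> (\<lambda>c. T.pt 2 \<one>\<^bsub>B\<^esub> c) ` carrier K"
  show ?thesis
  proof (rule ring_iso_by_generators(1)[OF T.T.ring_axioms L.ring_axioms \<Phi>_hom F(1) _
        T.tensor_generated _ _ B_and_roots_generate])
    show "?H \<subseteq> carrier (T.T 2)" by (auto intro!: T.pt_closed)
    show "F (\<Phi> h) = h" if "h \<in> ?H" for h
      using that by (elim UnE imageE) (simp_all only: \<Phi>_left \<Phi>_right F(2,3))
    show "carrier B \<union> \<iota>\<^sub>K ` carrier K \<subseteq> \<Phi> ` carrier (T.T 2)"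
    proof (intro Un_least image_subsetI subsetI)
      fix b assume b: "b \<in> carrier B"
      have "\<Phi> (T.pt 2 b \<one>\<^bsub>K\<^esub>) \<in> \<Phi> ` carrier (T.T 2)"
        by (intro imageI T.pt_closed b K.one_closed)
      then show "b \<in> \<Phi> ` carrier (T.T 2)" by (simp only: \<Phi>_left[OF b])
    next
      fix c assume c: "c \<in> carrier K"
      have "\<Phi> (T.pt 2 \<one>\<^bsub>B\<^esub> c) \<in> \<Phi> ` carrier (T.T 2)"
        by (intro imageI T.pt_closed c C2.CC.one_closed)
      then show "\<iota>\<^sub>K c \<in> \<Phi> ` carrier (T.T 2)" by (simp only: \<Phi>_right[OF c])
    qed
  qed
qed

lemma \<Phi>\<^sub>A_left: "b \<in> carrier A \<Longrightarrow> \<Phi>\<^sub>A (TA.pt b \<one>\<^bsub>K\<^esub>) = single2 A b 0 0"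
  using ring_hom_one[OF \<iota>\<^sub>K] by (simp add: \<Phi>\<^sub>A_pt single2_closed[OF A.cring_axioms])

lemma \<Phi>\<^sub>A_right: "c \<in> carrier K \<Longrightarrow> \<Phi>\<^sub>A (TA.pt \<one>\<^bsub>A\<^esub> c) = \<iota>\<^sub>K c"
  using ring_hom_closed[OF \<iota>\<^sub>K] by (simp add: \<Phi>\<^sub>A_pt single2_one[OF A.cring_axioms])

text \<open>The theorem speaks of \<open>inv_into\<close>, which is hard to compute with. On
  \<open>L\<close> it is identified with a homomorphism whose values on \<open>A\<close> and on
  \<open>K\<close> are known.\<close>

lemma \<Phi>\<^sub>A_iso_inverse:
  obtains G where "\<Phi>\<^sub>A \<in> ring_iso TA.T L" "G \<in> ring_hom L TA.T"
    "\<And>y. y \<in> carrier L \<Longrightarrow> inv_into (carrier TA.T) \<Phi>\<^sub>A y = G y"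
    "\<And>b. b \<in> carrier A \<Longrightarrow> G (single2 A b 0 0) = TA.pt b \<one>\<^bsub>K\<^esub>"
    "\<And>c. c \<in> carrier K \<Longrightarrow> G (\<iota>\<^sub>K c) = TA.pt \<one>\<^bsub>A\<^esub> c"
proof -
  let ?i = "\<lambda>c. TA.pt \<one>\<^bsub>A\<^esub> c"
  note kc = k.cring_axioms
  have U: "?i (single2 k \<one>\<^bsub>k\<^esub> m n) \<in> Units TA.T" for m n
    by (rule ring_hom_Units[OF K.cring_axioms TA.tensor_cring TA.pt_right_hom single2_Units[OF kc]])
  obtain G where G: "G \<in> ring_hom L TA.T" "\<And>b. b \<in> carrier A \<Longrightarrow> G (single2 A b 0 0) = TA.pt b \<one>\<^bsub>K\<^esub>"
    "G (single2 A \<one>\<^bsub>A\<^esub> 1 0) = ?i (single2 k \<one>\<^bsub>k\<^esub> 1 0)" "G (single2 A \<one>\<^bsub>A\<^esub> 0 1) = ?i (single2 k \<one>\<^bsub>k\<^esub> 0 1)"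
    using laurent2_hom_exists[OF A.cring_axioms TA.tensor_cring TA.pt_left_hom U U] by metis
  have "(G \<circ> \<iota>\<^sub>K) c = ?i c" if c: "c \<in> carrier K" for c
    by (rule laurent2_hom_unique[OF kc TA.tensor_cring ring_hom_trans[OF \<iota>\<^sub>K G(1)] TA.pt_right_hom _ _ _ c])
      (simp_all add: \<iota>\<^sub>K_single2 ring_hom_one[OF \<iota>] G ring_hom_closed[OF \<iota>] TA.pt_balanced)
  then have G_K: "G (\<iota>\<^sub>K c) = ?i c" if "c \<in> carrier K" for c using that by simp
  let ?H = "(\<lambda>b. TA.pt b \<one>\<^bsub>K\<^esub>) ` carrier A \<union> (\<lambda>c. TA.pt \<one>\<^bsub>A\<^esub> c) ` carrier K"
  have H: "?H \<subseteq> carrier TA.T" by (auto intro!: TA.pt_closed)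
  have GH: "G (\<Phi>\<^sub>A h) = h" if "h \<in> ?H" for h
    using that by (elim UnE imageE) (simp_all only: \<Phi>\<^sub>A_left \<Phi>\<^sub>A_right G(2) G_K)
  have im: "(\<lambda>c. single2 A c 0 0) ` carrier A \<union> laurent2_vars A \<subseteq> \<Phi>\<^sub>A ` carrier TA.T"
  proof (intro Un_least image_subsetI)
    fix b assume b: "b \<in> carrier A"
    have "\<Phi>\<^sub>A (TA.pt b \<one>\<^bsub>K\<^esub>) \<in> \<Phi>\<^sub>A ` carrier TA.T"
      using b by (intro imageI TA.pt_closed) auto
    then show "single2 A b 0 0 \<in> \<Phi>\<^sub>A ` carrier TA.T" by (simp only: \<Phi>\<^sub>A_left[OF b])
  next
    have "\<Phi>\<^sub>A (TA.pt \<one>\<^bsub>A\<^esub> c) \<in> \<Phi>\<^sub>A ` carrier TA.T" if "c \<in> carrier K" for c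
      using that by (intro imageI TA.pt_closed) auto
    then have "\<iota>\<^sub>K ` carrier K \<subseteq> \<Phi>\<^sub>A ` carrier TA.T"
      by (intro image_subsetI) (simp only: \<Phi>\<^sub>A_right)
    with \<iota>\<^sub>K_vars show "laurent2_vars A \<subseteq> \<Phi>\<^sub>A ` carrier TA.T" by (rule subset_trans)
  qed
  have iso: "\<Phi>\<^sub>A \<in> ring_iso TA.T L" "\<And>t. t \<in> carrier TA.T \<Longrightarrow> G (\<Phi>\<^sub>A t) = t"
    using ring_iso_by_generators[OF TA.T.ring_axioms L.ring_axioms \<Phi>\<^sub>A_hom G(1) H
      TA.tensor_generated _ im laurent2_generated[OF A.cring_axioms]] GH by blast+
  have inv: "inv_into (carrier TA.T) \<Phi>\<^sub>A y = G y" if y: "y \<in> carrier L" for y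
  proof -
    obtain t where t: "t \<in> carrier TA.T" "y = \<Phi>\<^sub>A t"
      using iso(1) y by (auto simp: ring_iso_def bij_betw_def)
    have "inj_on \<Phi>\<^sub>A (carrier TA.T)" using iso(1) by (simp add: ring_iso_def bij_betw_def)
    then show ?thesis using t iso(2)[OF t(1)] by simp
  qed
  show ?thesis using that[OF iso(1) G(1) inv G(2) G_K] .
qed

end

section \<open>Scheme-theoretic closure\<close>

text \<open>An element of \<open>J\<close> has the coset of zero, and a map that factors through the
  quotient cannot tell the two apart.\<close>

lemma factors_through_imp_kernel:
  assumes P: "ring P" and D: "ring D" and f: "f \<in> ring_hom P D" and J: "factors_through P D f J"
  shows "J \<subseteq> a_kernel P D f"
proof
  interpret P: ring P by fact
  obtain g where id: "ideal J P" and g: "g \<in> ring_hom (P Quot J) D"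
    "\<And>p. p \<in> carrier P \<Longrightarrow> g (J +>\<^bsub>P\<^esub> p) = f p"
    using J by (auto simp: factors_through_def)
  interpret J: ideal J P by fact
  fix p assume p: "p \<in> J"
  then have pc: "p \<in> carrier P" by (rule J.Icarr)
  have "J +>\<^bsub>P\<^esub> p = J +>\<^bsub>P\<^esub> \<zero>\<^bsub>P\<^esub>"
    using P.quotient_eq_iff_same_a_r_cos[OF id pc P.zero_closed] p pc by (simp add: a_minus_def)
  then have "f p = f \<zero>\<^bsub>P\<^esub>" using g(2)[OF pc] g(2)[OF P.zero_closed] by simp
  then show "p \<in> a_kernel P D f"
    using pc ring_hom_zero[OF f P D] by (simp add: a_kernel_def')
qed

text \<open>For affine schemes the closure of the image is cut out by the kernel: the map induced on
  the quotient gives the factorisation, and any ideal that admits one is contained in the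
  kernel.\<close>

lemma scheme_closure_kernel:
  assumes P: "ring P" and D: "ring D" and f: "f \<in> ring_hom P D"
  shows "scheme_closure P D f (a_kernel P D f)"
proof -
  interpret f: ring_hom_ring P D f using P D f by (rule ring_hom_ringI2)
  have "factors_through P D f (a_kernel P D f)"
    unfolding factors_through_def
  proof (intro conjI bexI ballI)
    show "ideal (a_kernel P D f) P" by (rule f.kernel_is_ideal)
    show "(\<lambda>X. the_elem (f ` X)) \<in> ring_hom (P Quot a_kernel P D f) D"
      by (rule f.the_elem_hom)
    show "the_elem (f ` (a_kernel P D f +>\<^bsub>P\<^esub> p)) = f p" if "p \<in> carrier P" for p
      by (rule f.the_elem_simp[OF that])
  qed
  then show ?thesis
    using factors_through_imp_kernel[OF P D f] by (simp add: scheme_closure_def)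
qed

section \<open>The embedding of the twofold contraction\<close>

text \<open>To be used with h = 1/2 and t a monomial in the roots: the halvings of the two
  contractions combine into 1/4.\<close>

lemma double_half_scaled:
  assumes "cring S" "h \<in> carrier S" "t \<in> carrier S" "y \<in> carrier S" "z \<in> carrier S"
  shows "h \<otimes>\<^bsub>S\<^esub> (h \<otimes>\<^bsub>S\<^esub> y \<oplus>\<^bsub>S\<^esub> h \<otimes>\<^bsub>S\<^esub> z) \<otimes>\<^bsub>S\<^esub> t = h \<otimes>\<^bsub>S\<^esub> h \<otimes>\<^bsub>S\<^esub> (t \<otimes>\<^bsub>S\<^esub> (y \<oplus>\<^bsub>S\<^esub> z))"
    and "h \<otimes>\<^bsub>S\<^esub> (h \<otimes>\<^bsub>S\<^esub> y \<ominus>\<^bsub>S\<^esub> h \<otimes>\<^bsub>S\<^esub> z) \<otimes>\<^bsub>S\<^esub> t = h \<otimes>\<^bsub>S\<^esub> h \<otimes>\<^bsub>S\<^esub> (t \<otimes>\<^bsub>S\<^esub> (y \<ominus>\<^bsub>S\<^esub> z))"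
proof -
  interpret cring S by fact
  note cl = assms(2-)
  show "h \<otimes>\<^bsub>S\<^esub> (h \<otimes>\<^bsub>S\<^esub> y \<oplus>\<^bsub>S\<^esub> h \<otimes>\<^bsub>S\<^esub> z) \<otimes>\<^bsub>S\<^esub> t = h \<otimes>\<^bsub>S\<^esub> h \<otimes>\<^bsub>S\<^esub> (t \<otimes>\<^bsub>S\<^esub> (y \<oplus>\<^bsub>S\<^esub> z))"
    using cl by algebra
  show "h \<otimes>\<^bsub>S\<^esub> (h \<otimes>\<^bsub>S\<^esub> y \<ominus>\<^bsub>S\<^esub> h \<otimes>\<^bsub>S\<^esub> z) \<otimes>\<^bsub>S\<^esub> t = h \<otimes>\<^bsub>S\<^esub> h \<otimes>\<^bsub>S\<^esub> (t \<otimes>\<^bsub>S\<^esub> (y \<ominus>\<^bsub>S\<^esub> z))"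
    using cl by algebra
qed

locale twofold_embedding = twofold_contraction k A \<iota> \<theta> \<eta>
  for k :: "('k, 'kx) ring_scheme" and A :: "('a, 'ax) ring_scheme" and \<iota> :: "'k \<Rightarrow> 'a"
    and \<theta> :: "'a \<Rightarrow> 'a" and \<eta> :: "'a \<Rightarrow> 'a" +
  fixes \<Lambda> :: "'l set" and a :: "'l \<Rightarrow> 'a"
  assumes gen: "generates_algebra k A \<iota> (a ` \<Lambda>)"
begin

abbreviation V where "V \<equiv> block_vars (block_vars \<Lambda>)"
abbreviation P where "P \<equiv> mpoly Rt V"
abbreviation e where "e \<equiv> contraction2_embedding k A \<iota> \<theta> \<eta> a"
abbreviation coords where
  "coords \<equiv> contraction_coord C1.CC (\<lambda>f. \<eta> \<circ> f) (contraction_coord A \<theta> a)"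

lemma a_closed [simp]: "l \<in> \<Lambda> \<Longrightarrow> a l \<in> carrier A"
  using gen by (auto simp: generates_algebra_def)

lemma coord1_closed: "v \<in> block_vars \<Lambda> \<Longrightarrow> contraction_coord A \<theta> a v \<in> carrier C1.CC"
  by (rule C1.coord_closed) auto

lemma e_hom: "e \<in> ring_hom P B"
  and e_const: "r \<in> carrier Rt \<Longrightarrow> e (mpoly_const Rt r) = \<beta> r"
  and e_var: "v \<in> V \<Longrightarrow> e (mpoly_var Rt v) = coords v"
  unfolding contraction2_embedding_def
  by (rule C2.embedding_hom[of "block_vars \<Lambda>"]; simp add: coord1_closed)+

lemma e_closed_immersion: "closed_immersion P B e"
  unfolding contraction2_embedding_def
  by (rule C2.embedding_closed_immersion[OF C1.coords_generate[OF gen]])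

sublocale P: cring P by (rule mpoly_cring[OF Rt.cring_axioms])

text \<open>\<open>B\<close> has no \<open>t\<^sub>1\<close>- or \<open>t\<^sub>2\<close>-torsion, so that inverting \<open>t\<^sub>1, t\<^sub>2\<close> does not enlarge the
  kernel of \<open>e\<close>.\<close>

lemma e_closure:
  "scheme_closure P (T.T 1) (\<lambda>f. T.pt 1 (e f) \<one>\<^bsub>K\<^esub>) (a_kernel P B e)"
proof -
  let ?f = "\<lambda>f. T.pt 1 (e f) \<one>\<^bsub>K\<^esub>"
  obtain \<pi> where \<pi>: "\<pi> \<in> ring_hom K K" "\<And>r. r \<in> carrier Rt \<Longrightarrow> \<pi> (\<kappa> 1 r) = \<kappa> 2 r"
    by (rule square_root_substitution) (rule that)
  have f: "?f \<in> ring_hom P (T.T 1)"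
    using ring_hom_trans[OF e_hom T.pt_left_hom[of 1]] by (simp add: comp_def)
  \<comment> \<open>\<open>K\<close> is mapped to \<open>L\<close> through \<pi>, so that t_i goes
    to u_i^2 as in \<open>B\<close>. The composite from \<open>B\<close> through the localisation to
    \<open>L\<close> is then the inclusion, which shows that inverting t_1 and t_2 is injective on
    \<open>B\<close>.\<close>
  let ?\<Phi> = "tensor_lift L (\<lambda>b. b) (\<iota>\<^sub>K \<circ> \<pi>)"
  have bal: "\<beta> r = (\<iota>\<^sub>K \<circ> \<pi>) (\<kappa> 1 r)" if "r \<in> carrier Rt" for r
    using that by (simp add: \<pi>(2) \<beta>_eq)
  have \<pi>': "\<iota>\<^sub>K \<circ> \<pi> \<in> ring_hom K L" by (rule ring_hom_trans[OF \<pi>(1) \<iota>\<^sub>K])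
  have lift: "?\<Phi> \<in> ring_hom (T.T 1) L" "b \<in> carrier B \<Longrightarrow> ?\<Phi> (T.pt 1 b \<one>\<^bsub>K\<^esub>) = b" for b
  proof -
    show "?\<Phi> \<in> ring_hom (T.T 1) L"
      by (rule T.tensor_lift_hom[OF L.cring_axioms incl_B \<pi>' bal])
    assume b: "b \<in> carrier B"
    have "?\<Phi> (T.pt 1 b \<one>\<^bsub>K\<^esub>) = b \<otimes>\<^bsub>L\<^esub> (\<iota>\<^sub>K \<circ> \<pi>) \<one>\<^bsub>K\<^esub>"
      by (rule T.tensor_lift_pt[OF L.cring_axioms incl_B \<pi>' bal b K.one_closed])
    then show "?\<Phi> (T.pt 1 b \<one>\<^bsub>K\<^esub>) = b"
      unfolding ring_hom_one[OF \<pi>'] using ring_hom_closed[OF incl_B b] by simp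
  qed
  have "e p = \<zero>\<^bsub>B\<^esub> \<longleftrightarrow> ?f p = \<zero>\<^bsub>T.T 1\<^esub>" if p: "p \<in> carrier P" for p
  proof
    assume "e p = \<zero>\<^bsub>B\<^esub>"
    then show "?f p = \<zero>\<^bsub>T.T 1\<^esub>"
      using ring_hom_zero[OF T.pt_left_hom[of 1] C2.CC.ring_axioms T.T.ring_axioms] by simp
  next
    assume "?f p = \<zero>\<^bsub>T.T 1\<^esub>"
    then have "e p = ?\<Phi> \<zero>\<^bsub>T.T 1\<^esub>" using lift(2)[OF ring_hom_closed[OF e_hom p]] by simp
    also have "\<dots> = \<zero>\<^bsub>L\<^esub>" by (rule ring_hom_zero[OF lift(1) T.T.ring_axioms L.ring_axioms])
    also have "\<dots> = \<zero>\<^bsub>B\<^esub>" using ring_hom_zero[OF incl_B C2.CC.ring_axioms L.ring_axioms] by simp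
    finally show "e p = \<zero>\<^bsub>B\<^esub>" .
  qed
  then have "a_kernel P B e = a_kernel P (T.T 1) ?f"
    unfolding a_kernel_def' by blast
  then show ?thesis
    using scheme_closure_kernel[OF P.ring_axioms T.T.ring_axioms f] by simp
qed

section \<open>Base change of the closed immersion\<close>

sublocale TP: tensor_setup Rt P "mpoly_const Rt" K "\<kappa> 2"
  using ring_hom_closed[OF mpoly_const_hom[OF Rt.cring_axioms]] ring_hom_closed[OF \<kappa>_hom]
  by unfold_locales auto

abbreviation e\<^sub>2 where
  "e\<^sub>2 \<equiv> tensor_lift (T.T 2) (\<lambda>f. T.pt 2 (e f) \<one>\<^bsub>K\<^esub>) (\<lambda>c. T.pt 2 \<one>\<^bsub>B\<^esub> c)"

lemma e\<^sub>2_hom: "e\<^sub>2 \<in> ring_hom TP.T (T.T 2)"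
  and e\<^sub>2_pt: "p \<in> carrier P \<Longrightarrow> c \<in> carrier K \<Longrightarrow>
    e\<^sub>2 (TP.pt p c) = T.pt 2 (e p) \<one>\<^bsub>K\<^esub> \<otimes>\<^bsub>T.T 2\<^esub> T.pt 2 \<one>\<^bsub>B\<^esub> c"
proof -
  have f: "(\<lambda>f. T.pt 2 (e f) \<one>\<^bsub>K\<^esub>) \<in> ring_hom P (T.T 2)"
    using ring_hom_trans[OF e_hom T.pt_left_hom[of 2]] by (simp add: comp_def)
  have bal: "T.pt 2 (e (mpoly_const Rt r)) \<one>\<^bsub>K\<^esub> = T.pt 2 \<one>\<^bsub>B\<^esub> (\<kappa> 2 r)" if "r \<in> carrier Rt" for r
    unfolding e_const[OF that] by (rule T.pt_balanced[OF that])
  show "e\<^sub>2 \<in> ring_hom TP.T (T.T 2)"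
    by (rule TP.tensor_lift_hom[OF T.tensor_cring f T.pt_right_hom bal])
  show "p \<in> carrier P \<Longrightarrow> c \<in> carrier K \<Longrightarrow>
    e\<^sub>2 (TP.pt p c) = T.pt 2 (e p) \<one>\<^bsub>K\<^esub> \<otimes>\<^bsub>T.T 2\<^esub> T.pt 2 \<one>\<^bsub>B\<^esub> c"
    by (rule TP.tensor_lift_pt[OF T.tensor_cring f T.pt_right_hom bal])
qed

lemma e\<^sub>2_left: "p \<in> carrier P \<Longrightarrow> e\<^sub>2 (TP.pt p \<one>\<^bsub>K\<^esub>) = T.pt 2 (e p) \<one>\<^bsub>K\<^esub>"
  using T.pt_closed[OF ring_hom_closed[OF e_hom] K.one_closed, of p 2]
  by (simp only: e\<^sub>2_pt K.one_closed T.pt_one T.T.r_one)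

lemma e\<^sub>2_right: "c \<in> carrier K \<Longrightarrow> e\<^sub>2 (TP.pt \<one>\<^bsub>P\<^esub> c) = T.pt 2 \<one>\<^bsub>B\<^esub> c"
  using T.pt_closed[OF C2.CC.one_closed, of c 2]
  by (simp only: e\<^sub>2_pt P.one_closed ring_hom_one[OF e_hom] T.pt_one T.T.l_one)

lemma e\<^sub>2_closed_immersion: "closed_immersion TP.T (T.T 2) e\<^sub>2"
proof -
  have surj: "e ` carrier P = carrier B" using e_closed_immersion by (simp add: closed_immersion_def)
  have "e\<^sub>2 ` carrier TP.T = carrier (T.T 2)"
  proof (rule ring_hom_surj_on_generators[OF TP.T.ring_axioms T.T.ring_axioms e\<^sub>2_hom _ T.tensor_generated])
    show "(\<lambda>b. T.pt 2 b \<one>\<^bsub>K\<^esub>) ` carrier B \<union> (\<lambda>c. T.pt 2 \<one>\<^bsub>B\<^esub> c) ` carrier K \<subseteq> e\<^sub>2 ` carrier TP.T"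
    proof (intro Un_least image_subsetI)
      fix b assume "b \<in> carrier B"
      then obtain p where p: "p \<in> carrier P" "b = e p" using surj by blast
      have "e\<^sub>2 (TP.pt p \<one>\<^bsub>K\<^esub>) \<in> e\<^sub>2 ` carrier TP.T"
        by (intro imageI TP.pt_closed p(1) K.one_closed)
      then show "T.pt 2 b \<one>\<^bsub>K\<^esub> \<in> e\<^sub>2 ` carrier TP.T" by (simp only: e\<^sub>2_left[OF p(1)] p(2))
    next
      fix c assume c: "c \<in> carrier K"
      have "e\<^sub>2 (TP.pt \<one>\<^bsub>P\<^esub> c) \<in> e\<^sub>2 ` carrier TP.T"
        by (intro imageI TP.pt_closed c P.one_closed)
      then show "T.pt 2 \<one>\<^bsub>B\<^esub> c \<in> e\<^sub>2 ` carrier TP.T" by (simp only: e\<^sub>2_right[OF c])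
    qed
  qed
  then show ?thesis using e\<^sub>2_hom by (simp add: closed_immersion_def)
qed

section \<open>Affine space after base change\<close>

abbreviation Q where "Q \<equiv> mpoly K V"
abbreviation \<Psi> where "\<Psi> \<equiv> tensor_lift Q (\<lambda>f m. \<kappa> 2 (f m)) (mpoly_const K)"

sublocale Q: cring Q by (rule mpoly_cring[OF K.cring_axioms])

lemma coeff_map: "(\<lambda>f m. \<kappa> 2 (f m)) \<in> ring_hom P Q"
  by (rule mpoly_map_hom[OF Rt.cring_axioms K.cring_axioms \<kappa>_hom])

lemma coeff_map_single: "(\<lambda>n. \<kappa> 2 (single Rt r m n)) = single K (\<kappa> 2 r) m"
  by (rule map_single[OF Rt.cring_axioms K.cring_axioms \<kappa>_hom])

lemma coeff_map_var: "(\<lambda>n. \<kappa> 2 (mpoly_var Rt v n)) = mpoly_var K v"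
  unfolding mpoly_var_def coeff_map_single ring_hom_one[OF \<kappa>_hom] ..

lemma \<Psi>_hom: "\<Psi> \<in> ring_hom TP.T Q"
  by (rule TP.tensor_lift_hom[OF Q.cring_axioms coeff_map mpoly_const_hom[OF K.cring_axioms] coeff_map_single])

lemma \<Psi>_pt: "p \<in> carrier P \<Longrightarrow> c \<in> carrier K \<Longrightarrow>
    \<Psi> (TP.pt p c) = (\<lambda>m. \<kappa> 2 (p m)) \<otimes>\<^bsub>Q\<^esub> mpoly_const K c"
  by (rule TP.tensor_lift_pt[OF Q.cring_axioms coeff_map mpoly_const_hom[OF K.cring_axioms] coeff_map_single])

lemma \<Psi>_left: "p \<in> carrier P \<Longrightarrow> \<Psi> (TP.pt p \<one>\<^bsub>K\<^esub>) = (\<lambda>m. \<kappa> 2 (p m))"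
  using ring_hom_closed[OF coeff_map, of p]
  by (simp only: \<Psi>_pt K.one_closed ring_hom_one[OF mpoly_const_hom[OF K.cring_axioms, of V]] Q.r_one)

lemma \<Psi>_right: "c \<in> carrier K \<Longrightarrow> \<Psi> (TP.pt \<one>\<^bsub>P\<^esub> c) = mpoly_const K c"
  using ring_hom_closed[OF mpoly_const_hom[OF K.cring_axioms], of c V]
  by (simp only: \<Psi>_pt P.one_closed ring_hom_one[OF coeff_map] Q.l_one)

text \<open>The map back comes from the universal property of the polynomial ring over
  \<open>K\<close>. That it undoes \<Psi> on polynomials over k[t_1, t_2] has to be checked only on
  constants, where it is balancedness, and on variables.\<close>

lemma \<Psi>_iso: "\<Psi> \<in> ring_iso TP.T Q"
proof -
  have vars: "TP.pt (mpoly_var Rt v) \<one>\<^bsub>K\<^esub> \<in> carrier TP.T" if "v \<in> V" for v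
    by (intro TP.pt_closed mpoly_var_closed[OF Rt.cring_axioms that] K.one_closed)
  define F where "F = mpoly_eval K TP.T (\<lambda>c. TP.pt \<one>\<^bsub>P\<^esub> c) (\<lambda>v. TP.pt (mpoly_var Rt v) \<one>\<^bsub>K\<^esub>)"
  have F: "F \<in> ring_hom Q TP.T"
    "\<And>c. c \<in> carrier K \<Longrightarrow> F (mpoly_const K c) = TP.pt \<one>\<^bsub>P\<^esub> c"
    "\<And>v. v \<in> V \<Longrightarrow> F (mpoly_var K v) = TP.pt (mpoly_var Rt v) \<one>\<^bsub>K\<^esub>"
    unfolding F_def
    using mpoly_eval_hom[of K TP.T _ V "\<lambda>v. TP.pt (mpoly_var Rt v) \<one>\<^bsub>K\<^esub>",
        OF K.cring_axioms TP.tensor_cring TP.pt_right_hom vars] by blast+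
  have F_left: "F (\<lambda>m. \<kappa> 2 (p m)) = TP.pt p \<one>\<^bsub>K\<^esub>" if p: "p \<in> carrier P" for p
  proof -
    have "(F \<circ> (\<lambda>f m. \<kappa> 2 (f m))) p = (\<lambda>p. TP.pt p \<one>\<^bsub>K\<^esub>) p"
    proof (rule mpoly_hom_eqI[OF Rt.cring_axioms TP.tensor_cring ring_hom_trans[OF coeff_map F(1)]
          TP.pt_left_hom _ _ p])
      show "(F \<circ> (\<lambda>f m. \<kappa> 2 (f m))) (mpoly_const Rt r) = TP.pt (mpoly_const Rt r) \<one>\<^bsub>K\<^esub>"
        if r: "r \<in> carrier Rt" for r
        using F(2)[OF ring_hom_closed[OF \<kappa>_hom r]]
        by (simp only: comp_def coeff_map_single TP.pt_balanced[OF r])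
      show "(F \<circ> (\<lambda>f m. \<kappa> 2 (f m))) (mpoly_var Rt v) = TP.pt (mpoly_var Rt v) \<one>\<^bsub>K\<^esub>"
        if v: "v \<in> V" for v
        by (simp only: comp_def coeff_map_var F(3)[OF v])
    qed
    then show ?thesis by simp
  qed
  let ?H = "(\<lambda>p. TP.pt p \<one>\<^bsub>K\<^esub>) ` carrier P \<union> (\<lambda>c. TP.pt \<one>\<^bsub>P\<^esub> c) ` carrier K"
  have H: "?H \<subseteq> carrier TP.T"
    by (intro Un_least image_subsetI TP.pt_closed P.one_closed K.one_closed)
  have FH: "F (\<Psi> h) = h" if "h \<in> ?H" for h
    using that by (elim UnE imageE) (simp_all only: \<Psi>_left \<Psi>_right F_left F(2))
  have "mpoly_const K ` carrier K \<union> mpoly_var K ` V \<subseteq> \<Psi> ` carrier TP.T"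
  proof (intro Un_least image_subsetI)
    fix c assume c: "c \<in> carrier K"
    have "\<Psi> (TP.pt \<one>\<^bsub>P\<^esub> c) \<in> \<Psi> ` carrier TP.T"
      by (intro imageI TP.pt_closed c P.one_closed)
    then show "mpoly_const K c \<in> \<Psi> ` carrier TP.T" by (simp only: \<Psi>_right[OF c])
  next
    fix v assume v: "v \<in> V"
    have "\<Psi> (TP.pt (mpoly_var Rt v) \<one>\<^bsub>K\<^esub>) \<in> \<Psi> ` carrier TP.T"
      by (intro imageI vars v)
    then show "mpoly_var K v \<in> \<Psi> ` carrier TP.T"
      by (simp only: \<Psi>_left[OF mpoly_var_closed[OF Rt.cring_axioms v]] coeff_map_var)
  qed
  from ring_iso_by_generators(1)[OF TP.T.ring_axioms Q.ring_axioms \<Psi>_hom F(1) H TP.tensor_generated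
      _ this mpoly_generated[OF K.cring_axioms]] FH
  show ?thesis by blast
qed

section \<open>The coordinates in closed form and their values at a point\<close>

lemma half_CC_single:
  assumes c: "c \<in> carrier A" and m: "single A c m \<in> carrier C1.CC"
  shows "half C1.CC (single A c m) = single A (half A c) m"
proof -
  \<comment> \<open>\<open>half\<close> refers to the inverse of 2 within the contraction; the
    inclusion turns it into the one of the Laurent ring, where it can be computed on the
    coefficient.\<close>
  have "half C1.CC (single A c m) = half C1.LC (single A c m)"
    by (rule half_hom[OF C1.contraction_cring C1.LC.cring_axioms C1.incl_hom C2.two_C m, symmetric])
  also have "\<dots> = single A (half A c) m"
    using c
    by (intro half_unique[OF C1.LC.cring_axioms two_Unit_hom[OF C1.contraction_cring
          C1.LC.cring_axioms C1.incl_hom C2.two_C]]) (simp_all add: C1.single_simps C1.half_half)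
  finally show ?thesis .
qed

lemma part_CC_single:
  assumes c: "c \<in> carrier A" and m: "single A c m \<in> carrier C1.CC"
  shows "half C1.CC (single A c m \<oplus>\<^bsub>C1.CC\<^esub> (\<eta> \<circ> single A c m)) = single A (half A (c \<oplus>\<^bsub>A\<^esub> \<eta> c)) m"
    and "half C1.CC (single A c m \<ominus>\<^bsub>C1.CC\<^esub> (\<eta> \<circ> single A c m)) = single A (half A (c \<ominus>\<^bsub>A\<^esub> \<eta> c)) m"
proof -
  have m': "single A (\<eta> c) m \<in> carrier C1.CC" using C2.\<sigma>_closed[OF m] by (simp add: \<eta>_single)
  have 1: "single A c m \<oplus>\<^bsub>C1.CC\<^esub> single A (\<eta> c) m = single A (c \<oplus>\<^bsub>A\<^esub> \<eta> c) m"
    using c by (simp add: C1.contraction_ops C1.single_simps)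
  have 2: "single A c m \<ominus>\<^bsub>C1.CC\<^esub> single A (\<eta> c) m = single A (c \<ominus>\<^bsub>A\<^esub> \<eta> c) m"
    using c m m' by (simp add: C1.contraction_minus) (simp add: a_minus_def C1.single_simps)
  show "half C1.CC (single A c m \<oplus>\<^bsub>C1.CC\<^esub> (\<eta> \<circ> single A c m)) = single A (half A (c \<oplus>\<^bsub>A\<^esub> \<eta> c)) m"
    unfolding \<eta>_single 1 using c C1.CC.a_closed[OF m m']
    by (intro half_CC_single) (simp_all add: 1)
  show "half C1.CC (single A c m \<ominus>\<^bsub>C1.CC\<^esub> (\<eta> \<circ> single A c m)) = single A (half A (c \<ominus>\<^bsub>A\<^esub> \<eta> c)) m"
    unfolding \<eta>_single 2 using c C1.CC.minus_closed[OF m m']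
    by (intro half_CC_single) (simp_all add: 2)
qed

text \<open>The inner exponent \<open>m\<close> records the block of the first contraction, the
  outer exponent \<open>n\<close> that of the second; block (1, 2) has exponent 1 because s /
  \<surd>s = \<surd>s. The coefficient results from two successive projections onto parts, for
  \<theta> and then for \<eta>.\<close>

lemma coords_eq:
  assumes l: "l \<in> \<Lambda>" and pq: "p \<in> {1, 2}" "q \<in> {1, 2}" "p' \<in> {1, 2}" "q' \<in> {1, 2}"
  shows "coords (p, q, p', q', l) =
    (let c = (if p' = q' then half A (a l \<oplus>\<^bsub>A\<^esub> \<theta> (a l)) else half A (a l \<ominus>\<^bsub>A\<^esub> \<theta> (a l)));
         m = (if p' = q' then 0 else if (p', q') = (1, 2) then 1 else - 1);
         n = (if p = q then 0 else if (p, q) = (1, 2) then 1 else - 1)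
     in single2 A (half A (if p = q then c \<oplus>\<^bsub>A\<^esub> \<eta> c else c \<ominus>\<^bsub>A\<^esub> \<eta> c)) m n)"
proof -
  define c where "c = (if p' = q' then half A (a l \<oplus>\<^bsub>A\<^esub> \<theta> (a l)) else half A (a l \<ominus>\<^bsub>A\<^esub> \<theta> (a l)))"
  define m :: int where "m = (if p' = q' then 0 else if (p', q') = (1, 2) then 1 else - 1)"
  have c: "c \<in> carrier A" using l by (simp add: c_def)
  have eq: "contraction_coord A \<theta> a (p', q', l) = single A c m"
    by (simp add: contraction_coord_def c_def m_def)
  have m: "single A c m \<in> carrier C1.CC"
    unfolding eq[symmetric] using l pq by (intro coord1_closed) (auto simp: block_vars_def)
  show ?thesis
    unfolding c_def[symmetric] m_def[symmetric] Let_def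
    by (simp add: contraction_coord_def[of C1.CC] eq part_CC_single[OF c m] single_CC single2_def)
qed

end

context twofold_embedding
begin

text \<open>\<open>W\<close> stands for any map out of \<open>L\<close> that restricts to
  \<open>x\<close> on \<open>A\<close> and to \<chi> on \<open>K\<close>. Two projections onto parts
  turn a coordinate into 1/4 times a monomial in u_1, u_2 times a signed sum of four terms, and
  comparison with the matrix is a check of sixteen index combinations.\<close>

lemma matrix_point_identity:
  fixes S :: "('s, 'sx) ring_scheme"
  assumes S: "cring S" and \<chi>: "\<chi> \<in> ring_hom K S" and x: "x \<in> ring_hom A S"
    and W: "W \<in> ring_hom L S"
    and W_A: "\<And>b. b \<in> carrier A \<Longrightarrow> W (single2 A b 0 0) = x b"
    and W_K: "\<And>c. c \<in> carrier K \<Longrightarrow> W (\<iota>\<^sub>K c) = \<chi> c"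
    and v: "v \<in> V"
  shows "W (coords v) = matrix_point k S \<chi> \<theta> \<eta> a x v"
proof -
  interpret S: cring S by fact
  note kc = k.cring_axioms and Ac = A.cring_axioms
  obtain p q p' q' l where v_eq: "v = (p, q, p', q', l)" by (cases v)
  have l: "l \<in> \<Lambda>" and pq: "p \<in> {1, 2}" "q \<in> {1, 2}" "p' \<in> {1, 2}" "q' \<in> {1, 2}"
    using v by (auto simp: v_eq block_vars_def)
  define u1 where "u1 = \<chi> (single2 k \<one>\<^bsub>k\<^esub> 1 0)"
  define u2 where "u2 = \<chi> (single2 k \<one>\<^bsub>k\<^esub> 0 1)"
  have \<chi>_closed: "\<chi> (single2 k \<one>\<^bsub>k\<^esub> m n) \<in> carrier S" for m n
    by (rule ring_hom_closed[OF \<chi> single2_closed[OF kc k.one_closed]])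
  have \<chi>_mult: "\<chi> (single2 k \<one>\<^bsub>k\<^esub> m n) \<otimes>\<^bsub>S\<^esub> \<chi> (single2 k \<one>\<^bsub>k\<^esub> m' n') = \<chi> (single2 k \<one>\<^bsub>k\<^esub> (m + m') (n + n'))"
    for m n m' n'
    using ring_hom_mult[OF \<chi> single2_closed[OF kc k.one_closed] single2_closed[OF kc k.one_closed]]
    by (simp add: single2_mult[OF kc])
  have \<chi>_one: "\<chi> (single2 k \<one>\<^bsub>k\<^esub> 0 0) = \<one>\<^bsub>S\<^esub>"
    by (simp only: single2_one[OF kc] ring_hom_one[OF \<chi>])
  have v1: "inv\<^bsub>S\<^esub> u1 = \<chi> (single2 k \<one>\<^bsub>k\<^esub> (- 1) 0)" and v2: "inv\<^bsub>S\<^esub> u2 = \<chi> (single2 k \<one>\<^bsub>k\<^esub> 0 (- 1))"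
    unfolding u1_def u2_def by (rule S.comm_inv_char; simp add: \<chi>_closed \<chi>_mult \<chi>_one)+
  have u: "\<chi> (single2 k \<one>\<^bsub>k\<^esub> m n) = \<chi> (single2 k \<one>\<^bsub>k\<^esub> m 0) \<otimes>\<^bsub>S\<^esub> \<chi> (single2 k \<one>\<^bsub>k\<^esub> 0 n)" for m n
    by (simp add: \<chi>_mult)
  have u_closed: "u1 \<in> carrier S" "u2 \<in> carrier S" "inv\<^bsub>S\<^esub> u1 \<in> carrier S" "inv\<^bsub>S\<^esub> u2 \<in> carrier S"
    unfolding v1 v2 by (simp_all only: u1_def u2_def \<chi>_closed)
  have W_single: "W (single2 A b m n) = x b \<otimes>\<^bsub>S\<^esub> \<chi> (single2 k \<one>\<^bsub>k\<^esub> m n)" if b: "b \<in> carrier A" for b m n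
  proof -
    have "single2 A b m n = single2 A b 0 0 \<otimes>\<^bsub>L\<^esub> \<iota>\<^sub>K (single2 k \<one>\<^bsub>k\<^esub> m n)"
      using b by (simp add: \<iota>\<^sub>K_single2 ring_hom_one[OF \<iota>] single2_mult[OF Ac])
    then show ?thesis
      using ring_hom_mult[OF W single2_closed[OF Ac b] ring_hom_closed[OF \<iota>\<^sub>K single2_closed[OF kc k.one_closed]]]
      by (simp add: W_A[OF b] W_K single2_closed[OF kc])
  qed
  have two_S: "\<one>\<^bsub>S\<^esub> \<oplus>\<^bsub>S\<^esub> \<one>\<^bsub>S\<^esub> \<in> Units S" by (rule two_Unit_hom[OF Ac S x C1.two_C])
  define h where "h = inv\<^bsub>S\<^esub> (\<one>\<^bsub>S\<^esub> \<oplus>\<^bsub>S\<^esub> \<one>\<^bsub>S\<^esub>)"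
  have h: "h \<in> carrier S" "(\<one>\<^bsub>S\<^esub> \<oplus>\<^bsub>S\<^esub> \<one>\<^bsub>S\<^esub>) \<otimes>\<^bsub>S\<^esub> h = \<one>\<^bsub>S\<^esub>" using two_S by (auto simp: h_def)
  have x_half: "x (half A c) = h \<otimes>\<^bsub>S\<^esub> x c" if "c \<in> carrier A" for c
    using half_hom[OF Ac S x C1.two_C that] by (simp add: half_def h_def)
  \<comment> \<open>4 = (1 + 1)(1 + 1), so its inverse is the square of \<open>h\<close>.\<close>
  have four: "inv\<^bsub>S\<^esub> ([(4::nat)] \<cdot>\<^bsub>S\<^esub> \<one>\<^bsub>S\<^esub>) = h \<otimes>\<^bsub>S\<^esub> h"
  proof (rule S.comm_inv_char)
    have "[(4::nat)] \<cdot>\<^bsub>S\<^esub> \<one>\<^bsub>S\<^esub> = (\<one>\<^bsub>S\<^esub> \<oplus>\<^bsub>S\<^esub> \<one>\<^bsub>S\<^esub>) \<otimes>\<^bsub>S\<^esub> (\<one>\<^bsub>S\<^esub> \<oplus>\<^bsub>S\<^esub> \<one>\<^bsub>S\<^esub>)"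
      by (simp add: numeral_eq_Suc S.l_distr S.r_distr S.a_assoc)
    also have "\<dots> \<otimes>\<^bsub>S\<^esub> (h \<otimes>\<^bsub>S\<^esub> h) = ((\<one>\<^bsub>S\<^esub> \<oplus>\<^bsub>S\<^esub> \<one>\<^bsub>S\<^esub>) \<otimes>\<^bsub>S\<^esub> h) \<otimes>\<^bsub>S\<^esub> ((\<one>\<^bsub>S\<^esub> \<oplus>\<^bsub>S\<^esub> \<one>\<^bsub>S\<^esub>) \<otimes>\<^bsub>S\<^esub> h)"
      using h(1) by algebra
    also have "\<dots> = \<one>\<^bsub>S\<^esub>" by (simp add: h(2))
    finally show "[(4::nat)] \<cdot>\<^bsub>S\<^esub> \<one>\<^bsub>S\<^esub> \<otimes>\<^bsub>S\<^esub> (h \<otimes>\<^bsub>S\<^esub> h) = \<one>\<^bsub>S\<^esub>" .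
  qed (use h(1) in auto)
  define y y\<^sub>\<theta> y\<^sub>\<eta> y\<^sub>\<theta>\<^sub>\<eta> where "y = x (a l)" and "y\<^sub>\<theta> = x (\<theta> (a l))" and "y\<^sub>\<eta> = x (\<eta> (a l))"
    and "y\<^sub>\<theta>\<^sub>\<eta> = x (\<theta> (\<eta> (a l)))"
  note y_defs = this
  have al: "a l \<in> carrier A" using l by simp
  have y: "y \<in> carrier S" "y\<^sub>\<theta> \<in> carrier S" "y\<^sub>\<eta> \<in> carrier S" "y\<^sub>\<theta>\<^sub>\<eta> \<in> carrier S"
    unfolding y_defs using al by (auto intro!: ring_hom_closed[OF x])
  note hom_simps = ring_hom_add[OF x] ring_hom_diff[OF A.ring_axioms S.ring_axioms x]
    ring_hom_add[OF \<eta>(1)] ring_hom_diff[OF A.ring_axioms A.ring_axioms \<eta>(1)]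
  have \<eta>_half: "\<eta> (half A c) = half A (\<eta> c)" if "c \<in> carrier A" for c
    by (rule half_hom[OF Ac Ac \<eta>(1) C1.two_C that, symmetric])
  \<comment> \<open>In the names, the first sign is that of \<theta> and the second that of \<eta>.
    Projecting for \<theta> and then for \<eta> produces \<eta> (\<theta> (a l)), which
    \<open>commute\<close> brings into the order used in
    \<open>y\<^sub>\<theta>\<^sub>\<eta>\<close>.\<close>
  have x_pp: "x (half A (half A (a l \<oplus>\<^bsub>A\<^esub> \<theta> (a l)) \<oplus>\<^bsub>A\<^esub> \<eta> (half A (a l \<oplus>\<^bsub>A\<^esub> \<theta> (a l)))))
      = h \<otimes>\<^bsub>S\<^esub> (h \<otimes>\<^bsub>S\<^esub> (y \<oplus>\<^bsub>S\<^esub> y\<^sub>\<theta>) \<oplus>\<^bsub>S\<^esub> h \<otimes>\<^bsub>S\<^esub> (y\<^sub>\<eta> \<oplus>\<^bsub>S\<^esub> y\<^sub>\<theta>\<^sub>\<eta>))"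
    and x_mp: "x (half A (half A (a l \<ominus>\<^bsub>A\<^esub> \<theta> (a l)) \<oplus>\<^bsub>A\<^esub> \<eta> (half A (a l \<ominus>\<^bsub>A\<^esub> \<theta> (a l)))))
      = h \<otimes>\<^bsub>S\<^esub> (h \<otimes>\<^bsub>S\<^esub> (y \<ominus>\<^bsub>S\<^esub> y\<^sub>\<theta>) \<oplus>\<^bsub>S\<^esub> h \<otimes>\<^bsub>S\<^esub> (y\<^sub>\<eta> \<ominus>\<^bsub>S\<^esub> y\<^sub>\<theta>\<^sub>\<eta>))"
    and x_pm: "x (half A (half A (a l \<oplus>\<^bsub>A\<^esub> \<theta> (a l)) \<ominus>\<^bsub>A\<^esub> \<eta> (half A (a l \<oplus>\<^bsub>A\<^esub> \<theta> (a l)))))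
      = h \<otimes>\<^bsub>S\<^esub> (h \<otimes>\<^bsub>S\<^esub> (y \<oplus>\<^bsub>S\<^esub> y\<^sub>\<theta>) \<ominus>\<^bsub>S\<^esub> h \<otimes>\<^bsub>S\<^esub> (y\<^sub>\<eta> \<oplus>\<^bsub>S\<^esub> y\<^sub>\<theta>\<^sub>\<eta>))"
    and x_mm: "x (half A (half A (a l \<ominus>\<^bsub>A\<^esub> \<theta> (a l)) \<ominus>\<^bsub>A\<^esub> \<eta> (half A (a l \<ominus>\<^bsub>A\<^esub> \<theta> (a l)))))
      = h \<otimes>\<^bsub>S\<^esub> (h \<otimes>\<^bsub>S\<^esub> (y \<ominus>\<^bsub>S\<^esub> y\<^sub>\<theta>) \<ominus>\<^bsub>S\<^esub> h \<otimes>\<^bsub>S\<^esub> (y\<^sub>\<eta> \<ominus>\<^bsub>S\<^esub> y\<^sub>\<theta>\<^sub>\<eta>))"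
    using al by (simp_all add: x_half \<eta>_half hom_simps y_defs commute)
  \<comment> \<open>The left-nested sums of \<open>point_matrix\<close> are regrouped into a pair at
    x and a pair at \<eta>x, the shape in which the two projections deliver them.\<close>
  have pp: "y \<oplus>\<^bsub>S\<^esub> y\<^sub>\<theta> \<oplus>\<^bsub>S\<^esub> y\<^sub>\<eta> \<oplus>\<^bsub>S\<^esub> y\<^sub>\<theta>\<^sub>\<eta> = (y \<oplus>\<^bsub>S\<^esub> y\<^sub>\<theta>) \<oplus>\<^bsub>S\<^esub> (y\<^sub>\<eta> \<oplus>\<^bsub>S\<^esub> y\<^sub>\<theta>\<^sub>\<eta>)" using y by algebra
  have mp: "y \<ominus>\<^bsub>S\<^esub> y\<^sub>\<theta> \<oplus>\<^bsub>S\<^esub> y\<^sub>\<eta> \<ominus>\<^bsub>S\<^esub> y\<^sub>\<theta>\<^sub>\<eta> = (y \<ominus>\<^bsub>S\<^esub> y\<^sub>\<theta>) \<oplus>\<^bsub>S\<^esub> (y\<^sub>\<eta> \<ominus>\<^bsub>S\<^esub> y\<^sub>\<theta>\<^sub>\<eta>)" using y by algebra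
  have pm: "y \<oplus>\<^bsub>S\<^esub> y\<^sub>\<theta> \<ominus>\<^bsub>S\<^esub> y\<^sub>\<eta> \<ominus>\<^bsub>S\<^esub> y\<^sub>\<theta>\<^sub>\<eta> = (y \<oplus>\<^bsub>S\<^esub> y\<^sub>\<theta>) \<ominus>\<^bsub>S\<^esub> (y\<^sub>\<eta> \<oplus>\<^bsub>S\<^esub> y\<^sub>\<theta>\<^sub>\<eta>)" using y by algebra
  have mm: "y \<ominus>\<^bsub>S\<^esub> y\<^sub>\<theta> \<ominus>\<^bsub>S\<^esub> y\<^sub>\<eta> \<oplus>\<^bsub>S\<^esub> y\<^sub>\<theta>\<^sub>\<eta> = (y \<ominus>\<^bsub>S\<^esub> y\<^sub>\<theta>) \<ominus>\<^bsub>S\<^esub> (y\<^sub>\<eta> \<ominus>\<^bsub>S\<^esub> y\<^sub>\<theta>\<^sub>\<eta>)" using y by algebra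
  \<comment> \<open>The exponents of u_1 and u_2 as in \<open>coords_eq\<close>. Below,
    \<open>t\<close> is the value of this monomial and \<open>z\<close> the signed sum.\<close>
  let ?m = "if p' = q' then 0 else if (p', q') = (1, 2) then 1 else - 1 :: int"
  let ?n = "if p = q then 0 else if (p, q) = (1, 2) then 1 else - 1 :: int"
  define t where "t = \<chi> (single2 k \<one>\<^bsub>k\<^esub> ?m ?n)"
  have t_closed: "t \<in> carrier S" unfolding t_def by (rule \<chi>_closed)
  define z where "z = (if p = q
    then if p' = q' then y \<oplus>\<^bsub>S\<^esub> y\<^sub>\<theta> \<oplus>\<^bsub>S\<^esub> y\<^sub>\<eta> \<oplus>\<^bsub>S\<^esub> y\<^sub>\<theta>\<^sub>\<eta> else y \<ominus>\<^bsub>S\<^esub> y\<^sub>\<theta> \<oplus>\<^bsub>S\<^esub> y\<^sub>\<eta> \<ominus>\<^bsub>S\<^esub> y\<^sub>\<theta>\<^sub>\<eta>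
    else if p' = q' then y \<oplus>\<^bsub>S\<^esub> y\<^sub>\<theta> \<ominus>\<^bsub>S\<^esub> y\<^sub>\<eta> \<ominus>\<^bsub>S\<^esub> y\<^sub>\<theta>\<^sub>\<eta> else y \<ominus>\<^bsub>S\<^esub> y\<^sub>\<theta> \<ominus>\<^bsub>S\<^esub> y\<^sub>\<eta> \<oplus>\<^bsub>S\<^esub> y\<^sub>\<theta>\<^sub>\<eta>)"
  have "W (coords v) = h \<otimes>\<^bsub>S\<^esub> h \<otimes>\<^bsub>S\<^esub> (t \<otimes>\<^bsub>S\<^esub> z)"
    unfolding v_eq coords_eq[OF l pq] Let_def
  proof (subst W_single)
    let ?c = "if p' = q' then half A (a l \<oplus>\<^bsub>A\<^esub> \<theta> (a l)) else half A (a l \<ominus>\<^bsub>A\<^esub> \<theta> (a l))"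
    show "half A (if p = q then ?c \<oplus>\<^bsub>A\<^esub> \<eta> ?c else ?c \<ominus>\<^bsub>A\<^esub> \<eta> ?c) \<in> carrier A"
      using al by simp
    have "x (half A (if p = q then ?c \<oplus>\<^bsub>A\<^esub> \<eta> ?c else ?c \<ominus>\<^bsub>A\<^esub> \<eta> ?c)) \<otimes>\<^bsub>S\<^esub> t = h \<otimes>\<^bsub>S\<^esub> h \<otimes>\<^bsub>S\<^esub> (t \<otimes>\<^bsub>S\<^esub> z)"
      unfolding z_def pp mp pm mm
      using y by (simp add: x_pp x_mp x_pm x_mm double_half_scaled[OF S h(1) t_closed])
    then show "x (half A (if p = q then ?c \<oplus>\<^bsub>A\<^esub> \<eta> ?c else ?c \<ominus>\<^bsub>A\<^esub> \<eta> ?c)) \<otimes>\<^bsub>S\<^esub>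
        \<chi> (single2 k \<one>\<^bsub>k\<^esub> ?m ?n) = h \<otimes>\<^bsub>S\<^esub> h \<otimes>\<^bsub>S\<^esub> (t \<otimes>\<^bsub>S\<^esub> z)"
      by (simp only: t_def)
  qed
  also have "t \<otimes>\<^bsub>S\<^esub> z = point_matrix S u1 u2 y y\<^sub>\<theta> y\<^sub>\<eta> y\<^sub>\<theta>\<^sub>\<eta> (2 * (p - 1) + p') (2 * (q - 1) + q')"
  proof -
    have t: "t = (if p' = q' then \<one>\<^bsub>S\<^esub> else if (p', q') = (1, 2) then u1 else inv\<^bsub>S\<^esub> u1) \<otimes>\<^bsub>S\<^esub>
        (if p = q then \<one>\<^bsub>S\<^esub> else if (p, q) = (1, 2) then u2 else inv\<^bsub>S\<^esub> u2)"
      unfolding t_def u[of ?m ?n] v1 v2 by (simp add: u1_def u2_def \<chi>_one)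
    \<comment> \<open>Row 2(p - 1) + p' and column 2(q - 1) + q' run through 1, ..., 4, and the
      sixteen entries are evaluated one by one.\<close>
    show ?thesis
      using pq y u_closed unfolding t z_def point_matrix_def Let_def
      by (elim insertE emptyE) simp_all
  qed
  finally show ?thesis
    by (simp only: v_eq matrix_point_def prod.case four y_defs u1_def u2_def)
qed

text \<open>Both sides are homomorphisms on a tensor product of \<open>P\<close> and
  \<open>K\<close>, so they are compared on the two factors. On \<open>P\<close> the constants
  reduce to \<open>K\<close> by balancedness, and the variables reduce to
  \<open>matrix_point_identity\<close>.\<close>

lemma base_change_on_points:
  fixes S :: "('s, 'sx) ring_scheme"
  assumes S: "cring S" and \<chi>: "\<chi> \<in> ring_hom K S" and x: "x \<in> ring_hom A S"
    and bal: "\<forall>r \<in> carrier k. x (\<iota> r) = \<chi> (single2 k r 0 0)" and w: "w \<in> carrier TP.T"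
  shows "tensor_lift S x \<chi> (inv_into (carrier TA.T) \<Phi>\<^sub>A (\<Phi> (e\<^sub>2 w)))
    = mpoly_eval K S \<chi> (matrix_point k S \<chi> \<theta> \<eta> a x) (\<Psi> w)"
proof -
  interpret S: cring S by fact
  obtain G where G: "G \<in> ring_hom L TA.T"
    "\<And>y. y \<in> carrier L \<Longrightarrow> inv_into (carrier TA.T) \<Phi>\<^sub>A y = G y"
    "\<And>b. b \<in> carrier A \<Longrightarrow> G (single2 A b 0 0) = TA.pt b \<one>\<^bsub>K\<^esub>"
    "\<And>c. c \<in> carrier K \<Longrightarrow> G (\<iota>\<^sub>K c) = TA.pt \<one>\<^bsub>A\<^esub> c"
    by (rule \<Phi>\<^sub>A_iso_inverse) (rule that)
  have TS: "tensor_lift S x \<chi> \<in> ring_hom TA.T S"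
    "\<And>b c. b \<in> carrier A \<Longrightarrow> c \<in> carrier K \<Longrightarrow> tensor_lift S x \<chi> (TA.pt b c) = x b \<otimes>\<^bsub>S\<^esub> \<chi> c"
    using TA.tensor_lift[OF S x \<chi>] bal by blast+
  \<comment> \<open>The point given by \<open>x\<close> and \<chi>, transported from the tensor
    product of \<open>A\<close> and \<open>K\<close> to \<open>L\<close>.\<close>
  define W where "W = tensor_lift S x \<chi> \<circ> G"
  have W: "W \<in> ring_hom L S" unfolding W_def by (rule ring_hom_trans[OF G(1) TS(1)])
  have W_A: "W (single2 A b 0 0) = x b" if b: "b \<in> carrier A" for b
    using TS(2)[OF b K.one_closed] ring_hom_closed[OF x b] G(3)[OF b]
    by (simp add: W_def ring_hom_one[OF \<chi>])
  have W_K: "W (\<iota>\<^sub>K c) = \<chi> c" if c: "c \<in> carrier K" for c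
    using TS(2)[OF A.one_closed c] ring_hom_closed[OF \<chi> c] G(4)[OF c]
    by (simp add: W_def ring_hom_one[OF x])
  have mp: "W (coords v) = matrix_point k S \<chi> \<theta> \<eta> a x v" if "v \<in> V" for v
    using W_A W_K by (rule matrix_point_identity[OF S \<chi> x W _ _ that])
  have coords: "coords v \<in> carrier B" if "v \<in> V" for v
    using C2.coord_closed[OF that] coord1_closed by blast
  have mp_closed: "matrix_point k S \<chi> \<theta> \<eta> a x v \<in> carrier S" if v: "v \<in> V" for v
    unfolding mp[OF v, symmetric] by (rule ring_hom_closed[OF W ring_hom_closed[OF incl_B coords[OF v]]])
  let ?M = "mpoly_eval K S \<chi> (matrix_point k S \<chi> \<theta> \<eta> a x)"
  have M: "?M \<in> ring_hom Q S" "\<And>c. c \<in> carrier K \<Longrightarrow> ?M (mpoly_const K c) = \<chi> c"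
    "\<And>v. v \<in> V \<Longrightarrow> ?M (mpoly_var K v) = matrix_point k S \<chi> \<theta> \<eta> a x v"
    by (rule mpoly_eval_hom[of K S \<chi> V, OF K.cring_axioms S \<chi>]; (rule mp_closed)?; assumption)+
  have F: "W \<circ> \<Phi> \<circ> e\<^sub>2 \<in> ring_hom TP.T S"
    by (intro ring_hom_trans[OF e\<^sub>2_hom ring_hom_trans[OF \<Phi>_hom W], folded comp_assoc])
  have M': "?M \<circ> \<Psi> \<in> ring_hom TP.T S"
    by (rule ring_hom_trans[OF \<Psi>_hom M(1)])
  have right: "(W \<circ> \<Phi> \<circ> e\<^sub>2) (TP.pt \<one>\<^bsub>P\<^esub> c) = (?M \<circ> \<Psi>) (TP.pt \<one>\<^bsub>P\<^esub> c)" if c: "c \<in> carrier K" for c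
    by (simp only: comp_apply e\<^sub>2_right[OF c] \<Phi>_right[OF c] W_K[OF c] \<Psi>_right[OF c] M(2)[OF c])
  have left: "(W \<circ> \<Phi> \<circ> e\<^sub>2) (TP.pt p \<one>\<^bsub>K\<^esub>) = (?M \<circ> \<Psi>) (TP.pt p \<one>\<^bsub>K\<^esub>)" if p: "p \<in> carrier P" for p
  proof -
    let ?l = "\<lambda>p. TP.pt p \<one>\<^bsub>K\<^esub>"
    have "((W \<circ> \<Phi> \<circ> e\<^sub>2) \<circ> ?l) p = ((?M \<circ> \<Psi>) \<circ> ?l) p"
    proof (rule mpoly_hom_eqI[OF Rt.cring_axioms S ring_hom_trans[OF TP.pt_left_hom F]
          ring_hom_trans[OF TP.pt_left_hom M'] _ _ p])
      show "((W \<circ> \<Phi> \<circ> e\<^sub>2) \<circ> ?l) (mpoly_const Rt r) = ((?M \<circ> \<Psi>) \<circ> ?l) (mpoly_const Rt r)"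
        if r: "r \<in> carrier Rt" for r
        using right[OF ring_hom_closed[OF \<kappa>_hom r]]
        by (simp only: comp_apply TP.pt_balanced[OF r])
      show "((W \<circ> \<Phi> \<circ> e\<^sub>2) \<circ> ?l) (mpoly_var Rt v) = ((?M \<circ> \<Psi>) \<circ> ?l) (mpoly_var Rt v)"
        if v: "v \<in> V" for v
      proof -
        note var = mpoly_var_closed[OF Rt.cring_axioms v]
        have "((W \<circ> \<Phi> \<circ> e\<^sub>2) \<circ> ?l) (mpoly_var Rt v) = W (coords v)"
          by (simp only: comp_apply e\<^sub>2_left[OF var] e_var[OF v] \<Phi>_left[OF coords[OF v]])
        also have "\<dots> = ((?M \<circ> \<Psi>) \<circ> ?l) (mpoly_var Rt v)"
          by (simp only: comp_apply \<Psi>_left[OF var] coeff_map_var M(3)[OF v] mp[OF v])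
        finally show ?thesis .
      qed
    qed
    then show ?thesis by (simp only: comp_apply)
  qed
  have "(W \<circ> \<Phi> \<circ> e\<^sub>2) w = (?M \<circ> \<Psi>) w"
    by (rule TP.tensor_hom_eqI[OF S F M' left right w])
  moreover have "\<Phi> (e\<^sub>2 w) \<in> carrier L"
    by (rule ring_hom_closed[OF \<Phi>_hom ring_hom_closed[OF e\<^sub>2_hom w]])
  ultimately show ?thesis
    by (simp only: comp_apply W_def G(2))
qed

end

text \<open>A compatible pair of \<open>x\<close> and \<chi> is an \<open>S\<close>-point of the
  base change of X. Among them is the universal point, where \<open>S\<close> is
  \<open>A\<^sub>2\<close> and the pair consists of the two maps into the tensor product; there
  \<open>tensor_lift S x \<chi>\<close> is the identity on \<open>A\<^sub>2\<close>, so the last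
  conjunct determines the morphism itself.\<close>

theorem corollary2p14:
  fixes k :: "('k, 'kx) ring_scheme" and A :: "('a, 'ax) ring_scheme"
    and \<iota> :: "'k \<Rightarrow> 'a" and \<theta> \<eta> :: "'a \<Rightarrow> 'a"
    and \<Lambda> :: "'l set" and a :: "'l \<Rightarrow> 'a"
    and S :: "('s, 'sx) ring_scheme"
  assumes "cring k" and "\<one>\<^bsub>k\<^esub> \<oplus>\<^bsub>k\<^esub> \<one>\<^bsub>k\<^esub> \<in> Units k"
    and "cring A" and "\<iota> \<in> ring_hom k A"
    and "involution_over k A \<iota> \<theta>" and "involution_over k A \<iota> \<eta>"
    and "\<forall>b \<in> carrier A. \<theta> (\<eta> b) = \<eta> (\<theta> b)"
    and "generates_algebra k A \<iota> (a ` \<Lambda>)"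
    and "cring S"
  shows
    "let
       R = UP (UP k);  \<comment> \<open>\<open>k[t\<^sub>1, t\<^sub>2]\<close>\<close>
       K = laurent2 k;  \<comment> \<open>as an \<open>R\<close>-algebra via \<open>\<kappa>\<^sub>1\<close>: \<open>k[t\<^sub>1\<^sup>\<plusminus>\<^sup>1, t\<^sub>2\<^sup>\<plusminus>\<^sup>1]\<close>; via \<open>\<kappa>\<^sub>2\<close>: \<open>k[\<surd>t\<^sub>1\<^sup>\<plusminus>\<^sup>1, \<surd>t\<^sub>2\<^sup>\<plusminus>\<^sup>1]\<close>\<close>
       \<kappa>\<^sub>1 = poly2_to_laurent2 k 1;
       \<kappa>\<^sub>2 = poly2_to_laurent2 k 2;
       L = laurent2 A;  \<comment> \<open>\<open>A[\<surd>t\<^sub>1\<^sup>\<plusminus>\<^sup>1, \<surd>t\<^sub>2\<^sup>\<plusminus>\<^sup>1]\<close>\<close>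
       B = contraction2 k A \<iota> \<theta> \<eta>;
       \<beta> = contraction2_structure k A \<iota> \<theta>;
       V = block_vars (block_vars \<Lambda>);
       P = mpoly R V;
       e = contraction2_embedding k A \<iota> \<theta> \<eta> a;
       B\<^sub>1 = tensor R B \<beta> K \<kappa>\<^sub>1;
       B\<^sub>2 = tensor R B \<beta> K \<kappa>\<^sub>2;
       P\<^sub>2 = tensor R P (mpoly_const R) K \<kappa>\<^sub>2;
       A\<^sub>2 = tensor k A \<iota> K (\<lambda>r. single2 k r 0 0);
       e\<^sub>2 = tensor_lift B\<^sub>2 (\<lambda>f. pure_tensor R B \<beta> K \<kappa>\<^sub>2 (e f) \<one>\<^bsub>K\<^esub>)
                             (\<lambda>c. pure_tensor R B \<beta> K \<kappa>\<^sub>2 \<one>\<^bsub>B\<^esub> c);  \<comment> \<open>the base change \<open>P\<^sub>2 \<rightarrow> B\<^sub>2\<close> of \<open>e\<close>\<close>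
       \<Phi> = tensor_lift L (\<lambda>b. b) (\<lambda>f m n. \<iota> (f m n));  \<comment> \<open>\<open>B\<^sub>2 \<rightarrow> L\<close>, induced by \<open>B \<subseteq> L\<close>\<close>
       \<Phi>\<^sub>A = tensor_lift L (\<lambda>b. single2 A b 0 0) (\<lambda>f m n. \<iota> (f m n));  \<comment> \<open>\<open>A\<^sub>2 \<rightarrow> L\<close>\<close>
       \<Psi> = tensor_lift (mpoly K V) (\<lambda>f m. \<kappa>\<^sub>2 (f m)) (mpoly_const K)  \<comment> \<open>\<open>P\<^sub>2 \<rightarrow> K[x\<^sub>v; v \<in> V]\<close>\<close>
     in
       closed_immersion P B e
     \<and> scheme_closure P B\<^sub>1 (\<lambda>f. pure_tensor R B \<beta> K \<kappa>\<^sub>1 (e f) \<one>\<^bsub>K\<^esub>) (a_kernel P B e)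
     \<and> closed_immersion P\<^sub>2 B\<^sub>2 e\<^sub>2
     \<and> \<Phi> \<in> ring_iso B\<^sub>2 L \<and> \<Phi>\<^sub>A \<in> ring_iso A\<^sub>2 L \<and> \<Psi> \<in> ring_iso P\<^sub>2 (mpoly K V)
     \<and> (\<forall>\<chi> \<in> ring_hom K S. \<forall>x \<in> ring_hom A S.
          (\<forall>r \<in> carrier k. x (\<iota> r) = \<chi> (single2 k r 0 0)) \<longrightarrow>
          (\<forall>w \<in> carrier P\<^sub>2.
             tensor_lift S x \<chi> (inv_into (carrier A\<^sub>2) \<Phi>\<^sub>A (\<Phi> (e\<^sub>2 w)))
             = mpoly_eval K S \<chi> (matrix_point k S \<chi> \<theta> \<eta> a x) (\<Psi> w)))"
proof -
  interpret twofold_embedding k A \<iota> \<theta> \<eta> \<Lambda> a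
    using assms
    by (simp add: twofold_embedding_def twofold_embedding_axioms_def twofold_contraction_def
        twofold_contraction_axioms_def)
  have \<Phi>\<^sub>A_iso: "\<Phi>\<^sub>A \<in> ring_iso TA.T L" by (rule \<Phi>\<^sub>A_iso_inverse)
  show ?thesis
    unfolding Let_def
    by (intro conjI ballI impI e_closed_immersion e_closure e\<^sub>2_closed_immersion \<Phi>_iso \<Phi>\<^sub>A_iso \<Psi>_iso
        base_change_on_points[OF \<open>cring S\<close>]) (assumption | erule (1) bspec)+
qed

end
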